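(* Let $X$ be the stationary homogeneous Ornstein–Uhlenbeck process with the perturbation described in the context. Let $$w(x)=-\pi\big(2\pi\det(\Sigma)\big)^{-1}\partial_h|_{h=0}\det(\Sigma_h)-\tilde g^TB^{-T}\Sigma^{-1}(x-m)-\frac12(x-m)^T\big(\partial_h|_{h=0}\Sigma_h^{-1}\big)(x-m).$$ Then for any $0\le s\le t\le T$ and $f\in D(\mathcal{A})\cap C^{2+\theta}_b(\mathbb{R}^d)$ (for some $\theta\in(0,1)$), $$R_f(s,t)=\frac{\partial}{\partial s}\mathbb{E}\,f(X_t)w(X_s).$$
   Context: Fix $T>0$. $X$ solves $dX_t=(BX_t+g)dt+AdW_t$ with $g\in\mathbb{R}^d$, $A\in M_{d\times n}(\mathbb{R})$, $W$ an $n$-dimensional Brownian motion, $B\in M_{d\times d}(\mathbb{R})$ symmetric with all eigenvalues negative; $a=AA^T$ satisfies $\xi^Ta\xi\ge\lambda|\xi|^2$ for some $\lambda>0$. For $h\in\mathbb{R}$ let $m_h=-B^{-1}(g+h\tilde g)$ and $\Sigma_h=\int_0^\infty e^{sB}(a+h\tilde a)e^{sB^T}ds$, where $\tilde g\in\mathbb{R}^d$ and $\tilde a\in M_{d\times d}(\mathbb{R})$ are fixed; $m=m_0$, $\Sigma=\Sigma_0$. $X$ is stationary: $X_0$ is Gaussian with mean $m$ and covariance $\Sigma$. Perturbed process: for $h\in C[0,T]$ with $\sup|h|\le1$, $X^h$ is the diffusion with drift $Bx+g+h(t)\tilde g$ and diffusion coefficient $a+h(t)\tilde a$, with the same initial distribution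 as $X$. Weak generator: with $P_tf(x)=\mathbb{E}[f(X_t)\mid X_0=x]$, $f\in C_b(\mathbb{R}^d)$ belongs to $D(\mathcal{A})$ if $\sup_{\epsilon>0}\|\epsilon^{-1}(P_\epsilon f-f)\|_\infty<\infty$ and $\epsilon^{-1}(P_\epsilon f(x)-f(x))$ converges pointwise as $\epsilon\downarrow0$ to some $u\in C_b(\mathbb{R}^d)$. $C^{2+\theta}_b$: bounded $C^2$ functions with bounded derivatives up to order $2$ whose second derivatives are bounded and $\theta$-Hölder. Response function: for $t\in[0,T]$ let $F_t(h)=\mathbb{E}f(X^h_t)$; $R_f(\cdot,t)$, locally integrable on $(0,t)$, is the response function of $f$ if for all $\varphi\in C_c^\infty(0,t)$, $\lim_{\epsilon\to0}\epsilon^{-1}(F_t(\epsilon\varphi)-F_t(0))=\int_0^tR_f(s,t)\varphi(s)ds$. *)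

theory Defs
  imports "HOL-Analysis.Analysis" "HOL-Probability.Probability"
begin

primrec mpow :: "real^'d^'d \<Rightarrow> nat \<Rightarrow> real^'d^'d" where
  "mpow M 0 = mat 1"
| "mpow M (Suc k) = M ** mpow M k"

definition mexp :: "real^'d^'d \<Rightarrow> real^'d^'d" where
  "mexp M = (\<Sum>k. (1 / fact k) *\<^sub>R mpow M k)"

definition eigenvalues_negative :: "real^'d^'d \<Rightarrow> bool" where
  "eigenvalues_negative B \<longleftrightarrow> (\<forall>l. (\<exists>v. v \<noteq> 0 \<and> B *v v = l *\<^sub>R v) \<longrightarrow> l < 0)"

definition Sigma_h :: "real^'d^'d \<Rightarrow> real^'d^'d \<Rightarrow> real^'d^'d \<Rightarrow> real \<Rightarrow> real^'d^'d" where
  "Sigma_h B a atl h = integral {0..} (\<lambda>s. mexp (s *\<^sub>R B) ** (a + h *\<^sub>R atl) ** transpose (mexp (s *\<^sub>R B)))"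

definition w_fun :: "real^'d^'d \<Rightarrow> real^'d \<Rightarrow> real^'d \<Rightarrow> real^'d^'d \<Rightarrow> real^'d^'d \<Rightarrow> real^'d \<Rightarrow> real" where
  "w_fun B g gt a atl x =
     (let m = - (matrix_inv B *v g); S = Sigma_h B a atl 0 in
      - pi * inverse (2 * pi * det S) * deriv (\<lambda>h. det (Sigma_h B a atl h)) 0
      - gt \<bullet> (transpose (matrix_inv B) *v (matrix_inv S *v (x - m)))
      - (1/2) * ((x - m) \<bullet> (vector_derivative (\<lambda>h. matrix_inv (Sigma_h B a atl h)) (at 0) *v (x - m))))"

definition pd :: "'d::finite \<Rightarrow> (real^'d \<Rightarrow> real) \<Rightarrow> real^'d \<Rightarrow> real" where
  "pd i f x = deriv (\<lambda>s. f (x + s *\<^sub>R axis i 1)) 0"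

definition partially_differentiable :: "(real^'d::finite \<Rightarrow> real) \<Rightarrow> bool" where
  "partially_differentiable f \<longleftrightarrow> (\<forall>i x. (\<lambda>s. f (x + s *\<^sub>R axis i 1)) differentiable (at 0))"

definition C2 :: "(real^'d::finite \<Rightarrow> real) \<Rightarrow> bool" where
  "C2 f \<longleftrightarrow> continuous_on UNIV f \<and> partially_differentiable f \<and>
     (\<forall>i. continuous_on UNIV (pd i f) \<and> partially_differentiable (pd i f) \<and>
        (\<forall>j. continuous_on UNIV (pd j (pd i f))))"

definition C2c :: "(real^'d::finite \<Rightarrow> real) \<Rightarrow> bool" where
  "C2c f \<longleftrightarrow> C2 f \<and> compact (closure {x. f x \<noteq> 0})"

definition C2theta_b :: "real \<Rightarrow> (real^'d::finite \<Rightarrow> real) \<Rightarrow> bool" where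
  "C2theta_b \<theta> f \<longleftrightarrow> C2 f \<and> bounded (range f) \<and>
     (\<forall>i. bounded (range (pd i f)) \<and> (\<forall>j. bounded (range (pd j (pd i f))) \<and>
        (\<exists>C. \<forall>x y. \<bar>pd j (pd i f) x - pd j (pd i f) y\<bar> \<le> C * norm (x - y) powr \<theta>)))"

definition Cc_inf_interval :: "real \<Rightarrow> (real \<Rightarrow> real) \<Rightarrow> bool" where
  "Cc_inf_interval t \<phi> \<longleftrightarrow> (\<forall>k x. ((deriv ^^ k) \<phi>) differentiable (at x)) \<and>
      compact (closure {s. \<phi> s \<noteq> 0}) \<and> closure {s. \<phi> s \<noteq> 0} \<subseteq> {0<..<t}"

definition gaussian_vec :: "'a measure \<Rightarrow> ('a \<Rightarrow> real^'d::finite) \<Rightarrow> real^'d \<Rightarrow> real^'d^'d \<Rightarrow> bool" where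
  "gaussian_vec M Z \<mu> C \<longleftrightarrow> Z \<in> borel_measurable M \<and>
     (\<forall>\<xi>. if 0 < \<xi> \<bullet> (C *v \<xi>)
           then distributed M lborel (\<lambda>\<omega>. \<xi> \<bullet> Z \<omega>) (normal_density (\<xi> \<bullet> \<mu>) (sqrt (\<xi> \<bullet> (C *v \<xi>))))
           else (AE \<omega> in M. \<xi> \<bullet> Z \<omega> = \<xi> \<bullet> \<mu>))"

definition brownian_indep :: "'a measure \<Rightarrow> ('a \<Rightarrow> real^'d::finite) \<Rightarrow> (real \<Rightarrow> 'a \<Rightarrow> real^'n::finite) \<Rightarrow> bool" where
  "brownian_indep M X0 W \<longleftrightarrow>
     (\<forall>\<omega>\<in>space M. W 0 \<omega> = 0 \<and> continuous_on {0..} (\<lambda>t. W t \<omega>)) \<and>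
     (\<forall>t\<ge>0. (W t) \<in> borel_measurable M) \<and>
     (\<forall>s t. 0 \<le> s \<and> s < t \<longrightarrow> gaussian_vec M (\<lambda>\<omega>. W t \<omega> - W s \<omega>) 0 ((t - s) *\<^sub>R mat 1)) \<and>
     (\<forall>(k::nat) \<tau>. \<tau> 0 = 0 \<and> (\<forall>i<k. \<tau> i < \<tau> (Suc i)) \<longrightarrow>
        prob_space.indep_vars M (\<lambda>_. borel)
          (\<lambda>i \<omega>. if i = 0 then (X0 \<omega>, 0) else (0, W (\<tau> i) \<omega> - W (\<tau> (i - 1)) \<omega>)) {0..k})"

text \<open>Y solves dY = (B Y + g) dt + A dW (pathwise integral form; A constant).\<close>
definition ou_sde_sol :: "'a measure \<Rightarrow> real^'d^'d \<Rightarrow> real^'d \<Rightarrow> real^'n^'d \<Rightarrow> (real \<Rightarrow> 'a \<Rightarrow> real^'n::finite)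
     \<Rightarrow> (real \<Rightarrow> 'a \<Rightarrow> real^'d::finite) \<Rightarrow> bool" where
  "ou_sde_sol M B g A W Y \<longleftrightarrow>
     (\<forall>t\<ge>0. (Y t) \<in> borel_measurable M) \<and>
     (\<forall>\<omega>\<in>space M. continuous_on {0..} (\<lambda>t. Y t \<omega>) \<and>
        (\<forall>t\<ge>0. Y t \<omega> = Y 0 \<omega> + integral {0..t} (\<lambda>r. B *v Y r \<omega> + g) + A *v W t \<omega>))"

definition weak_gen_domain :: "(real \<Rightarrow> (real^'d::finite \<Rightarrow> real) \<Rightarrow> real^'d \<Rightarrow> real) \<Rightarrow> (real^'d \<Rightarrow> real) \<Rightarrow> bool" where
  "weak_gen_domain P f \<longleftrightarrow> continuous_on UNIV f \<and> bounded (range f) \<and>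
     (\<exists>C. \<forall>\<epsilon>>0. \<forall>x. \<bar>(P \<epsilon> f x - f x) / \<epsilon>\<bar> \<le> C) \<and>
     (\<exists>u. continuous_on UNIV u \<and> bounded (range u) \<and>
        (\<forall>x. ((\<lambda>\<epsilon>. (P \<epsilon> f x - f x) / \<epsilon>) \<longlongrightarrow> u x) (at_right 0)))"

definition in_OU_gen_domain :: "'a measure \<Rightarrow> real^'d^'d \<Rightarrow> real^'d \<Rightarrow> real^'n^'d \<Rightarrow> (real \<Rightarrow> 'a \<Rightarrow> real^'n::finite)
     \<Rightarrow> (real^'d::finite \<Rightarrow> real) \<Rightarrow> bool" where
  "in_OU_gen_domain M B g A W f \<longleftrightarrow>
     (\<forall>Y. (\<forall>x. ou_sde_sol M B g A W (Y x) \<and> (\<forall>\<omega>\<in>space M. Y x 0 \<omega> = x)) \<longrightarrow>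
        weak_gen_domain (\<lambda>t f x. \<integral>\<omega>. f (Y x t \<omega>) \<partial>M) f)"

definition diff_gen :: "(real \<Rightarrow> real^'d \<Rightarrow> real^'d) \<Rightarrow> (real \<Rightarrow> real^'d^'d) \<Rightarrow> real
     \<Rightarrow> (real^'d::finite \<Rightarrow> real) \<Rightarrow> real^'d \<Rightarrow> real" where
  "diff_gen b c r f x = (\<Sum>i\<in>UNIV. b r x $ i * pd i f x) + (1/2) * (\<Sum>i\<in>UNIV. \<Sum>j\<in>UNIV. c r $ i $ j * pd j (pd i f) x)"

definition nat_filtration :: "'a measure \<Rightarrow> (real \<Rightarrow> 'a \<Rightarrow> real^'d::finite) \<Rightarrow> real \<Rightarrow> 'a measure" where
  "nat_filtration M X s = sigma (space M) {X r -` A \<inter> space M | r A. r \<in> {0..s} \<and> A \<in> sets borel}"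

definition diffusion_sol :: "'a measure \<Rightarrow> real \<Rightarrow> (real \<Rightarrow> real^'d \<Rightarrow> real^'d) \<Rightarrow> (real \<Rightarrow> real^'d^'d)
     \<Rightarrow> (real \<Rightarrow> 'a \<Rightarrow> real^'d::finite) \<Rightarrow> bool" where
  "diffusion_sol M T b c X \<longleftrightarrow>
     (\<forall>t\<in>{0..T}. (X t) \<in> borel_measurable M) \<and>
     (\<forall>\<omega>\<in>space M. continuous_on {0..T} (\<lambda>t. X t \<omega>)) \<and>
     (\<forall>f. C2c f \<longrightarrow>
        (let Mf = (\<lambda>t \<omega>. f (X t \<omega>) - f (X 0 \<omega>) - integral {0..t} (\<lambda>r. diff_gen b c r f (X r \<omega>))) in
         (\<forall>t\<in>{0..T}. integrable M (Mf t)) \<and>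
         (\<forall>s t. 0 \<le> s \<and> s \<le> t \<and> t \<le> T \<longrightarrow>
            (\<forall>F\<in>sets (nat_filtration M X s). (\<integral>\<omega>\<in>F. Mf t \<omega> \<partial>M) = (\<integral>\<omega>\<in>F. Mf s \<omega> \<partial>M)))))"

text \<open>R is the response function of F at time t (F h = E f(X^h_t)).\<close>
definition is_response :: "real \<Rightarrow> ((real \<Rightarrow> real) \<Rightarrow> real) \<Rightarrow> (real \<Rightarrow> real) \<Rightarrow> bool" where
  "is_response t F R \<longleftrightarrow>
     (\<forall>K. compact K \<and> K \<subseteq> {0<..<t} \<longrightarrow> set_integrable lborel K R) \<and>
     (\<forall>\<phi>. Cc_inf_interval t \<phi> \<longrightarrow>
        ((\<lambda>\<epsilon>. (F (\<lambda>r. \<epsilon> * \<phi> r) - F (\<lambda>_. 0)) / \<epsilon>) \<longlongrightarrow> (\<integral>s\<in>{0<..<t}. R s * \<phi> s \<partial>lborel)) (at 0))"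

end

theory Submission
  imports Defs
begin

text \<open>
  Everything reduces to finite-dimensional Gaussian laws.  Write \<open>Y = X\<^sub>0 - m\<close> and
  \<open>E\<^sub>s = exp ((t - s) B)\<close>.

  On the perturbed side, plane waves whose frequency moves along \<open>z' = - B z\<close> solve the backward
  equation, so the martingale problem determines the characteristic function of \<open>X\<^sup>h\<^sub>t\<close>: it is Gaussian
  with mean \<open>m + u\<close> and covariance \<open>\<Sigma> + Q\<close>, where \<open>u\<close> and \<open>Q\<close> are the integrals over \<open>[0, t]\<close> of
  \<open>h(s) E\<^sub>s gt\<close> and \<open>h(s) E\<^sub>s atl E\<^sub>s\<close>.  For \<open>h = \<epsilon> \<phi>\<close> both are linear in \<open>\<epsilon>\<close>, and Stein's identity
  turns the derivative of \<open>E f(X\<^sup>h\<^sub>t)\<close> at \<open>\<epsilon> = 0\<close> into the pairing of \<open>f (m + Y)\<close> with the Gaussian score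
  in the direction \<open>(u, Q)\<close>.

  On the stationary side, \<open>X\<^sub>s - m - C (X\<^sub>t - m)\<close> with \<open>C = \<Sigma> E\<^sub>s \<Sigma>\<^sup>-\<^sup>1\<close> is independent of \<open>X\<^sub>t\<close>.  As \<open>w\<close> is a
  quadratic polynomial, \<open>E f(X\<^sub>t) w(X\<^sub>s)\<close> is, up to a constant, the pairing of \<open>f (m + Y)\<close> with the score
  in the direction \<open>(- E\<^sub>s B\<^sup>-\<^sup>1 gt, E\<^sub>s \<Sigma>' E\<^sub>s)\<close>, where \<open>\<Sigma>'\<close> is the derivative of \<open>\<Sigma>\<^sub>h\<close> in \<open>h\<close>.  The Lyapunov
  equation \<open>B \<Sigma>' + \<Sigma>' B = - atl\<close> identifies its derivative in \<open>s\<close> with the direction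
  \<open>(E\<^sub>s gt, E\<^sub>s atl E\<^sub>s)\<close>.
\<close>

section \<open>The matrix exponential and the Lyapunov equation\<close>

text \<open>The perturbed processes live on probability spaces of their own and are known only
  through a martingale problem with compactly supported test functions, so their paths cannot be
  compared with those of \<open>X\<close>. Only the law at the single time \<open>t\<close> is
  accessible, and it is identified through the functions
  \<open>cos (\<xi> \<bullet> x + \<theta>)\<close>: the free phase carries both parts of the
  characteristic function, which keeps most of the argument real. For \<open>X\<close> the two-time
  law is needed; the noise is additive and the integrand a smooth deterministic orbit, so its
  integral against \<open>W\<close> is a pathwise limit of Riemann-Stieltjes sums and no stochastic
  integral enters. The derivative of a Gaussian expectation in its covariance is taken without
  densities: the perturbed law is compared, up to second order in \<epsilon>, with an affine image
  of \<open>Y\<close>, and bounded second derivatives of \<open>f\<close> control the error. Since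
  \<open>atl\<close> is not assumed symmetric, quadratic forms are symmetrised where a covariance is
  built from them.\<close>

lemma bounded_bilinear_matrix_matrix_mult:
  "bounded_bilinear ((**) :: real^'n^'m \<Rightarrow> real^'p^'n \<Rightarrow> real^'p^'m)"
  unfolding bilinear_conv_bounded_bilinear[symmetric] bilinear_def
  by (auto intro!: linearI simp: vec_eq_iff
      matrix_matrix_mult_def sum.distrib algebra_simps sum_distrib_left)

lemma bounded_bilinear_matrix_vector_mult:
  "bounded_bilinear ((*v) :: real^'n^'m \<Rightarrow> real^'n \<Rightarrow> real^'m)"
  unfolding bilinear_conv_bounded_bilinear[symmetric] bilinear_def
  by (auto intro!: linearI simp: vec_eq_iff
      matrix_vector_mult_def sum.distrib algebra_simps sum_distrib_left)

lemma bounded_linear_transpose: "bounded_linear (transpose :: real^'n^'m \<Rightarrow> real^'m^'n)"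
  unfolding linear_conv_bounded_linear[symmetric]
  by (auto intro!: linearI simp: vec_eq_iff transpose_def)

lemmas matrix_mult_bb = bounded_bilinear_matrix_matrix_mult
lemmas matrix_vector_bb = bounded_bilinear_matrix_vector_mult

lemmas continuous_on_matrix_mult [continuous_intros] =
  bounded_bilinear.continuous_on [OF bounded_bilinear_matrix_matrix_mult]
lemmas continuous_on_matrix_vector_mult [continuous_intros] =
  bounded_bilinear.continuous_on [OF bounded_bilinear_matrix_vector_mult]
lemmas continuous_on_transpose [continuous_intros] =
  bounded_linear.continuous_on [OF bounded_linear_transpose]

lemma matrix_mult_minus_left: "(- (M :: real^'n^'m)) ** N = - (M ** (N :: real^'p^'n))"
  by (rule bounded_bilinear.minus_left [OF matrix_mult_bb])

lemma matrix_mult_minus_right: "(M :: real^'n^'m) ** (- N) = - (M ** (N :: real^'p^'n))"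
  by (rule bounded_bilinear.minus_right [OF matrix_mult_bb])

lemma dot_transpose_mult: "(x :: real^'m) \<bullet> (M *v y) = (transpose M *v x) \<bullet> (y :: real^'n)"
  by (metis dot_lmul_matrix transpose_matrix_vector)

lemma mpow_scaleR: "mpow (s *\<^sub>R B) k = s ^ k *\<^sub>R mpow B k"
  by (induction k) (auto simp: bounded_bilinear.scaleR_left[OF matrix_mult_bb]
     bounded_bilinear.scaleR_right[OF matrix_mult_bb])

lemma mpow_Suc_right: "mpow M (Suc k) = mpow M k ** M"
  by (induction k) (auto simp: matrix_mul_assoc)

lemma transpose_mpow: "transpose (mpow M k) = mpow (transpose M) k"
proof (induction k)
  case (Suc k)
  have "transpose (mpow M (Suc k)) = mpow (transpose M) k ** transpose M"
    by (simp add: matrix_transpose_mul Suc)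
  then show ?case by (simp only: mpow_Suc_right)
qed (simp add: transpose_mat)

text \<open>Bounded bilinearity provides a constant \<open>K\<close> with
  \<open>norm (P ** Q) \<le> norm P * norm Q * K\<close>, so the powers of \<open>M\<close> grow at
  most geometrically with ratio \<open>norm M * K\<close> and a scalar exponential series
  dominates.\<close>

lemma summable_mexp: "summable (\<lambda>k. (1 / fact k) *\<^sub>R mpow (M :: real^'d^'d) k)"
proof -
  obtain K where K: "\<And>(P :: real^'d^'d) (Q :: real^'d^'d). norm (P ** Q) \<le> norm P * norm Q * K" "0 \<le> K"
    using bounded_bilinear.nonneg_bounded[OF matrix_mult_bb] by blast
  define c where "c = norm (mat 1 :: real^'d^'d)"
  have b: "norm (mpow M k) \<le> c * (norm M * K) ^ k" for k
  proof (induction k)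
    case (Suc k)
    have "norm (mpow M (Suc k)) \<le> norm M * norm (mpow M k) * K" using K(1)[of M "mpow M k"] by simp
    also have "\<dots> \<le> norm M * (c * (norm M * K) ^ k) * K"
      using Suc K by (intro mult_right_mono mult_left_mono) auto
    finally show ?case by (simp add: algebra_simps)
  qed (simp add: c_def)
  have s: "summable (\<lambda>k. c * (inverse (fact k) * (norm M * K) ^ k))"
    by (intro summable_mult summable_exp)
  show ?thesis
  proof (rule summable_comparison_test'[OF s, of 0])
    fix k show "norm ((1 / fact k) *\<^sub>R mpow M k) \<le> c * (inverse (fact k) * (norm M * K) ^ k)"
      using b[of k] by (simp add: field_simps)
  qed
qed

text \<open>Continuity lets the map pass through the series. It serves for transposition, for
  multiplication by a fixed matrix and for single coordinates.\<close>

lemma bounded_linear_mexp: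
  assumes "bounded_linear L"
  shows "L (mexp M) = (\<Sum>k. (1 / fact k) *\<^sub>R L (mpow M k))"
    and "summable (\<lambda>k. (1 / fact k) *\<^sub>R L (mpow M k))"
proof -
  interpret bounded_linear L by fact
  show "L (mexp M) = (\<Sum>k. (1 / fact k) *\<^sub>R L (mpow M k))"
    unfolding mexp_def using suminf[OF summable_mexp[of M]] by (simp add: scaleR)
  show "summable (\<lambda>k. (1 / fact k) *\<^sub>R L (mpow M k))"
    using summable[OF summable_mexp[of M]] by (simp add: scaleR)
qed

lemma transpose_mexp: "transpose (mexp M) = mexp (transpose M)"
  by (simp add: bounded_linear_mexp(1)[OF bounded_linear_transpose] transpose_mpow, simp add: mexp_def)

lemma mexp_commute: "M ** mexp M = mexp M ** M"
proof -
  have "M ** mexp M = (\<Sum>k. (1 / fact k) *\<^sub>R (M ** mpow M k))"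
    by (rule bounded_linear_mexp) (rule bounded_bilinear.bounded_linear_right[OF matrix_mult_bb])
  also have "\<dots> = (\<Sum>k. (1 / fact k) *\<^sub>R (mpow M k ** M))"
    using mpow_Suc_right[of M] by simp
  also have "\<dots> = mexp M ** M"
    by (rule bounded_linear_mexp(1)[symmetric]) (rule bounded_bilinear.bounded_linear_left[OF matrix_mult_bb])
  finally show ?thesis .
qed

lemma mexp_0 [simp]: "mexp (0 :: real^'d^'d) = mat 1"
proof -
  have "mpow (0 :: real^'d^'d) k = (if k = 0 then mat 1 else 0)" for k
    by (cases k) (auto simp: bounded_bilinear.zero_left[OF matrix_mult_bb])
  then have "(\<lambda>k. (1 / fact k) *\<^sub>R mpow (0 :: real^'d^'d) k) = (\<lambda>k. if k = 0 then mat 1 else 0)"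
    by auto
  then show ?thesis unfolding mexp_def
    using sums_single[of 0 "\<lambda>_. mat 1 :: real^'d^'d"] by (simp add: sums_iff)
qed

text \<open>Each coordinate of the exponential is an everywhere convergent scalar power series in
  \<open>s\<close>, which may be differentiated termwise; \<open>diffs\<close> shifts its
  coefficients to those of the same coordinate of \<open>B ** mexp (s *\<^sub>R B)\<close>.\<close>

lemma mexp_has_vector_derivative:
  "((\<lambda>s. mexp (s *\<^sub>R B)) has_vector_derivative (B ** mexp (s *\<^sub>R B))) (at s within S)"
proof -
  have "((\<lambda>s. mexp (s *\<^sub>R B)) has_vector_derivative (B ** mexp (s *\<^sub>R B))) (at s)"
    unfolding has_vector_derivative_def
  proof (subst has_derivative_componentwise_within, rule ballI)
    fix b :: "real^'a^'a" assume "b \<in> Basis"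
    have L: "bounded_linear (\<lambda>M :: real^'a^'a. M \<bullet> b)" by (rule bounded_linear_inner_left)
    define c where "c k = (mpow B k \<bullet> b) / fact k" for k
    have e: "mexp (y *\<^sub>R B) \<bullet> b = (\<Sum>k. c k * y ^ k)" and sm: "summable (\<lambda>k. c k * y ^ k)" for y
      using bounded_linear_mexp[OF L, of "y *\<^sub>R B"]
      by (simp_all add: c_def mpow_scaleR algebra_simps)
    have "((\<lambda>y. \<Sum>k. c k * y ^ k) has_field_derivative (\<Sum>k. diffs c k * s ^ k)) (at s)"
      by (rule termdiffs_strong_converges_everywhere[OF sm])
    moreover have "(\<Sum>k. diffs c k * s ^ k) = (B ** mexp (s *\<^sub>R B)) \<bullet> b"
    proof -
      have L': "bounded_linear (\<lambda>M :: real^'a^'a. (B ** M) \<bullet> b)"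
        using bounded_linear_compose[OF L bounded_bilinear.bounded_linear_right[OF matrix_mult_bb, of B]] .
      have "(B ** mexp (s *\<^sub>R B)) \<bullet> b = (\<Sum>k. (1 / fact k) *\<^sub>R ((B ** mpow (s *\<^sub>R B) k) \<bullet> b))"
        by (rule bounded_linear_mexp[OF L'])
      also have "\<dots> = (\<Sum>k. diffs c k * s ^ k)"
        by (intro suminf_cong)
           (simp add: diffs_def c_def mpow_scaleR bounded_bilinear.scaleR_right[OF matrix_mult_bb] del: of_nat_Suc)
      finally show ?thesis ..
    qed
    ultimately show "((\<lambda>x. mexp (x *\<^sub>R B) \<bullet> b) has_derivative (\<lambda>x. (x *\<^sub>R (B ** mexp (s *\<^sub>R B))) \<bullet> b)) (at s)"
      by (simp add: e has_field_derivative_def fun_eq_iff mult.commute)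
         (simp add: mult_commute_abs)
  qed
  then show ?thesis by (rule has_vector_derivative_at_within)
qed

lemma continuous_on_mexp [continuous_intros]:
  assumes "continuous_on S u"
  shows "continuous_on S (\<lambda>s. mexp (u s *\<^sub>R B))"
proof -
  have "continuous_on UNIV (\<lambda>s. mexp (s *\<^sub>R B))"
    using mexp_has_vector_derivative has_vector_derivative_continuous
    by (metis continuous_at_imp_continuous_on)
  then show ?thesis using continuous_on_compose2[OF _ assms] by blast
qed

lemma mexp_rev_has_vector_derivative:
  "((\<lambda>r. mexp ((t - r) *\<^sub>R B)) has_vector_derivative - (B ** mexp ((t - r) *\<^sub>R B))) (at r within S)"
proof -
  have "((\<lambda>r. t - r) has_vector_derivative -1) (at r within S)"
    by (auto intro!: derivative_eq_intros)
  from vector_diff_chain_within[OF this mexp_has_vector_derivative, of B] show ?thesis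
    by (simp add: o_def)
qed

section \<open>Quadratic forms, inverses and the spectral bound for \<open>B\<close>\<close>

text \<open>If \<open>u = M *v v\<close> were nonzero, a short step from \<open>v\<close> in
  direction \<open>- u\<close> would make the form negative: it starts at zero and its first-order
  change is proportional to \<open>- (u \<bullet> u)\<close>.\<close>

lemma psd_zero_kernel:
  fixes M :: "real^'d^'d"
  assumes sym: "transpose M = M" and psd: "\<And>w. 0 \<le> w \<bullet> (M *v w)" and z: "v \<bullet> (M *v v) = 0"
  shows "M *v v = 0"
proof (rule ccontr)
  assume ne: "M *v v \<noteq> 0"
  define u where "u = M *v v"
  have u: "0 < u \<bullet> u" using ne by (simp add: u_def)
  define k where "k = \<bar>u \<bullet> (M *v u)\<bar> + 1"
  have k: "0 < k" "u \<bullet> (M *v u) \<le> k" by (auto simp: k_def)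
  \<comment> \<open>With this step length the quadratic term is at most
    \<open>c * (u \<bullet> u)\<close>, half of the linear gain
    \<open>2 * c * (u \<bullet> u)\<close>.\<close>
  define c where "c = (u \<bullet> u) / k"
  have c: "0 < c" using u k by (simp add: c_def)
  have "(v - c *\<^sub>R u) \<bullet> (M *v (v - c *\<^sub>R u)) = - 2 * c * (u \<bullet> u) + c\<^sup>2 * (u \<bullet> (M *v u))"
  proof -
    have "v \<bullet> (M *v u) = u \<bullet> u" using sym dot_transpose_mult[of v M u] by (simp add: u_def)
    then show ?thesis using z
      by (simp add: matrix_vector_mult_diff_distrib inner_diff_left inner_diff_right
        matrix_vector_mult_scaleR u_def[symmetric] power2_eq_square algebra_simps inner_commute)
  qed
  moreover have "c\<^sup>2 * (u \<bullet> (M *v u)) \<le> c\<^sup>2 * k"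
    using k by (intro mult_left_mono) auto
  moreover have "c\<^sup>2 * k = c * (u \<bullet> u)" using k by (simp add: c_def power2_eq_square)
  moreover have "0 < c * (u \<bullet> u)" using c u by simp
  ultimately have "(v - c *\<^sub>R u) \<bullet> (M *v (v - c *\<^sub>R u)) < 0" by linarith
  with psd[of "v - c *\<^sub>R u"] show False by simp
qed

text \<open>A minimiser of the quadratic form on the unit sphere is an eigenvector, because the
  nonnegative form \<open>w \<mapsto> w \<bullet> M w - l |w|\<^sup>2\<close> vanishes at it.\<close>

lemma symmetric_least_eigenvalue:
  fixes M :: "real^'d^'d"
  assumes sym: "transpose M = M"
  obtains v l where "v \<noteq> 0" "M *v v = l *\<^sub>R v" "\<And>w. l * (norm w)\<^sup>2 \<le> w \<bullet> (M *v w)"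
proof -
  have "continuous_on (sphere 0 1) (\<lambda>w :: real^'d. w \<bullet> (M *v w))"
    by (intro continuous_intros)
  \<comment> \<open>Any coordinate vector shows that the unit sphere is nonempty.\<close>
  moreover have "axis undefined 1 \<in> sphere (0 :: real^'d) 1" by simp
  ultimately obtain v where v: "v \<in> sphere 0 1" "\<And>w. w \<in> sphere 0 1 \<Longrightarrow> v \<bullet> (M *v v) \<le> w \<bullet> (M *v w)"
    using continuous_attains_inf[OF compact_sphere, of 0 1 "\<lambda>w :: real^'d. w \<bullet> (M *v w)"] by blast
  define l where "l = v \<bullet> (M *v v)"
  have le: "l * (norm w)\<^sup>2 \<le> w \<bullet> (M *v w)" for w
  proof (cases "w = 0")
    case False
    have "l \<le> (w /\<^sub>R norm w) \<bullet> (M *v (w /\<^sub>R norm w))"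
      unfolding l_def using False by (intro v(2)) auto
    also have "\<dots> = (w \<bullet> (M *v w)) / (norm w)\<^sup>2"
      by (simp add: matrix_vector_mult_scaleR power2_eq_square field_simps)
    finally show ?thesis using False by (simp add: field_simps)
  qed simp
  define N where "N = M - l *\<^sub>R mat 1"
  have N: "N *v w = M *v w - l *\<^sub>R w" for w
    by (simp add: N_def matrix_vector_mult_diff_rdistrib bounded_bilinear.scaleR_left[OF matrix_vector_bb])
  have "N *v v = 0"
  proof (rule psd_zero_kernel)
    show "transpose N = N"
    proof -
      have "M $ j $ i = M $ i $ j" for i j
        using arg_cong[OF sym, of "\<lambda>A. A $ i $ j"] by (simp add: transpose_def)
      then show ?thesis by (simp add: N_def vec_eq_iff transpose_def mat_def)
    qed
    show "0 \<le> w \<bullet> (N *v w)" for w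
      using le[of w] by (simp add: N inner_diff_right power2_norm_eq_inner)
    show "v \<bullet> (N *v v) = 0"
      using v(1) by (simp add: N inner_diff_right l_def dot_square_norm)
  qed
  then have "M *v v = l *\<^sub>R v" by (simp add: N)
  moreover have "v \<noteq> 0" using v(1) by auto
  ultimately show thesis using le that by blast
qed

lemma invertible_posdef:
  fixes M :: "real^'d^'d"
  assumes "\<And>v. v \<noteq> 0 \<Longrightarrow> 0 < v \<bullet> (M *v v)"
  shows "invertible M"
proof -
  have "\<forall>x. M *v x = 0 \<longrightarrow> x = 0"
    using assms by force
  then show ?thesis
    by (simp add: invertible_left_inverse matrix_left_invertible_ker)
qed

lemma matrix_inv_mult:
  fixes M :: "real^'d^'d"
  assumes "invertible M"
  shows "M ** matrix_inv M = mat 1" "matrix_inv M ** M = mat 1"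
    "M *v (matrix_inv M *v x) = x" "matrix_inv M *v (M *v x) = x"
proof -
  show 1: "M ** matrix_inv M = mat 1" and 2: "matrix_inv M ** M = mat 1"
    using someI_ex[OF assms[unfolded invertible_def]] unfolding matrix_inv_def by auto
  show "M *v (matrix_inv M *v x) = x" "matrix_inv M *v (M *v x) = x"
    by (simp_all add: matrix_vector_mul_assoc 1 2)
qed

lemma transpose_matrix_inv:
  fixes M :: "real^'d^'d"
  assumes "invertible M" "transpose M = M"
  shows "transpose (matrix_inv M) = matrix_inv M"
proof -
  have "transpose (matrix_inv M) ** M = mat 1"
    using arg_cong[OF matrix_inv_mult(1)[OF assms(1)], of transpose] assms(2)
    by (simp add: matrix_transpose_mul transpose_mat)
  then have "transpose (matrix_inv M) ** (M ** matrix_inv M) = matrix_inv M"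
    by (simp add: matrix_mul_assoc)
  then show ?thesis by (simp add: matrix_inv_mult[OF assms(1)])
qed

text \<open>The least eigenvalue of \<open>- B\<close> is the negative of an eigenvalue of
  \<open>B\<close>, hence positive, and it bounds the form of \<open>- B\<close> from below.\<close>

lemma negative_definite:
  fixes B :: "real^'d^'d"
  assumes "transpose B = B" "eigenvalues_negative B"
  obtains \<beta> where "0 < \<beta>" "\<And>v. v \<bullet> (B *v v) \<le> - \<beta> * (norm v)\<^sup>2"
proof -
  have neg: "(- B) *v w = - (B *v w)" for w
    by (rule bounded_bilinear.minus_left[OF matrix_vector_bb])
  have "transpose (- B) = - B"
    using assms(1) by (simp add: linear_neg[OF bounded_linear.linear[OF bounded_linear_transpose]])
  from symmetric_least_eigenvalue[OF this] obtain v l where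
    v: "v \<noteq> 0" "(- B) *v v = l *\<^sub>R v" "\<And>w. l * (norm w)\<^sup>2 \<le> w \<bullet> ((- B) *v w)" by blast
  have "B *v v = (- l) *\<^sub>R v" using v(2) neg by (metis minus_minus scaleR_minus_left)
  then have "- l < 0" using assms(2) v(1) unfolding eigenvalues_negative_def by blast
  then show thesis using that[of l] v(3) neg by (simp add: inner_minus_right) (smt (verit, best))
qed

text \<open>Energy estimate: along \<open>u' = B u\<close> the quantity
  \<open>exp (2 * \<beta> * r) * (u r \<bullet> u r)\<close> cannot increase, because the form of
  \<open>B\<close> is at most \<open>- \<beta>\<close> times the squared norm. No diagonalisation is
  involved.\<close>

lemma mexp_decay:
  fixes B :: "real^'d^'d"
  assumes B: "\<And>v. v \<bullet> (B *v v) \<le> - \<beta> * (norm v)\<^sup>2" and s: "0 \<le> s"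
  shows "norm (mexp (s *\<^sub>R B) *v v) \<le> exp (- \<beta> * s) * norm v"
proof -
  define u where "u r = mexp (r *\<^sub>R B) *v v" for r
  have u': "(u has_vector_derivative (B *v u r)) (at r)" for r
    unfolding u_def matrix_vector_mul_assoc
    by (rule bounded_linear.has_vector_derivative[OF bounded_bilinear.bounded_linear_left[OF matrix_vector_bb] mexp_has_vector_derivative])
  define k where "k r = exp (2 * \<beta> * r) * (u r \<bullet> u r)" for r
  have k': "(k has_real_derivative exp (2 * \<beta> * r) * (2 * \<beta> * (u r \<bullet> u r) + 2 * (u r \<bullet> (B *v u r)))) (at r)" for r
  proof -
    have "((\<lambda>r. u r \<bullet> u r) has_vector_derivative u r \<bullet> (B *v u r) + (B *v u r) \<bullet> u r) (at r)"
      by (rule bounded_bilinear.has_vector_derivative[OF bounded_bilinear_inner u' u'])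
    then have d: "((\<lambda>r. u r \<bullet> u r) has_real_derivative 2 * (u r \<bullet> (B *v u r))) (at r)"
      by (simp add: has_real_derivative_iff_has_vector_derivative inner_commute)
    show ?thesis unfolding k_def
      by (rule derivative_eq_intros d refl)+ (simp add: algebra_simps)
  qed
  have "k s \<le> k 0"
  proof (rule DERIV_nonpos_imp_nonincreasing[OF s])
    fix r
    have "2 * \<beta> * (u r \<bullet> u r) + 2 * (u r \<bullet> (B *v u r)) \<le> 0"
      using B[of "u r"] by (simp add: dot_square_norm)
    then show "\<exists>y. (k has_real_derivative y) (at r) \<and> y \<le> 0"
      using k'[of r] by (auto intro!: mult_nonneg_nonpos)
  qed
  then have "exp (2 * \<beta> * s) * (norm (u s))\<^sup>2 \<le> (norm v)\<^sup>2"
    by (simp add: k_def u_def dot_square_norm)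
  then have "(exp (\<beta> * s) * norm (u s))\<^sup>2 \<le> (norm v)\<^sup>2"
    by (simp add: power_mult_distrib exp_double[symmetric] mult.assoc)
  then have "exp (\<beta> * s) * norm (u s) \<le> norm v"
    by (rule power2_le_imp_le) simp
  then show ?thesis by (simp add: u_def exp_minus field_simps)
qed

text \<open>The norm of a matrix is at most the sum of the norms of its rows, and the rows of the
  transpose are the images of the coordinate vectors; this is why the bound is obtained for the
  transpose.\<close>

lemma norm_matrix_le:
  fixes M :: "real^'d^'d" and K :: real
  assumes "\<And>v. norm (M *v v) \<le> K * norm v"
  shows "norm (transpose M) \<le> real CARD('d) * K"
proof -
  have "norm (transpose M) \<le> (\<Sum>i\<in>UNIV. norm (transpose M $ i))"
    unfolding norm_vec_def by (rule L2_set_le_sum) simp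
  also have "\<dots> \<le> (\<Sum>i\<in>(UNIV :: 'd set). K :: real)"
  proof (rule sum_mono)
    fix i
    have "transpose M $ i = M *v axis i 1"
      by (simp add: matrix_vector_mult_basis column_def transpose_def)
    then show "norm (transpose M $ i) \<le> K" using assms[of "axis i 1"] by simp
  qed
  finally show ?thesis by simp
qed

section \<open>The stationary covariance as solution of the Lyapunov equation\<close>

text \<open>The integral behind \<open>Sigma_h\<close> with an arbitrary middle matrix
  \<open>c\<close>. Freeing \<open>c\<close> matters because the same integral at
  \<open>c = atl\<close> is the derivative of \<open>Sigma_h\<close> in \<open>h\<close>.\<close>

definition lyap :: "real^'d^'d \<Rightarrow> real^'d^'d \<Rightarrow> real^'d^'d" where
  "lyap B c = integral {0..} (\<lambda>s. mexp (s *\<^sub>R B) ** c ** transpose (mexp (s *\<^sub>R B)))"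

lemma Sigma_h_eq_lyap: "Sigma_h B a atl h = lyap B (a + h *\<^sub>R atl)"
  by (simp add: Sigma_h_def lyap_def)

lemma set_integrable_exp_minus:
  assumes "0 < (b :: real)"
  shows "set_integrable lborel {0..} (\<lambda>s. exp (- b * s))"
proof -
  have "(\<lambda>s. exp (- b * s)) absolutely_integrable_on {0..}"
    using integrable_on_exp_minus_to_infinity[OF assms, of 0]
    by (intro nonnegative_absolutely_integrable_1) auto
  then have "integrable (completion lborel) (\<lambda>s. indicator {0..} s *\<^sub>R exp (- b * s))"
    by (simp add: set_integrable_def)
  then show ?thesis unfolding set_integrable_def
    by (subst (asm) integrable_completion) auto
qed

text \<open>The integrand \<open>F\<close> satisfies \<open>F' = B ** F + F ** B\<close>, equals
  \<open>c\<close> at 0 and decays exponentially. Decay gives integrability; integrating the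
  differential equation over the half-line leaves only the boundary value at 0.\<close>

lemma lyap_facts:
  fixes B :: "real^'d^'d"
  assumes B: "transpose B = B" "eigenvalues_negative B"
  shows lyap_integrable: "set_integrable lborel {0..} (\<lambda>s. mexp (s *\<^sub>R B) ** c ** transpose (mexp (s *\<^sub>R B)))"
    and lyap_equation: "B ** lyap B c + lyap B c ** B = - c"
proof -
  define F where "F c s = mexp (s *\<^sub>R B) ** c ** transpose (mexp (s *\<^sub>R B))" for c s
  obtain \<beta> where \<beta>: "0 < \<beta>" "\<And>v. v \<bullet> (B *v v) \<le> - \<beta> * (norm v)\<^sup>2"
    using negative_definite[OF B] by blast
  obtain K where K: "\<And>(P :: real^'d^'d) (Q :: real^'d^'d). norm (P ** Q) \<le> norm P * norm Q * K" "0 \<le> K"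
    using bounded_bilinear.nonneg_bounded[OF matrix_mult_bb] by blast
  define D where "D = real CARD('d)"
  \<comment> \<open>The bound available for the transpose applies to the exponential itself because
    symmetry of \<open>B\<close> makes the two equal.\<close>
  have E: "norm (mexp (s *\<^sub>R B)) \<le> D * exp (- \<beta> * s)" "transpose (mexp (s *\<^sub>R B)) = mexp (s *\<^sub>R B)" if "0 \<le> s" for s
  proof -
    show t: "transpose (mexp (s *\<^sub>R B)) = mexp (s *\<^sub>R B)"
      using B(1) by (simp add: transpose_mexp transpose_scalar)
    show "norm (mexp (s *\<^sub>R B)) \<le> D * exp (- \<beta> * s)"
      using norm_matrix_le[of "mexp (s *\<^sub>R B)", OF mexp_decay[OF \<beta>(2) that]] t by (simp add: D_def)
  qed
  define C where "C c = D\<^sup>2 * norm c * K\<^sup>2" for c :: "real^'d^'d"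
  have bnd: "norm (F c s) \<le> C c * exp (- (2 * \<beta>) * s)" if s: "0 \<le> s" for c s
  proof -
    let ?e = "D * exp (- \<beta> * s)"
    have D0: "0 \<le> D" by (simp add: D_def)
    have "norm (F c s) \<le> norm (mexp (s *\<^sub>R B) ** c) * norm (mexp (s *\<^sub>R B)) * K"
      unfolding F_def E(2)[OF s] by (rule K)
    also have "\<dots> \<le> (norm (mexp (s *\<^sub>R B)) * norm c * K) * norm (mexp (s *\<^sub>R B)) * K"
      using K by (intro mult_right_mono) auto
    also have "\<dots> \<le> (?e * norm c * K) * ?e * K"
      using K E(1)[OF s] D0 by (intro mult_mono mult_nonneg_nonneg) auto
    also have "\<dots> = C c * (exp (- \<beta> * s) * exp (- \<beta> * s))"
      by (simp add: C_def power2_eq_square algebra_simps)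
    also have "\<dots> = C c * exp (- (2 * \<beta>) * s)" by (simp flip: exp_add)
    finally show ?thesis .
  qed
  have cont: "continuous_on UNIV (F c)" for c
    unfolding F_def by (intro continuous_intros)
  have int: "set_integrable lborel {0..} (F c)" for c
  proof (rule set_integrable_bound)
    show "set_integrable lborel {0..} (\<lambda>s. C c * exp (- (2 * \<beta>) * s))"
      using \<beta>(1) by (intro set_integrable_mult_right set_integrable_exp_minus) auto
    show "set_borel_measurable lborel {0..} (F c)"
      unfolding set_borel_measurable_def
      using borel_measurable_continuous_onI[OF cont[of c]] by measurable
    show "AE s in lborel. s \<in> {0..} \<longrightarrow> norm (F c s) \<le> norm (C c * exp (- (2 * \<beta>) * s))"
      using bnd by (intro AE_I2) (smt (verit) atLeast_iff norm_ge_zero real_norm_def)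
  qed
  show "set_integrable lborel {0..} (\<lambda>s. mexp (s *\<^sub>R B) ** c ** transpose (mexp (s *\<^sub>R B)))"
    using int[of c] by (simp add: F_def[abs_def])
  have lim: "((\<lambda>s. F c s) \<longlongrightarrow> 0) at_top" for c
  proof (rule Lim_null_comparison)
    show "\<forall>\<^sub>F s in at_top. norm (F c s) \<le> C c * exp (- (2 * \<beta>) * s)"
      by (rule eventually_mono[OF eventually_ge_at_top[of 0]]) (rule bnd)
    have "((\<lambda>s. exp (- (2 * \<beta>) * s)) \<longlongrightarrow> 0) at_top"
      using \<beta>(1) by (intro filterlim_compose[OF exp_at_bot] filterlim_tendsto_neg_mult_at_bot[OF tendsto_const] filterlim_ident) auto
    from tendsto_mult_left[OF this, of "C c"] show "((\<lambda>s. C c * exp (- (2 * \<beta>) * s)) \<longlongrightarrow> 0) at_top" by simp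
  qed
  define L where "L P = B ** P + P ** B" for P
  have L: "bounded_linear L" unfolding L_def
    by (intro bounded_linear_add bounded_bilinear.bounded_linear_right[OF matrix_mult_bb] bounded_bilinear.bounded_linear_left[OF matrix_mult_bb])
  have F': "(F c has_vector_derivative L (F c s)) (at s within S)" for s S
  proof -
    have d: "((\<lambda>s. mexp (s *\<^sub>R B) ** c) has_vector_derivative (B ** mexp (s *\<^sub>R B)) ** c) (at s within S)"
      by (rule bounded_linear.has_vector_derivative[OF bounded_bilinear.bounded_linear_left[OF matrix_mult_bb] mexp_has_vector_derivative])
    have d2: "((\<lambda>s. transpose (mexp (s *\<^sub>R B))) has_vector_derivative transpose (B ** mexp (s *\<^sub>R B))) (at s within S)"
      by (rule bounded_linear.has_vector_derivative[OF bounded_linear_transpose mexp_has_vector_derivative])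
    have "(F c has_vector_derivative (mexp (s *\<^sub>R B) ** c) ** transpose (B ** mexp (s *\<^sub>R B))
       + ((B ** mexp (s *\<^sub>R B)) ** c) ** transpose (mexp (s *\<^sub>R B))) (at s within S)"
      unfolding F_def by (rule bounded_bilinear.has_vector_derivative[OF matrix_mult_bb d d2])
    then show ?thesis
      using B(1) by (simp add: F_def L_def matrix_transpose_mul matrix_mul_assoc add.commute)
  qed
  \<comment> \<open>The half-line integral of \<open>L (F c s)\<close> is computed twice: as the
    limit of \<open>F c b - F c 0\<close>, and as \<open>L\<close> applied to the integral of
    \<open>F c\<close>.\<close>
  have t: "((\<lambda>b. LBINT s:{0..b}. L (F c s)) \<longlongrightarrow> (LBINT s:{0..}. L (F c s))) at_top"
  proof (rule tendsto_set_lebesgue_integral_at_top)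
    show "set_integrable lborel {0..} (\<lambda>s. L (F c s))"
      using integrable_bounded_linear[OF L int[of c, unfolded set_integrable_def]]
      by (simp add: set_integrable_def linear_scale[OF bounded_linear.linear[OF L]])
  qed auto
  have t1: "(LBINT s:{0..}. L (F c s)) = L (LBINT s:{0..}. F c s)"
    using integral_bounded_linear[OF L int[of c, unfolded set_integrable_def]]
    by (simp add: set_lebesgue_integral_def linear_scale[OF bounded_linear.linear[OF L]])
  have t2: "(LBINT s:{0..}. F c s) = lyap B c"
    using set_borel_integral_eq_integral(2)[OF int[of c]] by (simp add: lyap_def F_def[abs_def])
  have "(LBINT s:{0..b}. L (F c s)) = F c b - F c 0" if "0 \<le> b" for b
    unfolding set_lebesgue_integral_def
    by (rule integral_FTC_Icc[OF that])
       (auto intro!: F' bounded_linear.continuous_on[OF L] continuous_on_subset[OF cont])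
  then have t3: "\<forall>\<^sub>F b in at_top. (LBINT s:{0..b}. L (F c s)) = F c b - F c 0"
    by (intro eventually_mono[OF eventually_ge_at_top[of 0]])
  from Lim_transform_eventually[OF t t3] have "((\<lambda>b. F c b - F c 0) \<longlongrightarrow> L (lyap B c)) at_top"
    unfolding t1 t2 .
  moreover have "((\<lambda>b. F c b - F c 0) \<longlongrightarrow> 0 - F c 0) at_top"
    by (intro tendsto_diff lim tendsto_const)
  ultimately have "L (lyap B c) = - F c 0"
    using tendsto_unique[OF trivial_limit_at_top_linorder] by fastforce
  then show "B ** lyap B c + lyap B c ** B = - c" by (simp add: L_def F_def)
qed

text \<open>Linearity of the integral, legitimate since each summand converges. It makes
  \<open>Sigma_h\<close> affine in \<open>h\<close> with slope \<open>lyap B atl\<close>, so that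
  the derivative of the inverse covariance becomes explicit.\<close>

lemma lyap_add_scaleR:
  fixes B :: "real^'d^'d"
  assumes B: "transpose B = B" "eigenvalues_negative B"
  shows "lyap B (a + h *\<^sub>R c) = lyap B a + h *\<^sub>R lyap B c"
proof -
  let ?F = "\<lambda>c s. mexp (s *\<^sub>R B) ** c ** transpose (mexp (s *\<^sub>R B))"
  have i: "(?F c) integrable_on {0..}" for c
    by (rule set_borel_integral_eq_integral(1)[OF lyap_integrable[OF B]])
  have "?F (a + h *\<^sub>R c) s = ?F a s + h *\<^sub>R ?F c s" for s
    by (simp add: bounded_bilinear.add_left[OF matrix_mult_bb] bounded_bilinear.add_right[OF matrix_mult_bb]
      bounded_bilinear.scaleR_left[OF matrix_mult_bb] bounded_bilinear.scaleR_right[OF matrix_mult_bb])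
  then show ?thesis unfolding lyap_def
    using i by (simp add: Henstock_Kurzweil_Integration.integral_add integrable_cmul)
qed

lemma transpose_lyap:
  fixes B :: "real^'d^'d"
  assumes B: "transpose B = B" "eigenvalues_negative B"
  shows "transpose (lyap B c) = lyap B (transpose c)"
proof -
  have "(\<lambda>s. mexp (s *\<^sub>R B) ** c ** transpose (mexp (s *\<^sub>R B))) integrable_on {0..}"
    by (rule set_borel_integral_eq_integral(1)[OF lyap_integrable[OF B]])
  from integral_linear[OF this bounded_linear_transpose] show ?thesis
    unfolding lyap_def by (simp add: o_def matrix_transpose_mul matrix_mul_assoc)
qed

text \<open>Nonnegativity is visible in the integrand. Strictness comes from the equation: a zero of
  the form lies in the kernel of \<open>lyap B c\<close>, and then testing the Lyapunov equation
  with \<open>v\<close> on both sides gives \<open>v \<bullet> (c *v v) = 0\<close>.\<close>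

lemma lyap_posdef:
  fixes B :: "real^'d^'d"
  assumes B: "transpose B = B" "eigenvalues_negative B"
    and c: "transpose c = c" "\<And>v. v \<noteq> 0 \<Longrightarrow> 0 < v \<bullet> (c *v v)" and v: "v \<noteq> 0"
  shows "0 < v \<bullet> (lyap B c *v v)"
proof -
  let ?F = "\<lambda>s. mexp (s *\<^sub>R B) ** c ** transpose (mexp (s *\<^sub>R B))"
  have L: "bounded_linear (\<lambda>M :: real^'d^'d. w \<bullet> (M *v w))" for w
    by (intro bounded_linear_compose[OF bounded_linear_inner_right] bounded_bilinear.bounded_linear_left[OF matrix_vector_bb])
  have nn: "0 \<le> w \<bullet> (lyap B c *v w)" for w
  proof -
    have i: "?F integrable_on {0..}"
      by (rule set_borel_integral_eq_integral(1)[OF lyap_integrable[OF B]])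
    have "w \<bullet> (lyap B c *v w) = integral {0..} (\<lambda>s. w \<bullet> (?F s *v w))"
      unfolding lyap_def using integral_linear[OF i L[of w]] by (simp add: o_def)
    also have "\<dots> \<ge> 0"
    proof (rule integral_nonneg)
      show "(\<lambda>s. w \<bullet> (?F s *v w)) integrable_on {0..}"
        using integrable_linear[OF i L[of w]] by (simp add: o_def)
      fix s :: real
      have "w \<bullet> (?F s *v w) = (transpose (mexp (s *\<^sub>R B)) *v w) \<bullet> (c *v (transpose (mexp (s *\<^sub>R B)) *v w))"
        by (simp add: dot_transpose_mult[of w "mexp (s *\<^sub>R B)"] flip: matrix_vector_mul_assoc)
      also have "\<dots> \<ge> 0" using c(2) by (metis inner_zero_left less_le order_refl)
      finally show "0 \<le> w \<bullet> (?F s *v w)" .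
    qed
    finally show ?thesis .
  qed
  have "v \<bullet> (lyap B c *v v) \<noteq> 0"
  proof
    assume "v \<bullet> (lyap B c *v v) = 0"
    then have z: "lyap B c *v v = 0"
      using transpose_lyap[OF B] c(1) by (intro psd_zero_kernel nn) auto
    have "v \<bullet> (c *v v) = - (v \<bullet> ((B ** lyap B c + lyap B c ** B) *v v))"
      by (simp add: lyap_equation[OF B] bounded_bilinear.minus_left[OF matrix_vector_bb])
    also have "\<dots> = 0"
      using z transpose_lyap[OF B, of c] c(1) dot_transpose_mult[of v "lyap B c" "B *v v"]
      by (simp add: matrix_vector_mult_add_rdistrib inner_add_right flip: matrix_vector_mul_assoc)
    finally show False using c(2)[OF v] by simp
  qed
  with nn[of v] show ?thesis by simp
qed

section \<open>Differentiating the inverse along a line of matrices\<close>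

text \<open>Everything follows from the resolvent identity
  \<open>P h - P 0 = - h *\<^sub>R (P h ** N ** P 0)\<close>. Together with a bound on
  \<open>P h\<close> near 0 it yields continuity at 0, and continuity inserted into the same
  identity yields the derivative.\<close>

lemma matrix_inv_has_vector_derivative:
  fixes S N :: "real^'d^'d"
  assumes l: "0 < l" "\<And>w. l * (norm w)\<^sup>2 \<le> w \<bullet> (S *v w)"
  shows "((\<lambda>h. matrix_inv (S + h *\<^sub>R N)) has_vector_derivative - (matrix_inv S ** N ** matrix_inv S)) (at 0)"
proof -
  define P where "P h = matrix_inv (S + h *\<^sub>R N)" for h
  \<comment> \<open>Adding 1 keeps \<open>k\<close> positive even when \<open>N\<close>
    vanishes.\<close>
  define k where "k = onorm ((*v) N) + 1"
  have k: "norm (N *v w) \<le> k * norm w" "0 < k" for w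
  proof -
    have o: "0 \<le> onorm ((*v) N)" by (simp add: onorm_pos_le)
    then show "0 < k" by (simp add: k_def)
    have "norm (N *v w) \<le> onorm ((*v) N) * norm w" by (rule onorm) simp
    then show "norm (N *v w) \<le> k * norm w" by (simp add: k_def algebra_simps add_increasing)
  qed
  \<comment> \<open>Within this radius the perturbation \<open>h *\<^sub>R N\<close> consumes at
    most half of the coercivity constant \<open>l\<close> of \<open>S\<close>.\<close>
  define e where "e = l / (2 * k)"
  have e: "0 < e" using l k by (simp add: e_def)
  have pos: "l / 2 * (norm w)\<^sup>2 \<le> w \<bullet> ((S + h *\<^sub>R N) *v w)" if "\<bar>h\<bar> < e" for h w
  proof -
    have "\<bar>h * (w \<bullet> (N *v w))\<bar> \<le> \<bar>h\<bar> * (norm w * (k * norm w))"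
      unfolding abs_mult using k(1)[of w]
      by (intro mult_left_mono order.trans[OF Cauchy_Schwarz_ineq2] mult_left_mono) auto
    also have "\<dots> = \<bar>h\<bar> * k * (norm w)\<^sup>2" by (simp add: power2_eq_square algebra_simps)
    also have "\<bar>h\<bar> * k * (norm w)\<^sup>2 \<le> l / 2 * (norm w)\<^sup>2"
    proof (rule mult_right_mono)
      have "\<bar>h\<bar> * k \<le> e * k" using that k by (intro mult_mono) auto
      also have "\<dots> = l / 2" using k by (simp add: e_def)
      finally show "\<bar>h\<bar> * k \<le> l / 2" .
    qed simp
    finally show ?thesis using l(2)[of w]
      by (simp add: matrix_vector_mult_add_rdistrib inner_add_right bounded_bilinear.scaleR_left[OF matrix_vector_bb])
  qed
  have inv: "invertible (S + h *\<^sub>R N)" if "\<bar>h\<bar> < e" for h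
    using pos[OF that] l(1) by (intro invertible_posdef) (smt (verit) divide_pos_pos mult_pos_pos zero_less_norm_iff zero_less_power)
  note PS = matrix_inv_mult[OF inv, folded P_def]
  \<comment> \<open>Coercivity \<open>l / 2\<close> bounds the inverse as an operator by
    \<open>2 / l\<close>; the dimension factor converts this into a bound on the matrix
    norm.\<close>
  define D where "D = real CARD('d) * (2 / l)"
  have bP: "norm (transpose (P h)) \<le> D" if "\<bar>h\<bar> < e" for h
    unfolding D_def
  proof (rule norm_matrix_le)
    fix v
    let ?w = "P h *v v"
    have "l / 2 * (norm ?w)\<^sup>2 \<le> ?w \<bullet> v" using pos[OF that, of ?w] PS(3)[OF that] by simp
    also have "\<dots> \<le> norm ?w * norm v" by (rule norm_cauchy_schwarz)
    finally have "norm ?w * (l / 2 * norm ?w) \<le> norm ?w * norm v"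
      by (simp add: power2_eq_square algebra_simps)
    then have "l / 2 * norm ?w \<le> norm v"
      using l(1) by (cases "?w = 0") (auto simp: mult_le_cancel_left)
    then show "norm ?w \<le> 2 / l * norm v" using l(1) by (simp add: field_simps)
  qed
  obtain Kt where Kt: "\<And>M :: real^'d^'d. norm (transpose M) \<le> norm M * Kt" "0 \<le> Kt"
    using bounded_linear.nonneg_bounded[OF bounded_linear_transpose] by blast
  have bP': "norm (P h) \<le> D * Kt" if "\<bar>h\<bar> < e" for h
    using Kt(1)[of "transpose (P h)"] mult_right_mono[OF bP[OF that] Kt(2)] by simp
  have diff: "P h - P 0 = - h *\<^sub>R (P h ** N ** P 0)" if "\<bar>h\<bar> < e" for h
  proof -
    have "P h ** (S + h *\<^sub>R N) ** P 0 = P 0" using PS(2)[OF that] by simp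
    moreover have "P h ** S ** P 0 = P h" using PS(1)[of 0] e by (simp flip: matrix_mul_assoc)
    ultimately show ?thesis
      by (simp add: bounded_bilinear.add_left[OF matrix_mult_bb] bounded_bilinear.add_right[OF matrix_mult_bb]
      bounded_bilinear.scaleR_left[OF matrix_mult_bb] bounded_bilinear.scaleR_right[OF matrix_mult_bb] algebra_simps)
  qed
  obtain K where K: "\<And>(P :: real^'d^'d) (Q :: real^'d^'d). norm (P ** Q) \<le> norm P * norm Q * K" "0 \<le> K"
    using bounded_bilinear.nonneg_bounded[OF matrix_mult_bb] by blast
  have ev: "\<forall>\<^sub>F h in at 0. \<bar>h\<bar> < e \<and> h \<noteq> 0"
    using e by (auto simp: eventually_at dist_real_def intro!: exI[of _ e])
  have lim: "(P \<longlongrightarrow> P 0) (at 0)"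
  proof -
    have "((\<lambda>h. P h - P 0) \<longlongrightarrow> 0) (at 0)"
    proof (rule Lim_null_comparison)
      show "\<forall>\<^sub>F h in at 0. norm (P h - P 0) \<le> \<bar>h\<bar> * (D * Kt * norm N * K * norm (P 0) * K)"
      proof (rule eventually_mono[OF ev])
        fix h assume h: "\<bar>h\<bar> < e \<and> h \<noteq> 0"
        have "norm (P h ** N ** P 0) \<le> norm (P h ** N) * norm (P 0) * K" by (rule K)
        also have "\<dots> \<le> (norm (P h) * norm N * K) * norm (P 0) * K"
          using K by (intro mult_right_mono) auto
        also have "\<dots> \<le> (D * Kt * norm N * K) * norm (P 0) * K"
          using bP'[of h] h K by (intro mult_right_mono) auto
        finally show "norm (P h - P 0) \<le> \<bar>h\<bar> * (D * Kt * norm N * K * norm (P 0) * K)"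
          using h diff[of h] by (simp add: mult_left_mono)
      qed
      show "((\<lambda>h. \<bar>h\<bar> * (D * Kt * norm N * K * norm (P 0) * K)) \<longlongrightarrow> 0) (at 0)"
        by (intro tendsto_mult_left_zero tendsto_rabs_zero tendsto_ident_at)
    qed
    then show ?thesis by (simp add: LIM_zero_iff)
  qed
  have "((\<lambda>h. (1 / h) *\<^sub>R (P h - P 0)) \<longlongrightarrow> - (P 0 ** N ** P 0)) (at 0)"
  proof (rule Lim_transform_eventually)
    show "((\<lambda>h. - (P h ** N ** P 0)) \<longlongrightarrow> - (P 0 ** N ** P 0)) (at 0)"
      by (intro tendsto_minus bounded_bilinear.tendsto[OF matrix_mult_bb] lim tendsto_const)
    show "\<forall>\<^sub>F h in at 0. - (P h ** N ** P 0) = (1 / h) *\<^sub>R (P h - P 0)"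
      by (rule eventually_mono[OF ev]) (simp add: diff)
  qed
  then have "(P has_vector_derivative - (P 0 ** N ** P 0)) (at 0)"
    unfolding has_vector_derivative_def has_derivative_at
  proof (intro conjI bounded_linear_scaleR_left)
    assume "((\<lambda>h. (1 / h) *\<^sub>R (P h - P 0)) \<longlongrightarrow> - (P 0 ** N ** P 0)) (at 0)"
    then have "((\<lambda>h. norm ((1 / h) *\<^sub>R (P h - P 0) - - (P 0 ** N ** P 0))) \<longlongrightarrow> 0) (at 0)"
      by (rule tendsto_norm_zero[OF LIM_zero])
    moreover have "\<forall>\<^sub>F h in at 0. norm ((1 / h) *\<^sub>R (P h - P 0) - - (P 0 ** N ** P 0))
       = norm (P (0 + h) - P 0 - h *\<^sub>R - (P 0 ** N ** P 0)) / norm h"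
    proof (rule eventually_mono[OF ev])
      fix h assume h: "\<bar>h\<bar> < e \<and> h \<noteq> 0"
      have "(1 / h) *\<^sub>R (P h - P 0) - - (P 0 ** N ** P 0)
         = (1 / h) *\<^sub>R (P (0 + h) - P 0 - h *\<^sub>R - (P 0 ** N ** P 0))"
        using h by (simp add: scaleR_diff_right scaleR_add_right)
      then show "norm ((1 / h) *\<^sub>R (P h - P 0) - - (P 0 ** N ** P 0))
       = norm (P (0 + h) - P 0 - h *\<^sub>R - (P 0 ** N ** P 0)) / norm h"
        by (simp only: norm_scaleR) simp
    qed
    ultimately show "((\<lambda>h. norm (P (0 + h) - P 0 - h *\<^sub>R - (P 0 ** N ** P 0)) / norm h) \<longlongrightarrow> 0) (at 0)"
      by (rule Lim_transform_eventually)
  qed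
  then show ?thesis by (simp add: P_def[abs_def])
qed

section \<open>Orbits of the flow \<open>z' = - B z\<close>\<close>

lemma mexp_orbit_has_vector_derivative:
  "((\<lambda>r. mexp ((t - r) *\<^sub>R B) *v \<zeta>) has_vector_derivative - (B *v (mexp ((t - r) *\<^sub>R B) *v \<zeta>))) (at r within Q)"
proof -
  have "((\<lambda>r. mexp ((t - r) *\<^sub>R B) *v \<zeta>) has_vector_derivative (- (B ** mexp ((t - r) *\<^sub>R B))) *v \<zeta>) (at r within Q)"
    by (rule bounded_linear.has_vector_derivative[OF bounded_bilinear.bounded_linear_left[OF matrix_vector_bb] mexp_rev_has_vector_derivative])
  then show ?thesis
    by (simp add: bounded_bilinear.minus_left[OF matrix_vector_bb] matrix_vector_mul_assoc)
qed

text \<open>The product rule gives the form of \<open>- (B ** S + S ** B)\<close>, which the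
  Lyapunov equation identifies with \<open>a\<close>. Hence the variance collected by the noise
  along an orbit is a difference of values of the \<open>S\<close>-form, both in the backward
  equation and in the two-time law.\<close>

lemma mexp_orbit_quadratic_derivative:
  fixes B S a :: "real^'d^'d"
  assumes B: "transpose B = B" and S: "B ** S + S ** B = - a" and z: "\<And>r. z r = mexp ((t - r) *\<^sub>R B) *v \<zeta>"
  shows "((\<lambda>r. z r \<bullet> (S *v z r)) has_real_derivative z r \<bullet> (a *v z r)) (at r within Q)"
proof -
  have symB: "(B *v u) \<bullet> v = u \<bullet> (B *v v)" for u v
    by (metis B dot_transpose_mult)
  have z': "(z has_vector_derivative - (B *v z r)) (at r within Q)" for r Q
    using mexp_orbit_has_vector_derivative[of t B \<zeta> r Q] by (simp add: z[abs_def])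
  have "((\<lambda>r. S *v z r) has_vector_derivative S *v (- (B *v z r))) (at r within Q)"
    by (rule bounded_linear.has_vector_derivative[OF bounded_bilinear.bounded_linear_right[OF matrix_vector_bb] z'])
  from bounded_bilinear.has_vector_derivative[OF bounded_bilinear_inner z'[of r Q] this]
  have "((\<lambda>r. z r \<bullet> (S *v z r)) has_real_derivative z r \<bullet> (S *v (- (B *v z r))) + (- (B *v z r)) \<bullet> (S *v z r)) (at r within Q)"
    by (simp add: has_real_derivative_iff_has_vector_derivative)
  moreover have "z r \<bullet> (S *v (- (B *v z r))) + (- (B *v z r)) \<bullet> (S *v z r) = z r \<bullet> (a *v z r)"
  proof -
    have "a = - (B ** S + S ** B)" using S by simp
    then have "z r \<bullet> (a *v z r) = - (z r \<bullet> (B *v (S *v z r))) - z r \<bullet> (S *v (B *v z r))"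
      by (simp add: bounded_bilinear.minus_left[OF matrix_vector_bb] bounded_bilinear.diff_left[OF matrix_vector_bb]
        bounded_bilinear.add_left[OF matrix_vector_bb] inner_diff_right inner_add_right flip: matrix_vector_mul_assoc)
    then show ?thesis
      by (simp add: symB bounded_bilinear.minus_right[OF matrix_vector_bb])
  qed
  ultimately show ?thesis by simp
qed

lemma mexp_scaleR_commute: "B ** mexp (r *\<^sub>R B) = mexp (r *\<^sub>R B) ** B"
proof (cases "r = 0")
  case False
  have "r *\<^sub>R (B ** mexp (r *\<^sub>R B)) = r *\<^sub>R (mexp (r *\<^sub>R B) ** B)"
    using mexp_commute[of "r *\<^sub>R B"]
    by (simp add: bounded_bilinear.scaleR_left[OF matrix_mult_bb] bounded_bilinear.scaleR_right[OF matrix_mult_bb])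
  then show ?thesis using False by simp
qed simp

section \<open>Uniqueness of characteristic functions\<close>

text \<open>The phase \<theta> makes sines available as shifted cosines, so one real family replaces
  complex exponentials. Closure under products is not built in; it comes from the product-to-sum
  formula and is what admits polynomials in sines.\<close>

inductive trig_poly :: "('a::real_inner \<Rightarrow> real) \<Rightarrow> bool" where
  cos: "trig_poly (\<lambda>x. cos (\<xi> \<bullet> x + \<theta>))"
| scale: "trig_poly p \<Longrightarrow> trig_poly (\<lambda>x. c * p x)"
| add: "trig_poly p \<Longrightarrow> trig_poly q \<Longrightarrow> trig_poly (\<lambda>x. p x + q x)"

lemma trig_poly_mult:
  assumes "trig_poly p" "trig_poly q"
  shows "trig_poly (\<lambda>x. p x * q x)"
  using assms(1)
proof (induction rule: trig_poly.induct)
  case (cos \<xi> \<theta>)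
  show ?case using assms(2)
  proof (induction rule: trig_poly.induct)
    case (cos \<eta> \<kappa>)
    have e: "cos (\<xi> \<bullet> x + \<theta>) * cos (\<eta> \<bullet> x + \<kappa>)
      = (1/2) * (cos ((\<xi> - \<eta>) \<bullet> x + (\<theta> - \<kappa>)) + cos ((\<xi> + \<eta>) \<bullet> x + (\<theta> + \<kappa>)))" for x
    proof -
      have "(\<xi> - \<eta>) \<bullet> x + (\<theta> - \<kappa>) = (\<xi> \<bullet> x + \<theta>) - (\<eta> \<bullet> x + \<kappa>)"
        "(\<xi> + \<eta>) \<bullet> x + (\<theta> + \<kappa>) = (\<xi> \<bullet> x + \<theta>) + (\<eta> \<bullet> x + \<kappa>)"
        by (simp_all add: inner_diff_left inner_add_left)
      then show ?thesis using cos_times_cos[of "\<xi> \<bullet> x + \<theta>" "\<eta> \<bullet> x + \<kappa>"] by (simp only:)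
    qed
    show ?case unfolding e by (intro trig_poly.intros)
  next
    case (scale p c)
    have e: "cos (\<xi> \<bullet> x + \<theta>) * (c * p x) = c * (cos (\<xi> \<bullet> x + \<theta>) * p x)" for x by simp
    show ?case unfolding e by (intro trig_poly.scale scale.IH)
  next
    case (add p q)
    then show ?case by (simp add: distrib_left trig_poly.add)
  qed
next
  case (scale p c)
  then show ?case by (simp add: mult.assoc trig_poly.scale)
next
  case (add p q)
  then show ?case by (simp add: distrib_right trig_poly.add)
qed

lemma trig_poly_const: "trig_poly (\<lambda>x. c)"
  using trig_poly.scale[OF trig_poly.cos[of 0 0], of c] by simp

lemma trig_poly_sum: "(\<And>i. i \<in> I \<Longrightarrow> trig_poly (p i)) \<Longrightarrow> trig_poly (\<lambda>x. \<Sum>i\<in>I. p i x)"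
  by (induction I rule: infinite_finite_induct) (auto intro: trig_poly.add trig_poly_const)

lemma trig_poly_sin: "trig_poly (\<lambda>x. sin (\<xi> \<bullet> x))"
  using trig_poly.cos[of \<xi> "- (pi/2)"] by (simp add: cos_diff)

definition sin_map :: "real \<Rightarrow> 'a::euclidean_space \<Rightarrow> 'a" where
  "sin_map L x = (\<Sum>b\<in>Basis. sin ((b /\<^sub>R L) \<bullet> x) *\<^sub>R b)"

lemma trig_poly_polynomial_sin_map:
  assumes "real_polynomial_function p"
  shows "trig_poly (\<lambda>x :: 'a::euclidean_space. p (sin_map L x))"
  using assms
proof (induction rule: real_polynomial_function.induct)
  case (linear f)
  interpret bounded_linear f by fact
  have e: "f (sin_map L x) = (\<Sum>b\<in>Basis. f b * sin ((b /\<^sub>R L) \<bullet> x))" for x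
    by (simp add: sin_map_def sum scaleR mult.commute)
  show ?case unfolding e by (intro trig_poly_sum trig_poly.scale trig_poly_sin)
qed (auto intro: trig_poly_const trig_poly.add trig_poly_mult)

lemma expectation_abs_le:
  assumes "prob_space M" "integrable M f" "\<And>\<omega>. \<bar>f \<omega>\<bar> \<le> (c :: real)"
  shows "\<bar>\<integral>\<omega>. f \<omega> \<partial>M\<bar> \<le> c"
proof -
  interpret prob_space M by fact
  have "\<bar>\<integral>\<omega>. f \<omega> \<partial>M\<bar> \<le> (\<integral>\<omega>. \<bar>f \<omega>\<bar> \<partial>M)" by (rule integral_abs_bound)
  also have "\<dots> \<le> (\<integral>\<omega>. c \<partial>M)" using assms by (intro integral_mono) auto
  finally show ?thesis by (simp add: prob_space)
qed

text \<open>Every bounded continuous \<open>f\<close> is the pointwise bounded limit, as \<open>L \<rightarrow> \<infinity>\<close>, of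
  \<open>x \<mapsto> f (L arcsin (sin (x\<^sub>i / L)))\<^sub>i\<close>; each of these functions is a continuous function of the
  sines, hence a uniform limit on the whole space of polynomials in them, that is, of
  trigonometric polynomials.\<close>

lemma expectation_eq_of_char_eq:
  fixes X :: "'m \<Rightarrow> 'a::euclidean_space" and Y :: "'n \<Rightarrow> 'a" and f :: "'a \<Rightarrow> real"
  assumes M: "prob_space M" and N: "prob_space N"
    and X[measurable]: "X \<in> borel_measurable M" and Y[measurable]: "Y \<in> borel_measurable N"
    and char: "\<And>\<xi> \<theta>. (\<integral>\<omega>. cos (\<xi> \<bullet> X \<omega> + \<theta>) \<partial>M) = (\<integral>\<omega>. cos (\<xi> \<bullet> Y \<omega> + \<theta>) \<partial>N)"
    and f: "continuous_on UNIV f" "\<And>x. \<bar>f x\<bar> \<le> C"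
  shows "(\<integral>\<omega>. f (X \<omega>) \<partial>M) = (\<integral>\<omega>. f (Y \<omega>) \<partial>N)"
proof -
  interpret M: prob_space M by fact
  interpret N: prob_space N by fact
  have trig: "integrable M (\<lambda>\<omega>. p (X \<omega>)) \<and> integrable N (\<lambda>\<omega>. p (Y \<omega>)) \<and>
     (\<integral>\<omega>. p (X \<omega>) \<partial>M) = (\<integral>\<omega>. p (Y \<omega>) \<partial>N)" if "trig_poly p" for p
    using that
  proof (induction rule: trig_poly.induct)
    case (cos \<xi> \<theta>)
    have "integrable M (\<lambda>\<omega>. cos (\<xi> \<bullet> X \<omega> + \<theta>))" by (rule M.integrable_const_bound[of _ 1]) auto
    moreover have "integrable N (\<lambda>\<omega>. cos (\<xi> \<bullet> Y \<omega> + \<theta>))" by (rule N.integrable_const_bound[of _ 1]) auto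
    ultimately show ?case using char by simp
  qed simp_all
  \<comment> \<open>Clamping to \<open>[-1, 1]\<close> makes the composition with
    \<open>arcsin\<close> continuous on the whole line, and it changes nothing at values of the
    sine.\<close>
  define c :: "real \<Rightarrow> real" where "c u = max (- 1) (min 1 u)" for u
  define F where "F L u = f (\<Sum>b\<in>Basis. (L * arcsin (c (u \<bullet> b))) *\<^sub>R b)" for L u
  have contF: "continuous_on UNIV (F L)" for L
    unfolding F_def c_def
    by (intro continuous_on_compose2[OF f(1)] continuous_intros) auto
  have conts: "continuous_on UNIV (sin_map L :: 'a \<Rightarrow> 'a)" for L
    unfolding sin_map_def by (intro continuous_intros)
  have cF: "continuous_on UNIV (\<lambda>x :: 'a. F L (sin_map L x))" for L
    by (rule continuous_on_compose2[OF contF conts]) auto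
  have [measurable]: "(\<lambda>x :: 'a. F L (sin_map L x)) \<in> borel_measurable borel" for L
    by (rule borel_measurable_continuous_onI[OF cF])
  have bF: "\<bar>F L u\<bar> \<le> C" for L u unfolding F_def by (rule f)
  have s1: "sin_map L x \<bullet> b = sin ((x \<bullet> b) / L)" if "b \<in> Basis" for L x and b :: 'a
    using that by (simp add: sin_map_def inner_sum_left inner_Basis if_distrib cong: if_cong)
       (simp add: inner_commute divide_inverse mult.commute)
  have sbox: "sin_map L x \<in> cbox (- One) One" for L and x :: 'a
    by (auto simp: mem_box s1)
  have eqL: "(\<integral>\<omega>. F L (sin_map L (X \<omega>)) \<partial>M) = (\<integral>\<omega>. F L (sin_map L (Y \<omega>)) \<partial>N)" for L
  proof (rule ccontr)
    assume ne: "\<not> ?thesis"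
    \<comment> \<open>A third of the gap: two approximation errors of at most \<open>e\<close>
      cannot account for a difference of \<open>3 * e\<close>.\<close>
    define e where "e = \<bar>(\<integral>\<omega>. F L (sin_map L (X \<omega>)) \<partial>M) - (\<integral>\<omega>. F L (sin_map L (Y \<omega>)) \<partial>N)\<bar> / 3"
    have e: "0 < e" using ne by (simp add: e_def)
    obtain p where p: "real_polynomial_function p" "\<And>u. u \<in> cbox (- One) (One::'a) \<Longrightarrow> \<bar>F L u - p u\<bar> < e"
      using Stone_Weierstrass_real_polynomial_function[OF compact_cbox continuous_on_subset[OF contF subset_UNIV] e]
      by blast
    note T = trig[OF trig_poly_polynomial_sin_map[OF p(1), of L]]
    have a: "\<bar>(\<integral>\<omega>. F L (sin_map L (X \<omega>)) \<partial>M) - (\<integral>\<omega>. p (sin_map L (X \<omega>)) \<partial>M)\<bar> \<le> e"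
    proof -
      have i: "integrable M (\<lambda>\<omega>. F L (sin_map L (X \<omega>)))"
        using bF by (intro M.integrable_const_bound[of _ C]) auto
      have "\<bar>\<integral>\<omega>. F L (sin_map L (X \<omega>)) - p (sin_map L (X \<omega>)) \<partial>M\<bar> \<le> e"
        using T i p(2)[OF sbox] by (intro expectation_abs_le[OF M]) (auto intro: less_imp_le)
      then show ?thesis using T i by (simp add: M.prob_space)
    qed
    have b: "\<bar>(\<integral>\<omega>. F L (sin_map L (Y \<omega>)) \<partial>N) - (\<integral>\<omega>. p (sin_map L (Y \<omega>)) \<partial>N)\<bar> \<le> e"
    proof -
      have i: "integrable N (\<lambda>\<omega>. F L (sin_map L (Y \<omega>)))"
        using bF by (intro N.integrable_const_bound[of _ C]) auto
      have "\<bar>\<integral>\<omega>. F L (sin_map L (Y \<omega>)) - p (sin_map L (Y \<omega>)) \<partial>N\<bar> \<le> e"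
        using T i p(2)[OF sbox] by (intro expectation_abs_le[OF N]) (auto intro: less_imp_le)
      then show ?thesis using T i by (simp add: N.prob_space)
    qed
    have "3 * e = \<bar>(\<integral>\<omega>. F L (sin_map L (X \<omega>)) \<partial>M) - (\<integral>\<omega>. F L (sin_map L (Y \<omega>)) \<partial>N)\<bar>"
      by (simp add: e_def)
    then have "3 * e \<le> 2 * e" using a b conjunct2[OF conjunct2[OF T]] by linarith
    with e show False by simp
  qed
  have lim: "(\<lambda>n. F (real (Suc n)) (sin_map (real (Suc n)) x)) \<longlonglongrightarrow> f x" for x
  proof -
    obtain n0 :: nat where n0: "norm x < real n0" using reals_Archimedean2 by blast
    \<comment> \<open>Once \<open>n\<close> exceeds \<open>norm x\<close>, every coordinate divided
      by \<open>Suc n\<close> has modulus at most \<open>1 \<le> pi / 2\<close>, where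
      \<open>arcsin\<close> inverts \<open>sin\<close>; the sequence is eventually constant.\<close>
    have "F (real (Suc n)) (sin_map (real (Suc n)) x) = f x" if "n0 \<le> n" for n
    proof -
      have "real (Suc n) * arcsin (c (sin_map (real (Suc n)) x \<bullet> b)) = x \<bullet> b" if b: "b \<in> Basis" for b
      proof -
        have "\<bar>x \<bullet> b\<bar> \<le> real (Suc n)" using Basis_le_norm[OF b, of x] n0 \<open>n0 \<le> n\<close> by simp
        then have "\<bar>(x \<bullet> b) / real (Suc n)\<bar> \<le> 1" by (simp add: abs_div del: of_nat_Suc)
        then have "\<bar>(x \<bullet> b) / real (Suc n)\<bar> \<le> pi / 2" using pi_ge_two by linarith
        then have "arcsin (sin ((x \<bullet> b) / real (Suc n))) = (x \<bullet> b) / real (Suc n)"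
          by (intro arcsin_sin) (simp_all only: abs_le_iff, linarith+)
        then show ?thesis using b by (simp add: s1 c_def del: of_nat_Suc)
      qed
      then show ?thesis by (simp add: F_def euclidean_representation del: of_nat_Suc)
    qed
    then show ?thesis by (intro tendsto_eventually eventually_sequentiallyI[of n0]) 
  qed
  have "(\<lambda>n. \<integral>\<omega>. F (real (Suc n)) (sin_map (real (Suc n)) (X \<omega>)) \<partial>M) \<longlonglongrightarrow> (\<integral>\<omega>. f (X \<omega>) \<partial>M)"
    using f bF lim borel_measurable_continuous_onI[OF f(1)]
    by (intro integral_dominated_convergence[of _ _ _ "\<lambda>_. C"]) auto
  moreover have "(\<lambda>n. \<integral>\<omega>. F (real (Suc n)) (sin_map (real (Suc n)) (Y \<omega>)) \<partial>N) \<longlonglongrightarrow> (\<integral>\<omega>. f (Y \<omega>) \<partial>N)"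
    using f bF lim borel_measurable_continuous_onI[OF f(1)]
    by (intro integral_dominated_convergence[of _ _ _ "\<lambda>_. C"]) auto
  ultimately show ?thesis unfolding eqL using LIMSEQ_unique by blast
qed

section \<open>From equal expectations to equal laws and independence\<close>

text \<open>Indicators of open sets are pointwise limits of the bounded continuous functions
  \<open>min 1 (n * infdist x (- U))\<close>, and the open sets form an intersection-stable
  generator of the Borel sets.\<close>

lemma distr_eq_of_char_eq:
  fixes X :: "'m \<Rightarrow> 'a::euclidean_space" and Y :: "'n \<Rightarrow> 'a"
  assumes M: "prob_space M" and N: "prob_space N"
    and X[measurable]: "X \<in> borel_measurable M" and Y[measurable]: "Y \<in> borel_measurable N"
    and char: "\<And>\<xi> \<theta>. (\<integral>\<omega>. cos (\<xi> \<bullet> X \<omega> + \<theta>) \<partial>M) = (\<integral>\<omega>. cos (\<xi> \<bullet> Y \<omega> + \<theta>) \<partial>N)"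
  shows "distr M borel X = distr N borel Y"
proof -
  interpret M: prob_space M by fact
  interpret N: prob_space N by fact
  interpret MX: prob_space "distr M borel X" by (rule M.prob_space_distr) simp
  interpret NY: prob_space "distr N borel Y" by (rule N.prob_space_distr) simp
  have open_eq: "measure (distr M borel X) U = measure (distr N borel Y) U" if U: "open U" for U
  \<comment> \<open>For the whole space the complement is empty and \<open>infdist\<close> to it is
    0 by convention, so the approximating functions would all vanish.\<close>
  proof (cases "U = UNIV")
    case False
    define g where "g n x = min 1 (real n * infdist x (- U))" for n x
    have cg: "continuous_on UNIV (g n)" for n unfolding g_def by (intro continuous_intros)
    have [measurable]: "g n \<in> borel_measurable borel" for n by (rule borel_measurable_continuous_onI[OF cg])
    have bg: "\<bar>g n x\<bar> \<le> 1" for n x by (simp add: g_def infdist_nonneg)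
    have lg: "(\<lambda>n. g n x) \<longlonglongrightarrow> indicat_real U x" for x
    proof (cases "x \<in> U")
      case True
      have "infdist x (- U) \<noteq> 0"
        using in_closed_iff_infdist_zero[of "- U" x] U False True by (auto simp: closed_Compl)
      then have p: "0 < infdist x (- U)" using infdist_nonneg[of x "- U"] by linarith
      then obtain n0 :: nat where n0: "1 < real n0 * infdist x (- U)"
        using reals_Archimedean3 by blast
      have "g n x = 1" if "n0 \<le> n" for n
      proof -
        have "real n0 * infdist x (- U) \<le> real n * infdist x (- U)"
          using that p by (intro mult_right_mono) auto
        then show ?thesis using n0 by (simp add: g_def)
      qed
      then show ?thesis using True by (intro tendsto_eventually eventually_sequentiallyI[of n0]) auto
    next
      case False
      then have "infdist x (- U) = 0" by simp
      then show ?thesis using False by (simp add: g_def)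
    qed
    have [measurable]: "U \<in> sets borel" using U by simp
    have "(\<lambda>n. \<integral>\<omega>. g n (X \<omega>) \<partial>M) \<longlonglongrightarrow> (\<integral>\<omega>. indicat_real U (X \<omega>) \<partial>M)"
      using bg lg by (intro integral_dominated_convergence[of _ _ _ "\<lambda>_. 1"]) auto
    moreover have "(\<lambda>n. \<integral>\<omega>. g n (Y \<omega>) \<partial>N) \<longlonglongrightarrow> (\<integral>\<omega>. indicat_real U (Y \<omega>) \<partial>N)"
      using bg lg by (intro integral_dominated_convergence[of _ _ _ "\<lambda>_. 1"]) auto
    moreover have "(\<integral>\<omega>. g n (X \<omega>) \<partial>M) = (\<integral>\<omega>. g n (Y \<omega>) \<partial>N)" for n
      by (rule expectation_eq_of_char_eq[OF M N X Y char cg bg])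
    ultimately have "(\<integral>\<omega>. indicat_real U (X \<omega>) \<partial>M) = (\<integral>\<omega>. indicat_real U (Y \<omega>) \<partial>N)"
      using LIMSEQ_unique by simp
    moreover have "MX.prob U = (\<integral>\<omega>. indicat_real U (X \<omega>) \<partial>M)" "NY.prob U = (\<integral>\<omega>. indicat_real U (Y \<omega>) \<partial>N)"
      using integral_distr[of X M borel "indicat_real U"] integral_distr[of Y N borel "indicat_real U"]
      by (simp_all del: integral_distr)
    ultimately show ?thesis by simp
  next
    case True
    then show ?thesis using MX.prob_space NY.prob_space by simp
  qed
  show ?thesis
  proof (rule measure_eqI_generator_eq[where E="Collect open" and \<Omega>=UNIV and A="\<lambda>_. UNIV"])
    show "Int_stable (Collect (open :: 'a set \<Rightarrow> bool))" by (auto simp: Int_stable_def)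
    show "emeasure (distr M borel X) U = emeasure (distr N borel Y) U" if "U \<in> Collect open" for U
      using open_eq[of U] that by (simp add: MX.emeasure_eq_measure NY.emeasure_eq_measure)
    show "sets (distr M borel X) = sigma_sets UNIV (Collect open)" "sets (distr N borel Y) = sigma_sets UNIV (Collect open)"
      by (simp_all add: borel_def)
  qed auto
qed

text \<open>By Fubini the iterated integral is the characteristic function of
  \<open>(U \<omega>, V \<omega>')\<close> on the product of \<open>M\<close> with itself, whose law
  is the product of the marginals; uniqueness concludes.\<close>

lemma indep_of_char_factor:
  fixes U :: "'m \<Rightarrow> 'a::euclidean_space" and V :: "'m \<Rightarrow> 'b::euclidean_space"
  assumes M: "prob_space M"
    and U[measurable]: "U \<in> borel_measurable M" and V[measurable]: "V \<in> borel_measurable M"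
    and char: "\<And>\<xi> \<eta> \<theta>. (\<integral>\<omega>. cos (\<xi> \<bullet> U \<omega> + \<eta> \<bullet> V \<omega> + \<theta>) \<partial>M)
       = (\<integral>\<omega>. (\<integral>\<omega>'. cos (\<xi> \<bullet> U \<omega> + \<eta> \<bullet> V \<omega>' + \<theta>) \<partial>M) \<partial>M)"
  shows "distr M borel (\<lambda>\<omega>. (U \<omega>, V \<omega>)) = distr M borel U \<Otimes>\<^sub>M distr M borel V"
proof -
  interpret M: prob_space M by fact
  interpret P: pair_prob_space M M ..
  have pr: "prob_space (M \<Otimes>\<^sub>M M)" by (rule P.prob_space_axioms)
  have "distr M borel (\<lambda>\<omega>. (U \<omega>, V \<omega>)) = distr (M \<Otimes>\<^sub>M M) borel (\<lambda>(\<omega>, \<omega>'). (U \<omega>, V \<omega>'))"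
  proof (rule distr_eq_of_char_eq[OF M pr])
    show "(\<lambda>\<omega>. (U \<omega>, V \<omega>)) \<in> borel_measurable M"
      unfolding borel_prod[symmetric] by simp
    show "(\<lambda>(\<omega>, \<omega>'). (U \<omega>, V \<omega>')) \<in> borel_measurable (M \<Otimes>\<^sub>M M)"
      unfolding borel_prod[symmetric] by simp
    fix \<xi> :: "'a \<times> 'b" and \<theta>
    obtain \<xi>1 \<xi>2 where \<xi>: "\<xi> = (\<xi>1, \<xi>2)" by (cases \<xi>)
    have i: "integrable (M \<Otimes>\<^sub>M M) (\<lambda>(\<omega>, \<omega>'). cos (\<xi>1 \<bullet> U \<omega> + \<xi>2 \<bullet> V \<omega>' + \<theta>))"
      by (rule P.integrable_const_bound[of _ 1]) auto
    have "(\<integral>\<omega>. cos (\<xi> \<bullet> (U \<omega>, V \<omega>) + \<theta>) \<partial>M) = (\<integral>\<omega>. (\<integral>\<omega>'. cos (\<xi>1 \<bullet> U \<omega> + \<xi>2 \<bullet> V \<omega>' + \<theta>) \<partial>M) \<partial>M)"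
      using char[of \<xi>1 \<xi>2 \<theta>] by (simp add: \<xi>)
    also have "\<dots> = (\<integral>(\<omega>, \<omega>'). cos (\<xi>1 \<bullet> U \<omega> + \<xi>2 \<bullet> V \<omega>' + \<theta>) \<partial>(M \<Otimes>\<^sub>M M))"
      using P.integral_fst'[OF i] by simp
    finally show "(\<integral>\<omega>. cos (\<xi> \<bullet> (U \<omega>, V \<omega>) + \<theta>) \<partial>M)
       = (\<integral>\<omega>. cos (\<xi> \<bullet> (case \<omega> of (\<omega>, \<omega>') \<Rightarrow> (U \<omega>, V \<omega>')) + \<theta>) \<partial>(M \<Otimes>\<^sub>M M))"
      by (simp add: \<xi> case_prod_unfold)
  qed
  also have "\<dots> = distr M borel U \<Otimes>\<^sub>M distr M borel V"
    using pair_measure_distr[OF U V prob_space_imp_sigma_finite[OF M.prob_space_distr[OF V]]]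
    by (simp add: borel_prod)
  finally show ?thesis .
qed

section \<open>Gaussian vectors and Stein's identity\<close>

text \<open>After standardising, the cosine is the real part of
  \<open>cis (\<mu> + \<theta>)\<close> times \<open>iexp (\<sigma> * N \<omega>)\<close>, so the
  characteristic function of the standard normal law at \<sigma> gives the value.\<close>

lemma expectation_cos_normal:
  assumes M: "prob_space M" and s: "0 < \<sigma>"
    and d: "distributed M lborel Z (normal_density \<mu> \<sigma>)"
  shows "(\<integral>\<omega>. cos (Z \<omega> + \<theta>) \<partial>M) = exp (- \<sigma>\<^sup>2 / 2) * cos (\<mu> + \<theta>)"
proof -
  interpret prob_space M by fact
  have Z[measurable]: "Z \<in> borel_measurable M" using d by (auto simp: distributed_def)
  define N where "N \<omega> = (Z \<omega> - \<mu>) / \<sigma>" for \<omega>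
  have [measurable]: "N \<in> borel_measurable M" unfolding N_def by simp
  have dN: "distributed M lborel N std_normal_density"
    using d normal_standard_normal_convert[OF s, of Z \<mu>] by (simp add: N_def[abs_def])
  have "char (distr M lborel N) \<sigma> = complex_of_real (exp (- (\<sigma>\<^sup>2) / 2))"
    using dN char_std_normal_distribution by (simp add: distributed_def)
  then have c: "(\<integral>\<omega>. iexp (\<sigma> * N \<omega>) \<partial>M) = complex_of_real (exp (- (\<sigma>\<^sup>2) / 2))"
    unfolding char_def by (simp add: integral_distr)
  have i: "integrable M (\<lambda>\<omega>. iexp (\<sigma> * N \<omega>))" by (rule integrable_const_bound[of _ 1]) auto
  have e: "cos (Z \<omega> + \<theta>) = Re (cis (\<mu> + \<theta>) * iexp (\<sigma> * N \<omega>))" for \<omega>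
  proof -
    have "cis (\<mu> + \<theta>) * iexp (\<sigma> * N \<omega>) = cis (\<mu> + \<theta> + \<sigma> * N \<omega>)"
      by (simp add: cis_conv_exp flip: exp_add) (simp add: algebra_simps)
    moreover have "\<mu> + \<theta> + \<sigma> * N \<omega> = Z \<omega> + \<theta>" using s by (simp add: N_def)
    ultimately show ?thesis by simp
  qed
  have "(\<integral>\<omega>. cos (Z \<omega> + \<theta>) \<partial>M) = Re (\<integral>\<omega>. cis (\<mu> + \<theta>) * iexp (\<sigma> * N \<omega>) \<partial>M)"
    unfolding e using i by (intro integral_Re) auto
  also have "\<dots> = Re (cis (\<mu> + \<theta>) * complex_of_real (exp (- (\<sigma>\<^sup>2) / 2)))"
    using c by simp
  finally show ?thesis by (simp add: mult.commute)
qed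

text \<open>The definition of \<open>gaussian_vec\<close> treats positive variance and everything
  else separately. Under \<open>nn\<close> the second branch means variance zero: the projection is
  almost surely constant and the exponential factor is 1.\<close>

lemma gaussian_vec_char:
  fixes Z :: "'a \<Rightarrow> real^'d"
  assumes M: "prob_space M" and Z: "gaussian_vec M Z \<mu> C" and nn: "0 \<le> \<xi> \<bullet> (C *v \<xi>)"
  shows "(\<integral>\<omega>. cos (\<xi> \<bullet> Z \<omega> + \<theta>) \<partial>M) = exp (- (\<xi> \<bullet> (C *v \<xi>)) / 2) * cos (\<xi> \<bullet> \<mu> + \<theta>)"
proof (cases "0 < \<xi> \<bullet> (C *v \<xi>)")
  case True
  then have "distributed M lborel (\<lambda>\<omega>. \<xi> \<bullet> Z \<omega>) (normal_density (\<xi> \<bullet> \<mu>) (sqrt (\<xi> \<bullet> (C *v \<xi>))))"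
    using Z unfolding gaussian_vec_def by meson
  from expectation_cos_normal[OF M _ this] True show ?thesis by simp
next
  case False
  interpret prob_space M by fact
  have [measurable]: "Z \<in> borel_measurable M" using Z by (simp add: gaussian_vec_def)
  have "AE \<omega> in M. \<xi> \<bullet> Z \<omega> = \<xi> \<bullet> \<mu>" using False Z unfolding gaussian_vec_def by meson
  then have "(\<integral>\<omega>. cos (\<xi> \<bullet> Z \<omega> + \<theta>) \<partial>M) = (\<integral>\<omega>. cos (\<xi> \<bullet> \<mu> + \<theta>) \<partial>M)"
    by (intro integral_cong_AE) (auto elim!: eventually_mono)
  moreover have "\<xi> \<bullet> (C *v \<xi>) = 0" using nn False by simp
  ultimately show ?thesis by (simp add: prob_space)
qed

lemma gaussian_vec_moments:
  fixes Z :: "'a \<Rightarrow> real^'d"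
  assumes M: "prob_space M" and Z: "gaussian_vec M Z \<mu> C"
  shows "integrable M (\<lambda>\<omega>. \<xi> \<bullet> Z \<omega>)" "integrable M (\<lambda>\<omega>. (\<xi> \<bullet> (Z \<omega> - \<mu>))\<^sup>2)"
    "(\<integral>\<omega>. \<xi> \<bullet> Z \<omega> \<partial>M) = \<xi> \<bullet> \<mu>"
proof -
  interpret prob_space M by fact
  have Zm[measurable]: "Z \<in> borel_measurable M" using Z by (simp add: gaussian_vec_def)
  have "integrable M (\<lambda>\<omega>. \<xi> \<bullet> Z \<omega>) \<and> integrable M (\<lambda>\<omega>. (\<xi> \<bullet> Z \<omega> - \<xi> \<bullet> \<mu>)\<^sup>2) \<and> (\<integral>\<omega>. \<xi> \<bullet> Z \<omega> \<partial>M) = \<xi> \<bullet> \<mu>"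
  proof (cases "0 < \<xi> \<bullet> (C *v \<xi>)")
    case True
    define s where "s = sqrt (\<xi> \<bullet> (C *v \<xi>))"
    have s: "0 < s" using True by (simp add: s_def)
    have d: "distributed M lborel (\<lambda>\<omega>. \<xi> \<bullet> Z \<omega>) (normal_density (\<xi> \<bullet> \<mu>) s)"
      using Z True unfolding gaussian_vec_def s_def by meson
    have "integrable M (\<lambda>\<omega>. \<xi> \<bullet> Z \<omega>)"
      using integrable_normal_moment_nz_1[OF s, of "\<xi> \<bullet> \<mu>"]
      by (subst distributed_integrable[OF d, of "\<lambda>x. x", symmetric]) auto
    moreover have "integrable M (\<lambda>\<omega>. (\<xi> \<bullet> Z \<omega> - \<xi> \<bullet> \<mu>)\<^sup>2)"
      using integrable_normal_moment[OF s, of "\<xi> \<bullet> \<mu>" 2]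
      by (subst distributed_integrable[OF d, of "\<lambda>x. (x - \<xi> \<bullet> \<mu>)\<^sup>2", symmetric]) auto
    ultimately show ?thesis using normal_distributed_expectation[OF s d] by simp
  next
    case False
    then have ae: "AE \<omega> in M. \<xi> \<bullet> Z \<omega> = \<xi> \<bullet> \<mu>" using Z unfolding gaussian_vec_def by meson
    have "integrable M (\<lambda>\<omega>. \<xi> \<bullet> Z \<omega>) = integrable M (\<lambda>\<omega>. \<xi> \<bullet> \<mu>)"
      using ae by (intro integrable_cong_AE) auto
    moreover have "integrable M (\<lambda>\<omega>. (\<xi> \<bullet> Z \<omega> - \<xi> \<bullet> \<mu>)\<^sup>2) = integrable M (\<lambda>\<omega>. 0 :: real)"
      using ae by (intro integrable_cong_AE) (auto elim!: eventually_mono)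
    moreover have "(\<integral>\<omega>. \<xi> \<bullet> Z \<omega> \<partial>M) = (\<integral>\<omega>. \<xi> \<bullet> \<mu> \<partial>M)"
      using ae by (intro integral_cong_AE) auto
    ultimately show ?thesis by (simp add: prob_space)
  qed
  then show "integrable M (\<lambda>\<omega>. \<xi> \<bullet> Z \<omega>)" "integrable M (\<lambda>\<omega>. (\<xi> \<bullet> (Z \<omega> - \<mu>))\<^sup>2)"
    "(\<integral>\<omega>. \<xi> \<bullet> Z \<omega> \<partial>M) = \<xi> \<bullet> \<mu>" by (simp_all add: inner_diff_right)
qed

lemma gaussian_vec_centered:
  fixes Z :: "'a \<Rightarrow> real^'d"
  assumes M: "prob_space M" and Z: "gaussian_vec M Z \<mu> C"
  shows "gaussian_vec M (\<lambda>\<omega>. Z \<omega> - \<mu>) 0 C"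
proof -
  interpret prob_space M by fact
  have Zm[measurable]: "Z \<in> borel_measurable M" using Z by (simp add: gaussian_vec_def)
  have "distributed M lborel (\<lambda>\<omega>. \<xi> \<bullet> (Z \<omega> - \<mu>)) (normal_density 0 (sqrt (\<xi> \<bullet> (C *v \<xi>))))"
    if "0 < \<xi> \<bullet> (C *v \<xi>)" for \<xi>
  proof -
    have "distributed M lborel (\<lambda>\<omega>. \<xi> \<bullet> Z \<omega>) (normal_density (\<xi> \<bullet> \<mu>) (sqrt (\<xi> \<bullet> (C *v \<xi>))))"
      using Z that unfolding gaussian_vec_def by meson
    from normal_density_affine[OF this, of 1 "- (\<xi> \<bullet> \<mu>)"] that show ?thesis
      by (simp add: inner_diff_right)
  qed
  moreover have "AE \<omega> in M. \<xi> \<bullet> (Z \<omega> - \<mu>) = 0" if "\<not> 0 < \<xi> \<bullet> (C *v \<xi>)" for \<xi>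
  proof -
    have "AE \<omega> in M. \<xi> \<bullet> Z \<omega> = \<xi> \<bullet> \<mu>" using Z that unfolding gaussian_vec_def by meson
    then show ?thesis by (auto simp: inner_diff_right elim!: eventually_mono)
  qed
  ultimately show ?thesis unfolding gaussian_vec_def by simp
qed

lemma gaussian_vec_integrable_norm:
  fixes Z :: "'a \<Rightarrow> real^'d"
  assumes M: "prob_space M" and Z: "gaussian_vec M Z 0 C"
  shows "integrable M (\<lambda>\<omega>. (norm (Z \<omega>))\<^sup>2)" "integrable M (\<lambda>\<omega>. norm (Z \<omega>))"
proof -
  interpret prob_space M by fact
  have Zm[measurable]: "Z \<in> borel_measurable M" using Z by (simp add: gaussian_vec_def)
  have e: "(norm (Z \<omega>))\<^sup>2 = (\<Sum>i\<in>UNIV. (axis i 1 \<bullet> (Z \<omega> - 0))\<^sup>2)" for \<omega>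
    by (simp add: inner_axis' norm_vec_def L2_set_def sum_nonneg)
  show i: "integrable M (\<lambda>\<omega>. (norm (Z \<omega>))\<^sup>2)"
    unfolding e by (intro Bochner_Integration.integrable_sum gaussian_vec_moments(2)[OF M Z])
  have le: "norm (norm (Z \<omega>)) \<le> norm (1 + (norm (Z \<omega>))\<^sup>2)" for \<omega>
  proof -
    have "2 * norm (Z \<omega>) \<le> (norm (Z \<omega>))\<^sup>2 + 1" using sum_squares_bound[of "norm (Z \<omega>)" 1] by simp
    then have "norm (Z \<omega>) \<le> 1 + (norm (Z \<omega>))\<^sup>2" using norm_ge_zero[of "Z \<omega>"] by linarith
    then show ?thesis by simp
  qed
  show "integrable M (\<lambda>\<omega>. norm (Z \<omega>))"
  proof (rule Bochner_Integration.integrable_bound)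
    show "integrable M (\<lambda>\<omega>. 1 + (norm (Z \<omega>))\<^sup>2)" using i by simp
    show "AE \<omega> in M. norm (norm (Z \<omega>)) \<le> norm (1 + (norm (Z \<omega>))\<^sup>2)" by (rule AE_I2) (rule le)
  qed simp
qed

section \<open>Stein's identity on the line and for Gaussian vectors\<close>

lemma normal_density_has_derivative:
  assumes "0 < \<tau>"
  shows "(normal_density 0 \<tau> has_real_derivative - (x / \<tau>\<^sup>2) * normal_density 0 \<tau> x) (at x)"
  unfolding normal_density_def using assms
  by (auto intro!: derivative_eq_intros simp: field_simps power2_eq_square)

text \<open>This is \<open>exp (- y) \<le> 1 / y\<close> at
  \<open>y = x\<^sup>2 / (2 * \<tau>\<^sup>2)\<close>. Quadratic decay suffices against the linear
  growth allowed for the test function in Stein's identity.\<close>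

lemma normal_density_bound:
  assumes "0 < \<tau>" "x \<noteq> 0"
  shows "normal_density 0 \<tau> x \<le> (2 * \<tau>\<^sup>2 / sqrt (2 * pi * \<tau>\<^sup>2)) / x\<^sup>2"
proof -
  let ?y = "x\<^sup>2 / (2 * \<tau>\<^sup>2)"
  have y: "0 < ?y" using assms by simp
  have "exp (- z) \<le> 1 / z" if "0 < z" for z :: real
  proof -
    have "z \<le> exp z" using exp_ge_add_one_self[of z] by linarith
    then show ?thesis using le_imp_inverse_le[OF _ that] by (simp add: exp_minus inverse_eq_divide)
  qed
  from this[OF y] have "1 / sqrt (2 * pi * \<tau>\<^sup>2) * exp (- ?y) \<le> 1 / sqrt (2 * pi * \<tau>\<^sup>2) * (1 / ?y)"
    by (intro mult_left_mono) auto
  then show ?thesis by (simp add: normal_density_def)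
qed

text \<open>Integration by parts on the whole line: the derivative of density times \<open>G\<close>
  is the difference of the two integrands, up to the factor \<open>\<tau>\<^sup>2\<close>, and the
  boundary terms vanish.\<close>

lemma stein_normal:
  fixes G G' :: "real \<Rightarrow> real"
  assumes t: "0 < \<tau>" and G: "\<And>x. (G has_real_derivative G' x) (at x)" and G': "continuous_on UNIV G'"
    and b: "\<And>x. \<bar>G x\<bar> \<le> C * (1 + \<bar>x\<bar>)" "\<And>x. \<bar>G' x\<bar> \<le> C * (1 + \<bar>x\<bar>)"
  shows "(\<integral>x. normal_density 0 \<tau> x * (x * G x) \<partial>lborel) = \<tau>\<^sup>2 * (\<integral>x. normal_density 0 \<tau> x * G' x \<partial>lborel)"
proof -
  let ?r = "normal_density 0 \<tau>"
  have C: "0 \<le> C" using b(1)[of 0] by simp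
  have cG: "continuous_on UNIV G" using G DERIV_isCont continuous_at_imp_continuous_on by blast
  have cr: "continuous_on UNIV ?r"
    using normal_density_has_derivative[OF t] DERIV_isCont continuous_at_imp_continuous_on by blast
  have [measurable]: "G \<in> borel_measurable borel" "G' \<in> borel_measurable borel"
    using cG G' by (auto intro: borel_measurable_continuous_onI)
  have m0: "integrable lborel ?r" "integrable lborel (\<lambda>x. ?r x * \<bar>x\<bar>)" "integrable lborel (\<lambda>x. ?r x * \<bar>x\<bar>\<^sup>2)"
    using integrable_normal_moment_abs[OF t, of 0 1] integrable_normal_moment_abs[OF t, of 0 2] integrable_normal_density[OF t]
    by simp_all
  have i1: "integrable lborel (\<lambda>x. ?r x * G' x)"
  proof (rule Bochner_Integration.integrable_bound)
    show "integrable lborel (\<lambda>x. C * (?r x + ?r x * \<bar>x\<bar>))" using m0 by simp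
    show "AE x in lborel. norm (?r x * G' x) \<le> norm (C * (?r x + ?r x * \<bar>x\<bar>))"
    proof (rule AE_I2)
      fix x
      have "?r x * \<bar>G' x\<bar> \<le> ?r x * (C * (1 + \<bar>x\<bar>))" by (intro mult_left_mono b) simp
      also have "\<dots> = C * (?r x + ?r x * \<bar>x\<bar>)" by (simp add: algebra_simps)
      finally show "norm (?r x * G' x) \<le> norm (C * (?r x + ?r x * \<bar>x\<bar>))" using C by (simp add: abs_mult)
    qed
  qed simp
  have i2: "integrable lborel (\<lambda>x. ?r x * (x * G x))"
  proof (rule Bochner_Integration.integrable_bound)
    show "integrable lborel (\<lambda>x. C * (?r x * \<bar>x\<bar> + ?r x * \<bar>x\<bar>\<^sup>2))" using m0 by simp
    show "AE x in lborel. norm (?r x * (x * G x)) \<le> norm (C * (?r x * \<bar>x\<bar> + ?r x * \<bar>x\<bar>\<^sup>2))"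
    proof (rule AE_I2)
      fix x
      have "?r x * (\<bar>x\<bar> * \<bar>G x\<bar>) \<le> ?r x * (\<bar>x\<bar> * (C * (1 + \<bar>x\<bar>)))" by (intro mult_left_mono b) simp_all
      also have "\<dots> = C * (?r x * \<bar>x\<bar> + ?r x * \<bar>x\<bar>\<^sup>2)" by (simp add: algebra_simps power2_eq_square)
      also have "\<dots> \<le> \<bar>C * (?r x * \<bar>x\<bar> + ?r x * \<bar>x\<bar>\<^sup>2)\<bar>" by simp
      finally show "norm (?r x * (x * G x)) \<le> norm (C * (?r x * \<bar>x\<bar> + ?r x * \<bar>x\<bar>\<^sup>2))" using C by (simp add: abs_mult)
    qed
  qed simp
  define F where "F x = ?r x * G x" for x
  define F' where "F' x = ?r x * G' x - (?r x * (x * G x)) / \<tau>\<^sup>2" for x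
  have FF': "(F has_real_derivative F' x) (at x)" for x
    unfolding F_def F'_def
    using DERIV_mult[OF normal_density_has_derivative[OF t, of x] G[of x]] by (simp add: algebra_simps)
  have cF': "continuous_on UNIV F'" unfolding F'_def using t by (intro continuous_intros cr G' cG) auto
  have iF': "integrable lborel F'" unfolding F'_def using i1 i2 by simp
  \<comment> \<open>The constant of the density bound times the growth constant of \<open>G\<close>;
    the factor 2 comes from \<open>1 + \<bar>x\<bar> \<le> 2 * \<bar>x\<bar>\<close> away from the
    unit interval.\<close>
  define k where "k = C * (2 * (2 * \<tau>\<^sup>2 / sqrt (2 * pi * \<tau>\<^sup>2)))"
  have k: "norm (F x) \<le> k / \<bar>x\<bar>" if x: "1 \<le> \<bar>x\<bar>" for x
  proof -
    have "\<bar>F x\<bar> = ?r x * \<bar>G x\<bar>" by (simp add: F_def abs_mult)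
    also have "\<dots> \<le> ((2 * \<tau>\<^sup>2 / sqrt (2 * pi * \<tau>\<^sup>2)) / x\<^sup>2) * (C * (2 * \<bar>x\<bar>))"
    proof (rule mult_mono)
      show "?r x \<le> (2 * \<tau>\<^sup>2 / sqrt (2 * pi * \<tau>\<^sup>2)) / x\<^sup>2" using x by (intro normal_density_bound t) auto
      have "C * (1 + \<bar>x\<bar>) \<le> C * (2 * \<bar>x\<bar>)" using x C by (intro mult_left_mono) auto
      then show "\<bar>G x\<bar> \<le> C * (2 * \<bar>x\<bar>)" using b(1)[of x] by linarith
    qed auto
    also have "\<dots> = k * (\<bar>x\<bar> / \<bar>x\<bar>\<^sup>2)" by (simp add: k_def)
    also have "\<dots> = k / \<bar>x\<bar>" using x by (simp add: power2_eq_square del: power2_abs abs_mult_self_eq)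
    finally show ?thesis by simp
  qed
  have top: "(F \<longlongrightarrow> 0) at_top"
  proof (rule Lim_null_comparison)
    show "\<forall>\<^sub>F x in at_top. norm (F x) \<le> k / \<bar>x\<bar>"
      by (rule eventually_mono[OF eventually_ge_at_top[of 1]], rule k) simp
    show "((\<lambda>x :: real. k / \<bar>x\<bar>) \<longlongrightarrow> 0) at_top"
      by (intro tendsto_divide_0[OF tendsto_const] filterlim_at_top_imp_at_infinity filterlim_abs_real)
  qed
  have bot: "(F \<longlongrightarrow> 0) at_bot"
  proof (rule Lim_null_comparison)
    show "\<forall>\<^sub>F x in at_bot. norm (F x) \<le> k / \<bar>x\<bar>"
      by (rule eventually_mono[OF eventually_le_at_bot[of "-1"]], rule k) simp
    have "filterlim (\<lambda>x :: real. \<bar>x\<bar>) at_top at_bot"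
      unfolding filterlim_at_bot_mirror using filterlim_abs_real by simp
    then show "((\<lambda>x :: real. k / \<bar>x\<bar>) \<longlongrightarrow> 0) at_bot"
      by (intro tendsto_divide_0[OF tendsto_const] filterlim_at_top_imp_at_infinity)
  qed
  have "(LBINT x=-\<infinity>..\<infinity>. F' x) = 0 - 0"
  proof (rule interval_integral_FTC_integrable[where F=F])
    show "(F has_vector_derivative F' x) (at x)" for x
      using FF'[of x] by (simp add: has_real_derivative_iff_has_vector_derivative)
    show "isCont F' x" for x using cF' by (simp add: continuous_on_eq_continuous_at)
    show "set_integrable lborel (einterval (-\<infinity>) \<infinity>) F'"
      using iF' by (simp add: set_integrable_def einterval_eq)
    show "((F \<circ> real_of_ereal) \<longlongrightarrow> 0) (at_right (-\<infinity>))"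
      using bot by (simp add: ereal_tendsto_simps)
    show "((F \<circ> real_of_ereal) \<longlongrightarrow> 0) (at_left \<infinity>)"
      using top by (simp add: ereal_tendsto_simps)
  qed auto
  then have "(\<integral>x. F' x \<partial>lborel) = 0"
    by (simp add: interval_lebesgue_integral_def einterval_eq set_lebesgue_integral_def)
  then have "(\<integral>x. ?r x * G' x \<partial>lborel) - (\<integral>x. ?r x * (x * G x) \<partial>lborel) / \<tau>\<^sup>2 = 0"
    unfolding F'_def using i1 i2 by simp
  then show ?thesis using t by (simp add: field_simps)
qed

text \<open>Put \<open>l = S\<^sup>-\<^sup>1 e\<close>. Then \<open>N = l \<bullet> Y\<close> is
  normal with variance \<open>t\<^sup>2 = l \<bullet> e\<close>, and its covariance with
  \<open>Y\<close> is exactly \<open>e\<close>; so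
  \<open>V = Y - (N / t\<^sup>2) *\<^sub>R e\<close> is uncorrelated with \<open>N\<close>, hence
  independent of it. With \<open>V\<close> frozen, \<open>Y\<close> moves along the axis
  \<open>e\<close> only and the one-dimensional identity applies.\<close>

lemma stein_gaussian_vec:
  fixes Y :: "'a \<Rightarrow> real^'d" and S :: "real^'d^'d" and F F' :: "real^'d \<Rightarrow> real"
  assumes M: "prob_space M" and Y: "gaussian_vec M Y 0 S"
    and sym: "transpose S = S" and pos: "\<And>v. v \<noteq> 0 \<Longrightarrow> 0 < v \<bullet> (S *v v)"
    and F: "\<And>y s. ((\<lambda>s. F (y + s *\<^sub>R axis i 1)) has_real_derivative F' (y + s *\<^sub>R axis i 1)) (at s)"
    and cont: "continuous_on UNIV F" "continuous_on UNIV F'"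
    and b: "\<And>y. \<bar>F y\<bar> \<le> C * (1 + norm y)" "\<And>y. \<bar>F' y\<bar> \<le> C * (1 + norm y)"
  shows "(\<integral>\<omega>. ((matrix_inv S *v axis i 1) \<bullet> Y \<omega>) * F (Y \<omega>) \<partial>M) = (\<integral>\<omega>. F' (Y \<omega>) \<partial>M)"
proof -
  interpret prob_space M by fact
  have Ym[measurable]: "Y \<in> borel_measurable M" using Y by (simp add: gaussian_vec_def)
  have Fm[measurable]: "F \<in> borel_measurable borel" "F' \<in> borel_measurable borel"
    using cont by (auto intro: borel_measurable_continuous_onI)
  have C: "0 \<le> C" using b(1)[of 0] by simp
  have psd: "0 \<le> v \<bullet> (S *v v)" for v using pos[of v] by (cases "v = 0") auto
  define e where "e = (axis i 1 :: real^'d)"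
  define l where "l = matrix_inv S *v e"
  have Sl: "S *v l = e"
    using matrix_inv_mult(3)[OF invertible_posdef[OF pos]] by (simp add: l_def)
  have "l \<noteq> 0" using Sl by (auto simp: e_def axis_eq_0_iff)
  define t where "t = sqrt (l \<bullet> e)"
  have le: "0 < l \<bullet> e" using pos[OF \<open>l \<noteq> 0\<close>] Sl by simp
  then have t: "0 < t" "t\<^sup>2 = l \<bullet> e" by (simp_all add: t_def)
  define N where "N \<omega> = l \<bullet> Y \<omega>" for \<omega>
  define V where "V \<omega> = Y \<omega> - (N \<omega> / t\<^sup>2) *\<^sub>R e" for \<omega>
  have Nm[measurable]: "N \<in> borel_measurable M" unfolding N_def by measurable
  have Vm[measurable]: "V \<in> borel_measurable M" unfolding V_def by measurable
  have dN: "distributed M lborel N (normal_density 0 t)"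
  proof -
    have "distributed M lborel (\<lambda>\<omega>. l \<bullet> Y \<omega>) (normal_density (l \<bullet> 0) (sqrt (l \<bullet> (S *v l))))"
      using Y pos[OF \<open>l \<noteq> 0\<close>] unfolding gaussian_vec_def by meson
    then show ?thesis by (simp add: N_def[abs_def] Sl t_def)
  qed
  have ch: "(\<integral>\<omega>. cos (\<xi> \<bullet> Y \<omega> + \<theta>) \<partial>M) = exp (- (\<xi> \<bullet> (S *v \<xi>)) / 2) * cos \<theta>" for \<xi> \<theta>
    using gaussian_vec_char[OF M Y psd] by simp
  have law: "distr M borel (\<lambda>\<omega>. (N \<omega>, V \<omega>)) = distr M borel N \<Otimes>\<^sub>M distr M borel V"
  proof (rule indep_of_char_factor[OF M Nm Vm])
    fix \<xi> :: real and \<eta> :: "real^'d" and \<theta> :: real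
    \<comment> \<open>The functional \<eta> on \<open>V\<close>, rewritten as a functional on
      \<open>Y\<close>. It is orthogonal to \<open>e\<close>, that is, \<open>S\<close>-orthogonal
      to \<open>l\<close>, so the two variances add and the characteristic function factors.\<close>
    define \<eta>' where "\<eta>' = \<eta> - ((\<eta> \<bullet> e) / t\<^sup>2) *\<^sub>R l"
    have V: "\<eta> \<bullet> V \<omega> = \<eta>' \<bullet> Y \<omega>" for \<omega>
      by (simp add: V_def \<eta>'_def N_def inner_diff_right inner_diff_left)
    have o: "\<eta>' \<bullet> e = 0" using t le by (simp add: \<eta>'_def inner_diff_left)
    have o': "l \<bullet> (S *v \<eta>') = 0" using o dot_transpose_mult[of l S \<eta>'] sym Sl by (simp add: inner_commute)
    have v: "(\<xi> *\<^sub>R l + \<eta>') \<bullet> (S *v (\<xi> *\<^sub>R l + \<eta>')) = (\<xi> *\<^sub>R l) \<bullet> (S *v (\<xi> *\<^sub>R l)) + \<eta>' \<bullet> (S *v \<eta>')"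
      using o o' by (simp add: matrix_vector_right_distrib inner_add_left inner_add_right matrix_vector_mult_scaleR Sl)
    have "(\<integral>\<omega>. cos (\<xi> \<bullet> N \<omega> + \<eta> \<bullet> V \<omega> + \<theta>) \<partial>M) = (\<integral>\<omega>. cos ((\<xi> *\<^sub>R l + \<eta>') \<bullet> Y \<omega> + \<theta>) \<partial>M)"
      by (simp add: V N_def inner_add_left)
    also have "\<dots> = exp (- (\<eta>' \<bullet> (S *v \<eta>')) / 2) * (exp (- ((\<xi> *\<^sub>R l) \<bullet> (S *v (\<xi> *\<^sub>R l))) / 2) * cos \<theta>)"
      unfolding ch v by (simp add: exp_add[symmetric] add_divide_distrib diff_divide_distrib)
    also have "\<dots> = (\<integral>\<omega>. exp (- (\<eta>' \<bullet> (S *v \<eta>')) / 2) * cos ((\<xi> *\<^sub>R l) \<bullet> Y \<omega> + \<theta>) \<partial>M)"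
      using ch[of "\<xi> *\<^sub>R l" \<theta>] by (simp only: integral_mult_right_zero)
    also have "\<dots> = (\<integral>\<omega>. (\<integral>\<omega>'. cos (\<xi> \<bullet> N \<omega> + \<eta> \<bullet> V \<omega>' + \<theta>) \<partial>M) \<partial>M)"
    proof (rule Bochner_Integration.integral_cong[OF refl])
      fix \<omega>
      have "(\<integral>\<omega>'. cos (\<xi> \<bullet> N \<omega> + \<eta> \<bullet> V \<omega>' + \<theta>) \<partial>M) = (\<integral>\<omega>'. cos (\<eta>' \<bullet> Y \<omega>' + (\<xi> \<bullet> N \<omega> + \<theta>)) \<partial>M)"
        by (simp add: V algebra_simps)
      then show "exp (- (\<eta>' \<bullet> (S *v \<eta>')) / 2) * cos ((\<xi> *\<^sub>R l) \<bullet> Y \<omega> + \<theta>)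
        = (\<integral>\<omega>'. cos (\<xi> \<bullet> N \<omega> + \<eta> \<bullet> V \<omega>' + \<theta>) \<partial>M)"
        unfolding ch by (simp add: N_def)
    qed
    finally show "(\<integral>\<omega>. cos (\<xi> \<bullet> N \<omega> + \<eta> \<bullet> V \<omega> + \<theta>) \<partial>M)
       = (\<integral>\<omega>. (\<integral>\<omega>'. cos (\<xi> \<bullet> N \<omega> + \<eta> \<bullet> V \<omega>' + \<theta>) \<partial>M) \<partial>M)" .
  qed
  interpret N: prob_space "distr M borel N" by (rule prob_space_distr) simp
  interpret V: prob_space "distr M borel V" by (rule prob_space_distr) simp
  interpret P: pair_prob_space "distr M borel N" "distr M borel V" ..
  have NVm: "(\<lambda>\<omega>. (N \<omega>, V \<omega>)) \<in> measurable M borel" unfolding borel_prod[symmetric] by simp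
  have law_density: "distr M borel N = density lborel (\<lambda>x. ennreal (normal_density 0 t x))"
    using dN by (simp add: distributed_def cong: distr_cong)
  \<comment> \<open>Fubini for the independent pair, with the inner integral over \<open>N\<close>
    written against its density.\<close>
  have exp_law: "(\<integral>\<omega>. H (N \<omega>) (V \<omega>) \<partial>M)
      = (\<integral>y. (\<integral>x. normal_density 0 t x * H x y \<partial>lborel) \<partial>distr M borel V)"
    if H: "(\<lambda>(x, y). H x y) \<in> borel_measurable borel" and i: "integrable M (\<lambda>\<omega>. H (N \<omega>) (V \<omega>))"
    for H :: "real \<Rightarrow> real^'d \<Rightarrow> real"
  proof -
    have i': "integrable (distr M borel N \<Otimes>\<^sub>M distr M borel V) (\<lambda>(x, y). H x y)"
      unfolding law[symmetric] using integrable_distr_eq[OF NVm H] i by simp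
    have Hy: "(\<lambda>x. H x y) \<in> borel_measurable borel" for y
      using measurable_compose[OF _ H[unfolded borel_prod[symmetric]], of "\<lambda>x. (x, y)" borel] by simp
    have "(\<integral>\<omega>. H (N \<omega>) (V \<omega>) \<partial>M) = (\<integral>(x, y). H x y \<partial>distr M borel (\<lambda>\<omega>. (N \<omega>, V \<omega>)))"
      using integral_distr[OF NVm H] by simp
    also have "\<dots> = (\<integral>y. (\<integral>x. H x y \<partial>distr M borel N) \<partial>distr M borel V)"
      unfolding law using P.integral_snd[OF i'] by simp
    also have "\<dots> = (\<integral>y. (\<integral>x. normal_density 0 t x * H x y \<partial>lborel) \<partial>distr M borel V)"
      unfolding law_density using Hy by (subst integral_real_density) auto
    finally show ?thesis .
  qed
  have YNV: "Y \<omega> = V \<omega> + (N \<omega> / t\<^sup>2) *\<^sub>R e" for \<omega> by (simp add: V_def)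
  have m1: "(\<lambda>(x, y). x * F (y + (x / t\<^sup>2) *\<^sub>R e)) \<in> borel_measurable borel"
    unfolding case_prod_beta
    by (intro borel_measurable_continuous_onI continuous_intros continuous_on_compose2[OF cont(1)]) (use t in auto)
  have m2: "(\<lambda>(x, y). F' (y + (x / t\<^sup>2) *\<^sub>R e)) \<in> borel_measurable borel"
    unfolding case_prod_beta
    by (intro borel_measurable_continuous_onI continuous_intros continuous_on_compose2[OF cont(2)]) (use t in auto)
  note in2 = gaussian_vec_integrable_norm[OF M Y]
  have i1: "integrable M (\<lambda>\<omega>. N \<omega> * F (Y \<omega>))"
  proof (rule Bochner_Integration.integrable_bound)
    show "integrable M (\<lambda>\<omega>. norm l * C * (norm (Y \<omega>) + (norm (Y \<omega>))\<^sup>2))" using in2 by simp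
    show "AE \<omega> in M. norm (N \<omega> * F (Y \<omega>)) \<le> norm (norm l * C * (norm (Y \<omega>) + (norm (Y \<omega>))\<^sup>2))"
    proof (rule AE_I2)
      fix \<omega>
      have "\<bar>N \<omega>\<bar> * \<bar>F (Y \<omega>)\<bar> \<le> (norm l * norm (Y \<omega>)) * (C * (1 + norm (Y \<omega>)))"
        unfolding N_def by (intro mult_mono b Cauchy_Schwarz_ineq2) auto
      also have "\<dots> = norm l * C * (norm (Y \<omega>) + (norm (Y \<omega>))\<^sup>2)"
        by (simp add: algebra_simps power2_eq_square)
      finally show "norm (N \<omega> * F (Y \<omega>)) \<le> norm (norm l * C * (norm (Y \<omega>) + (norm (Y \<omega>))\<^sup>2))"
        using C by (simp add: abs_mult)
    qed
  qed measurable
  have i2: "integrable M (\<lambda>\<omega>. F' (Y \<omega>))"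
  proof (rule Bochner_Integration.integrable_bound)
    show "integrable M (\<lambda>\<omega>. C * (1 + norm (Y \<omega>)))" using in2 by simp
    show "AE \<omega> in M. norm (F' (Y \<omega>)) \<le> norm (C * (1 + norm (Y \<omega>)))"
    proof (rule AE_I2)
      fix \<omega> show "norm (F' (Y \<omega>)) \<le> norm (C * (1 + norm (Y \<omega>)))"
        using b(2)[of "Y \<omega>"] unfolding real_norm_def by linarith
    qed
  qed measurable
  have "(\<integral>\<omega>. N \<omega> * F (Y \<omega>) \<partial>M) = (\<integral>y. (\<integral>x. normal_density 0 t x * (x * F (y + (x / t\<^sup>2) *\<^sub>R e)) \<partial>lborel) \<partial>distr M borel V)"
    using exp_law[OF m1] i1 unfolding YNV[symmetric] .
  also have "\<dots> = (\<integral>y. (\<integral>x. normal_density 0 t x * F' (y + (x / t\<^sup>2) *\<^sub>R e) \<partial>lborel) \<partial>distr M borel V)"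
  proof (rule Bochner_Integration.integral_cong[OF refl])
    fix y :: "real^'d"
    \<comment> \<open>One bound for the function and its derivative in \<open>x\<close>: the chain
      rule contributes \<open>1 / t\<^sup>2\<close>, whence the factor
      \<open>1 + 1 / t\<^sup>2\<close>; the other factor bounds the growth of
      \<open>y + (x / t\<^sup>2) *\<^sub>R e\<close>.\<close>
    define D where "D = C * (1 + norm y + 1 / t\<^sup>2) * (1 + 1 / t\<^sup>2)"
    have bd: "C * (1 + norm (y + (x / t\<^sup>2) *\<^sub>R e)) \<le> C * (1 + norm y + 1 / t\<^sup>2) * (1 + \<bar>x\<bar>)" for x
    proof -
      have "norm (y + (x / t\<^sup>2) *\<^sub>R e) \<le> norm y + \<bar>x\<bar> * (1 / t\<^sup>2)"
        using norm_triangle_ineq[of y "(x / t\<^sup>2) *\<^sub>R e"] by (simp add: e_def abs_mult)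
      moreover have "1 + (norm y + \<bar>x\<bar> * (1 / t\<^sup>2)) \<le> (1 + norm y + 1 / t\<^sup>2) * (1 + \<bar>x\<bar>)"
        using t(1) by (simp add: distrib_left distrib_right)
      ultimately have "1 + norm (y + (x / t\<^sup>2) *\<^sub>R e) \<le> (1 + norm y + 1 / t\<^sup>2) * (1 + \<bar>x\<bar>)"
        by linarith
      from mult_left_mono[OF this C] show ?thesis by (simp only: mult.assoc)
    qed
    have "(\<integral>x. normal_density 0 t x * (x * F (y + (x / t\<^sup>2) *\<^sub>R e)) \<partial>lborel)
       = t\<^sup>2 * (\<integral>x. normal_density 0 t x * (F' (y + (x / t\<^sup>2) *\<^sub>R e) / t\<^sup>2) \<partial>lborel)"
    proof (rule stein_normal[OF t(1), where C="D"])
      fix x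
      have "((\<lambda>x. x / t\<^sup>2) has_real_derivative 1 / t\<^sup>2) (at x)" by (rule DERIV_cdivide[OF DERIV_ident])
      from DERIV_chain2[OF F[of y "x / t\<^sup>2"] this]
      show "((\<lambda>x. F (y + (x / t\<^sup>2) *\<^sub>R e)) has_real_derivative F' (y + (x / t\<^sup>2) *\<^sub>R e) / t\<^sup>2) (at x)"
        by (simp add: e_def)
      let ?D = "C * (1 + norm y + 1 / t\<^sup>2) * (1 + \<bar>x\<bar>)"
      have D0: "0 \<le> ?D" using C t(1) by simp
      have DD: "D * (1 + \<bar>x\<bar>) = ?D + ?D / t\<^sup>2"
      proof -
        have "a * (1 + 1 / b) * c = a * c + a * c / b" for a b c :: real
          by (simp add: distrib_left distrib_right)
        then show ?thesis unfolding D_def .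
      qed
      have q: "0 \<le> ?D / t\<^sup>2" using D0 by simp
      show "\<bar>F (y + (x / t\<^sup>2) *\<^sub>R e)\<bar> \<le> D * (1 + \<bar>x\<bar>)"
        using order.trans[OF b(1) bd[of x]] q unfolding DD by linarith
      have "\<bar>F' (y + (x / t\<^sup>2) *\<^sub>R e)\<bar> / t\<^sup>2 \<le> ?D / t\<^sup>2"
        by (intro divide_right_mono order.trans[OF b(2) bd]) simp
      then show "\<bar>F' (y + (x / t\<^sup>2) *\<^sub>R e) / t\<^sup>2\<bar> \<le> D * (1 + \<bar>x\<bar>)"
        using D0 unfolding DD by simp
    next
      show "continuous_on UNIV (\<lambda>x. F' (y + (x / t\<^sup>2) *\<^sub>R e) / t\<^sup>2)"
        by (intro continuous_intros continuous_on_compose2[OF cont(2)]) (use t in auto)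
    qed
    then show "(\<integral>x. normal_density 0 t x * (x * F (y + (x / t\<^sup>2) *\<^sub>R e)) \<partial>lborel)
       = (\<integral>x. normal_density 0 t x * F' (y + (x / t\<^sup>2) *\<^sub>R e) \<partial>lborel)"
      using t(1) by simp
  qed
  also have "\<dots> = (\<integral>\<omega>. F' (Y \<omega>) \<partial>M)"
    using exp_law[OF m2] i2 unfolding YNV[symmetric] by simp
  finally show ?thesis by (simp add: N_def l_def e_def)
qed

section \<open>Functions with continuous partial derivatives\<close>

text \<open>By definition \<open>pd\<close> is a derivative at parameter 0; translating the base
  point carries it to every parameter of the coordinate line.\<close>

lemma pd_has_real_derivative:
  fixes f :: "real^'d \<Rightarrow> real"
  assumes "partially_differentiable f"
  shows "((\<lambda>s. f (x + s *\<^sub>R axis i 1)) has_real_derivative pd i f (x + s *\<^sub>R axis i 1)) (at s)"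
proof -
  let ?z = "x + s *\<^sub>R axis i 1"
  have "((\<lambda>r. f (?z + r *\<^sub>R axis i 1)) has_real_derivative pd i f ?z) (at 0)"
    unfolding pd_def using assms unfolding partially_differentiable_def
    by (simp add: DERIV_deriv_iff_real_differentiable)
  then have "((\<lambda>r. f (x + (s + r) *\<^sub>R axis i 1)) has_real_derivative pd i f ?z) (at 0)"
    by (simp add: scaleR_add_left add.assoc)
  then show ?thesis
    using DERIV_shift[of "\<lambda>s. f (x + s *\<^sub>R axis i 1)" "pd i f ?z" 0 s] by (simp add: add.commute)
qed

text \<open>The increment of \<open>f\<close> is split by changing one coordinate at a time.\<close>

lemma has_derivative_of_continuous_pd:
  fixes f :: "real^'d \<Rightarrow> real"
  assumes d: "partially_differentiable f" and c: "\<And>i. continuous_on UNIV (pd i f)"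
  shows "(f has_derivative (\<lambda>v. \<Sum>i\<in>UNIV. v $ i * pd i f x)) (at x)"
proof -
  define P where "P S v = (\<Sum>i\<in>S. v $ i *\<^sub>R axis i (1::real))" for S and v :: "real^'d"
  have P0: "P S 0 = 0" for S by (simp add: P_def)
  have main: "((\<lambda>v. f (x + P S v)) has_derivative (\<lambda>v. \<Sum>i\<in>S. v $ i * pd i f x)) (at 0)" if "finite S" for S
    using that
  proof (induction S rule: finite_induct)
    case empty
    then show ?case by (simp add: P_def)
  next
    case (insert j S)
    define g where "g v = f (x + P S v + (v $ j) *\<^sub>R axis j 1) - f (x + P S v)" for v
    have "(g has_derivative (\<lambda>v. v $ j * pd j f x)) (at 0)"
      unfolding has_derivative_at_alt
    proof (intro conjI allI impI)
      show "bounded_linear (\<lambda>v :: real^'d. v $ j * pd j f x)"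
        by (intro bounded_linear_mult_const bounded_linear_vec_nth)
      fix e :: real assume e: "0 < e"
      have "isCont (pd j f) x" using c[of j] by (simp add: continuous_on_eq_continuous_at)
      then obtain d0 where d0: "0 < d0" "\<And>y. dist y x < d0 \<Longrightarrow> \<bar>pd j f y - pd j f x\<bar> < e"
        using e unfolding continuous_at_eps_delta dist_real_def by blast
      \<comment> \<open>This continuity keeps every intermediate point, with the coordinates in
        \<open>S\<close> already changed and coordinate \<open>j\<close> changed in part, within the
        radius \<open>d0\<close> around \<open>x\<close>.\<close>
      have "isCont (\<lambda>v. norm (P S v) + norm v) 0" unfolding P_def by (intro continuous_intros)
      then obtain d1 where d1: "0 < d1" "\<And>v. dist v 0 < d1 \<Longrightarrow> norm (P S v) + norm v < d0"
        using d0(1) P0 unfolding continuous_at_eps_delta dist_real_def by (simp add: P_def) (metis abs_ge_self order_le_less_trans)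
      show "\<exists>d>0. \<forall>y. norm (y - 0) < d \<longrightarrow> norm (g y - g 0 - (y - 0) $ j * pd j f x) \<le> e * norm (y - 0)"
      proof (intro exI conjI allI impI)
        fix v :: "real^'d" assume v: "norm (v - 0) < d1"
        \<comment> \<open>Subtracting the linear part beforehand lets the mean value bound deliver
          the remainder estimate itself.\<close>
        define k where "k s = f (x + P S v + s *\<^sub>R axis j 1) - s * pd j f x" for s
        have "norm (k (v $ j) - k 0) \<le> e * norm (v $ j - 0)"
        proof (rule field_differentiable_bound[where S="cball 0 \<bar>v $ j\<bar>"])
          fix s :: real assume s: "s \<in> cball 0 \<bar>v $ j\<bar>"
          show "(k has_field_derivative pd j f (x + P S v + s *\<^sub>R axis j 1) - pd j f x) (at s within cball 0 \<bar>v $ j\<bar>)"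
            unfolding k_def
            by (auto intro!: derivative_eq_intros pd_has_real_derivative[OF d] intro: DERIV_subset)
          have "dist (x + P S v + s *\<^sub>R axis j 1) x \<le> norm (P S v) + \<bar>s\<bar>"
            using norm_triangle_ineq[of "P S v" "s *\<^sub>R axis j 1"] by (simp add: dist_norm add.assoc)
          also have "\<dots> \<le> norm (P S v) + norm v" using s component_le_norm_cart[of v j] by (simp add: dist_real_def)
          also have "\<dots> < d0" using d1(2)[of v] v by simp
          finally show "norm (pd j f (x + P S v + s *\<^sub>R axis j 1) - pd j f x) \<le> e"
            using d0(2) by (simp add: less_imp_le)
        qed (auto simp: dist_real_def)
        also have "\<dots> \<le> e * norm v" using e component_le_norm_cart[of v j] by simp
        finally show "norm (g v - g 0 - (v - 0) $ j * pd j f x) \<le> e * norm (v - 0)"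
          by (simp add: k_def g_def P0 algebra_simps)
      qed (rule d1)
    qed
    from has_derivative_add[OF insert.IH this]
    have "((\<lambda>v. f (x + P S v) + g v) has_derivative (\<lambda>v. \<Sum>i\<in>insert j S. v $ i * pd i f x)) (at 0)"
      using insert.hyps by (simp add: add.commute)
    moreover have "f (x + P (insert j S) v) = f (x + P S v) + g v" for v
      using insert.hyps by (simp add: g_def P_def add_ac)
    ultimately show ?case by simp
  qed
  have "((\<lambda>v. f (x + v)) has_derivative (\<lambda>v. \<Sum>i\<in>UNIV. v $ i * pd i f x)) (at 0)"
  proof -
    have "P UNIV v = v" for v by (simp add: P_def vec_eq_iff axis_def if_distrib cong: if_cong)
    then show ?thesis using main[of UNIV] by simp
  qed
  then show ?thesis unfolding has_derivative_at by simp
qed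

lemma line_has_real_derivative:
  fixes f :: "real^'d \<Rightarrow> real"
  assumes "partially_differentiable f" "\<And>i. continuous_on UNIV (pd i f)"
  shows "((\<lambda>s. f (x + s *\<^sub>R v)) has_real_derivative (\<Sum>i\<in>UNIV. v $ i * pd i f (x + s *\<^sub>R v))) (at s within S)"
proof -
  have "((\<lambda>s. x + s *\<^sub>R v) has_derivative (\<lambda>s. s *\<^sub>R v)) (at s within S)"
    by (auto intro!: derivative_eq_intros)
  from has_derivative_compose[OF this has_derivative_of_continuous_pd[OF assms]]
  have "((\<lambda>s. f (x + s *\<^sub>R v)) has_derivative (\<lambda>r. \<Sum>i\<in>UNIV. (r *\<^sub>R v) $ i * pd i f (x + s *\<^sub>R v))) (at s within S)" .
  moreover have "(\<lambda>r. \<Sum>i\<in>UNIV. (r *\<^sub>R v) $ i * pd i f (x + s *\<^sub>R v)) = (*) (\<Sum>i\<in>UNIV. v $ i * pd i f (x + s *\<^sub>R v))"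
    by (auto simp: fun_eq_iff sum_distrib_right intro!: sum.cong)
  ultimately show ?thesis unfolding has_field_derivative_def by simp
qed

lemma sum_component_bound:
  fixes v :: "real^'d"
  assumes "\<And>i. \<bar>c i\<bar> \<le> K"
  shows "\<bar>\<Sum>i\<in>UNIV. v $ i * c i\<bar> \<le> real CARD('d) * K * norm v"
proof -
  have "\<bar>\<Sum>i\<in>UNIV. v $ i * c i\<bar> \<le> (\<Sum>i\<in>UNIV. \<bar>v $ i\<bar> * \<bar>c i\<bar>)"
    using sum_abs[of "\<lambda>i. v $ i * c i" UNIV] by (simp add: abs_mult)
  also have "\<dots> \<le> (\<Sum>i\<in>(UNIV :: 'd set). norm v * K)"
    using assms by (intro sum_mono mult_mono component_le_norm_cart) auto
  finally show ?thesis by (simp add: mult_ac)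
qed

lemma lipschitz_of_bounded_pd:
  fixes f :: "real^'d \<Rightarrow> real"
  assumes "partially_differentiable f" "\<And>i. continuous_on UNIV (pd i f)" "\<And>i x. \<bar>pd i f x\<bar> \<le> K"
  shows "\<bar>f (x + v) - f x\<bar> \<le> real CARD('d) * K * norm v"
proof -
  have "norm (f (x + 1 *\<^sub>R v) - f (x + 0 *\<^sub>R v)) \<le> real CARD('d) * K * norm v * norm (1 - 0 :: real)"
    by (rule field_differentiable_bound[where S=UNIV and f="\<lambda>s. f (x + s *\<^sub>R v)", OF _ line_has_real_derivative[OF assms(1,2)]])
       (use sum_component_bound[OF assms(3)] in auto)
  then show ?thesis by simp
qed

text \<open>Along the segment the derivative of the remainder is a combination of increments of
  first partials, which are Lipschitz. One dimension factor comes from the Lipschitz bound and one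
  from the sum; estimating \<open>s\<close> by 1 gives up the usual factor 1/2.\<close>

lemma taylor_bound:
  fixes f :: "real^'d \<Rightarrow> real"
  assumes f: "partially_differentiable f" "\<And>i. continuous_on UNIV (pd i f)"
    and f2: "\<And>i. partially_differentiable (pd i f)" "\<And>i j. continuous_on UNIV (pd j (pd i f))"
      "\<And>i j x. \<bar>pd j (pd i f) x\<bar> \<le> K"
  shows "\<bar>f (x + v) - f x - (\<Sum>i\<in>UNIV. v $ i * pd i f x)\<bar> \<le> (real CARD('d))\<^sup>2 * K * (norm v)\<^sup>2"
proof -
  define k where "k s = f (x + s *\<^sub>R v) - s * (\<Sum>i\<in>UNIV. v $ i * pd i f x)" for s
  have K: "0 \<le> K" using f2(3)[of undefined undefined undefined] by linarith
  have "norm (k 1 - k 0) \<le> (real CARD('d))\<^sup>2 * K * (norm v)\<^sup>2 * norm (1 - 0 :: real)"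
  proof (rule field_differentiable_bound[where S="{0..1}"])
    fix s :: real assume s: "s \<in> {0..1}"
    show "(k has_field_derivative (\<Sum>i\<in>UNIV. v $ i * (pd i f (x + s *\<^sub>R v) - pd i f x))) (at s within {0..1})"
      unfolding k_def
      by (rule derivative_eq_intros line_has_real_derivative[OF f] refl)+ (simp add: sum_subtractf right_diff_distrib)
    have "\<bar>pd i f (x + s *\<^sub>R v) - pd i f x\<bar> \<le> real CARD('d) * K * norm v" for i
    proof -
      have "\<bar>pd i f (x + s *\<^sub>R v) - pd i f x\<bar> \<le> real CARD('d) * K * norm (s *\<^sub>R v)"
        by (rule lipschitz_of_bounded_pd[OF f2])
      also have "\<dots> \<le> real CARD('d) * K * norm v"
        using s K by (intro mult_left_mono) (auto simp: mult_left_le_one_le)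
      finally show ?thesis .
    qed
    from sum_component_bound[of "\<lambda>i. pd i f (x + s *\<^sub>R v) - pd i f x", OF this, of v]
    show "norm (\<Sum>i\<in>UNIV. v $ i * (pd i f (x + s *\<^sub>R v) - pd i f x)) \<le> (real CARD('d))\<^sup>2 * K * (norm v)\<^sup>2"
      by (simp add: power2_eq_square mult_ac)
  qed auto
  then show ?thesis by (simp add: k_def)
qed

section \<open>First-order perturbation of a Gaussian law\<close>

text \<open>For centred Gaussian \<open>Y\<close> with covariance \<open>S\<close> this pairs \<phi>
  with the logarithmic derivative of the density when the mean moves by \<open>S *v v\<close> and
  the covariance by \<open>S ** N ** S\<close> (up to symmetrisation). The directions thus arrive
  already multiplied by \<open>S\<^sup>-\<^sup>1\<close>, and the subtracted product is the trace
  term that normalises the density.\<close>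

definition gaussian_score :: "'a measure \<Rightarrow> ('a \<Rightarrow> real^'d) \<Rightarrow> ('a \<Rightarrow> real) \<Rightarrow> real^'d \<Rightarrow> real^'d^'d \<Rightarrow> real" where
  "gaussian_score M Y \<phi> v N = (\<integral>\<omega>. \<phi> \<omega> * (Y \<omega> \<bullet> v) \<partial>M)
     + ((\<integral>\<omega>. \<phi> \<omega> * (Y \<omega> \<bullet> (N *v Y \<omega>)) \<partial>M) - (\<integral>\<omega>. \<phi> \<omega> \<partial>M) * (\<integral>\<omega>. Y \<omega> \<bullet> (N *v Y \<omega>) \<partial>M)) / 2"

text \<open>Needed because the covariance direction is built from \<open>atl\<close>, which may fail
  to be symmetric, whereas Gaussian laws see only the quadratic form.\<close>

lemma symmetric_part_quadratic:
  fixes Q :: "real^'d^'d"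
  shows "x \<bullet> (((1/2) *\<^sub>R (Q + transpose Q)) *v x) = x \<bullet> (Q *v x)"
  using dot_transpose_mult[of x Q x]
  by (simp add: bounded_bilinear.scaleR_left[OF matrix_vector_bb] matrix_vector_mult_add_rdistrib
      inner_add_right inner_commute)

text \<open>The common majorant for all integrands below: none grows faster than quadratically in
  \<open>Y\<close>, so second moments suffice.\<close>

lemma integrable_times_linear_bound:
  fixes Y :: "'a \<Rightarrow> real^'d"
  assumes M: "prob_space M" and Y: "gaussian_vec M Y 0 S"
    and h: "h \<in> borel_measurable M" "\<And>\<omega>. \<bar>h \<omega>\<bar> \<le> c * (1 + norm (Y \<omega>) + (norm (Y \<omega>))\<^sup>2)"
  shows "integrable M h"
proof (rule Bochner_Integration.integrable_bound)
  interpret prob_space M by fact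
  show "integrable M (\<lambda>\<omega>. c * (1 + norm (Y \<omega>) + (norm (Y \<omega>))\<^sup>2))"
    using gaussian_vec_integrable_norm[OF M Y] by simp
  show "AE \<omega> in M. norm (h \<omega>) \<le> norm (c * (1 + norm (Y \<omega>) + (norm (Y \<omega>))\<^sup>2))"
  proof (rule AE_I2)
    fix \<omega> show "norm (h \<omega>) \<le> norm (c * (1 + norm (Y \<omega>) + (norm (Y \<omega>))\<^sup>2))"
      using h(2)[of \<omega>] unfolding real_norm_def by linarith
  qed
qed (rule h(1))

lemma gaussian_score_integrable:
  fixes Y :: "'a \<Rightarrow> real^'d" and \<phi> :: "'a \<Rightarrow> real"
  assumes M: "prob_space M" and Y: "gaussian_vec M Y 0 S"
    and \<phi>: "\<phi> \<in> borel_measurable M" "\<And>\<omega>. \<bar>\<phi> \<omega>\<bar> \<le> K"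
  shows "integrable M (\<lambda>\<omega>. \<phi> \<omega> * (Y \<omega> \<bullet> v))" "integrable M (\<lambda>\<omega>. \<phi> \<omega> * (Y \<omega> \<bullet> (N *v Y \<omega>)))"
    "integrable M (\<lambda>\<omega>. Y \<omega> \<bullet> (N *v Y \<omega>))"
proof -
  interpret prob_space M by fact
  note \<phi>(1)[measurable]
  have Ym[measurable]: "Y \<in> borel_measurable M" using Y by (simp add: gaussian_vec_def)
  have K: "0 \<le> K" using \<phi>(2)[of undefined] by linarith
  have mN[measurable]: "(\<lambda>y. y \<bullet> (N *v y)) \<in> borel_measurable borel"
    by (intro borel_measurable_continuous_onI continuous_intros)
  define kN where "kN = onorm ((*v) N)"
  have kN: "norm (N *v y) \<le> kN * norm y" "0 \<le> kN" for y
    unfolding kN_def by (auto intro: onorm onorm_pos_le)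
  have bN: "\<bar>Y \<omega> \<bullet> (N *v Y \<omega>)\<bar> \<le> kN * (norm (Y \<omega>))\<^sup>2" for \<omega>
  proof -
    have "\<bar>Y \<omega> \<bullet> (N *v Y \<omega>)\<bar> \<le> norm (Y \<omega>) * (kN * norm (Y \<omega>))"
      by (intro order.trans[OF Cauchy_Schwarz_ineq2] mult_left_mono kN) auto
    then show ?thesis by (simp add: power2_eq_square mult_ac)
  qed
  show "integrable M (\<lambda>\<omega>. \<phi> \<omega> * (Y \<omega> \<bullet> v))"
  proof (rule integrable_times_linear_bound[OF M Y, where c="K * norm v"])
    fix \<omega>
    have "\<bar>\<phi> \<omega>\<bar> * \<bar>Y \<omega> \<bullet> v\<bar> \<le> K * (norm (Y \<omega>) * norm v)"
      by (intro mult_mono \<phi> Cauchy_Schwarz_ineq2 K) auto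
    also have "\<dots> = K * norm v * norm (Y \<omega>)" by simp
    also have "\<dots> \<le> K * norm v * (1 + norm (Y \<omega>) + (norm (Y \<omega>))\<^sup>2)"
      using K by (intro mult_left_mono) auto
    finally show "\<bar>\<phi> \<omega> * (Y \<omega> \<bullet> v)\<bar> \<le> K * norm v * (1 + norm (Y \<omega>) + (norm (Y \<omega>))\<^sup>2)"
      by (simp add: abs_mult)
  qed measurable
  show "integrable M (\<lambda>\<omega>. \<phi> \<omega> * (Y \<omega> \<bullet> (N *v Y \<omega>)))"
  proof (rule integrable_times_linear_bound[OF M Y, where c="K * kN"])
    fix \<omega>
    have "\<bar>\<phi> \<omega>\<bar> * \<bar>Y \<omega> \<bullet> (N *v Y \<omega>)\<bar> \<le> K * (kN * (norm (Y \<omega>))\<^sup>2)"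
      by (intro mult_mono \<phi> bN K) auto
    also have "\<dots> \<le> K * (kN * (1 + norm (Y \<omega>) + (norm (Y \<omega>))\<^sup>2))"
      using K kN by (intro mult_left_mono) auto
    finally show "\<bar>\<phi> \<omega> * (Y \<omega> \<bullet> (N *v Y \<omega>))\<bar> \<le> K * kN * (1 + norm (Y \<omega>) + (norm (Y \<omega>))\<^sup>2)"
      by (simp add: abs_mult mult.assoc)
  qed measurable
  show "integrable M (\<lambda>\<omega>. Y \<omega> \<bullet> (N *v Y \<omega>))"
  proof (rule integrable_times_linear_bound[OF M Y, where c="kN"])
    fix \<omega>
    have "kN * (norm (Y \<omega>))\<^sup>2 \<le> kN * (1 + norm (Y \<omega>) + (norm (Y \<omega>))\<^sup>2)"
      using kN by (intro mult_left_mono) auto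
    then show "\<bar>Y \<omega> \<bullet> (N *v Y \<omega>)\<bar> \<le> kN * (1 + norm (Y \<omega>) + (norm (Y \<omega>))\<^sup>2)" using bN[of \<omega>] by linarith
  qed measurable
qed

text \<open>Stein's identity in each coordinate \<open>i\<close> for the product of \<open>f\<close>
  with the \<open>i\<close>-th component of the affine field \<open>u + D *v y\<close>. The product
  rule produces the diagonal entries of \<open>D\<close>, which add up to the trace.\<close>

lemma gaussian_integration_by_parts:
  fixes Y :: "'a \<Rightarrow> real^'d" and S D :: "real^'d^'d" and f :: "real^'d \<Rightarrow> real"
  assumes M: "prob_space M" and Y: "gaussian_vec M Y 0 S"
    and sym: "transpose S = S" and pos: "\<And>v. v \<noteq> 0 \<Longrightarrow> 0 < v \<bullet> (S *v v)"
    and f: "continuous_on UNIV f" "partially_differentiable f" "\<And>i. continuous_on UNIV (pd i f)"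
    and b: "\<And>x. \<bar>f x\<bar> \<le> K" "\<And>i x. \<bar>pd i f x\<bar> \<le> K"
  shows "(\<integral>\<omega>. (\<Sum>i\<in>UNIV. (u + D *v Y \<omega>) $ i * pd i f (m + Y \<omega>)) \<partial>M)
     = (\<integral>\<omega>. f (m + Y \<omega>) * ((matrix_inv S *v Y \<omega>) \<bullet> (u + D *v Y \<omega>)) \<partial>M)
       - (\<Sum>i\<in>UNIV. D $ i $ i) * (\<integral>\<omega>. f (m + Y \<omega>) \<partial>M)"
proof -
  interpret prob_space M by fact
  have Ym[measurable]: "Y \<in> borel_measurable M" using Y by (simp add: gaussian_vec_def)
  have fm[measurable]: "f \<in> borel_measurable borel" "\<And>i. pd i f \<in> borel_measurable borel"
    using f by (auto intro: borel_measurable_continuous_onI)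
  have K: "0 \<le> K" using b(1)[of 0] by linarith
  define P where "P = matrix_inv S"
  have Psym: "transpose P = P" unfolding P_def by (rule transpose_matrix_inv[OF invertible_posdef[OF pos] sym])
  define L where "L y = u + D *v y" for y
  have cL: "continuous_on UNIV L" unfolding L_def by (intro continuous_intros)
  have [measurable]: "(\<lambda>y. L y $ i) \<in> borel_measurable borel" "(\<lambda>y. (P *v y) $ i) \<in> borel_measurable borel" for i
    by (intro borel_measurable_continuous_onI continuous_intros cL)+
  define kD where "kD = onorm ((*v) D)"
  define kP where "kP = onorm ((*v) P)"
  have kD: "norm (D *v y) \<le> kD * norm y" "0 \<le> kD" for y
    unfolding kD_def by (auto intro: onorm onorm_pos_le)
  have kP: "norm (P *v y) \<le> kP * norm y" "0 \<le> kP" for y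
    unfolding kP_def by (auto intro: onorm onorm_pos_le)
  define c where "c = norm u + kD"
  have c0: "0 \<le> c" using kD by (simp add: c_def)
  have bL: "norm (L y) \<le> c * (1 + norm y)" for y
  proof -
    have "norm (L y) \<le> norm u + kD * norm y"
      unfolding L_def using norm_triangle_ineq[of u "D *v y"] kD(1)[of y] by linarith
    also have "\<dots> \<le> c * (1 + norm y)" using kD by (simp add: c_def algebra_simps)
    finally show ?thesis .
  qed
  have bLi: "\<bar>L y $ i\<bar> \<le> c * (1 + norm y)" for y i
    using component_le_norm_cart[of "L y" i] bL[of y] by linarith
  have Dii: "\<bar>D $ i $ i\<bar> \<le> kD" for i
    using component_le_norm_cart[of "D *v axis i 1" i] kD(1)[of "axis i 1"]
    by (simp add: matrix_vector_mult_basis column_def)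
  have stein: "(\<integral>\<omega>. (P *v Y \<omega>) $ i * (f (m + Y \<omega>) * L (Y \<omega>) $ i) \<partial>M)
     = (\<integral>\<omega>. pd i f (m + Y \<omega>) * L (Y \<omega>) $ i + f (m + Y \<omega>) * D $ i $ i \<partial>M)" for i
  proof -
    have "(\<integral>\<omega>. ((matrix_inv S *v axis i 1) \<bullet> Y \<omega>) * (f (m + Y \<omega>) * L (Y \<omega>) $ i) \<partial>M)
     = (\<integral>\<omega>. pd i f (m + Y \<omega>) * L (Y \<omega>) $ i + f (m + Y \<omega>) * D $ i $ i \<partial>M)"
    \<comment> \<open>\<open>K\<close> bounds \<open>f\<close> and its partials, \<open>c\<close>
      the linear growth of \<open>L\<close>, and \<open>kD\<close> the diagonal entries of
      \<open>D\<close>; the derivative is a sum of two products, hence the two summands of the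
      constant.\<close>
    proof (rule stein_gaussian_vec[OF M Y sym pos, where F="\<lambda>y. f (m + y) * L y $ i"
          and F'="\<lambda>y. pd i f (m + y) * L y $ i + f (m + y) * D $ i $ i" and C="K * c + K * kD"])
      fix y and s :: real
      have 1: "((\<lambda>s. f (m + (y + s *\<^sub>R axis i 1))) has_real_derivative pd i f (m + (y + s *\<^sub>R axis i 1))) (at s)"
        using pd_has_real_derivative[OF f(2), of "m + y"] by (simp add: add.assoc)
      have 2: "((\<lambda>s. L (y + s *\<^sub>R axis i 1) $ i) has_real_derivative D $ i $ i) (at s)"
        unfolding L_def by (auto intro!: derivative_eq_intros simp: matrix_vector_right_distrib
            matrix_vector_mult_scaleR matrix_vector_mult_basis column_def)
      show "((\<lambda>s. f (m + (y + s *\<^sub>R axis i 1)) * L (y + s *\<^sub>R axis i 1) $ i) has_real_derivative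
        pd i f (m + (y + s *\<^sub>R axis i 1)) * L (y + s *\<^sub>R axis i 1) $ i + f (m + (y + s *\<^sub>R axis i 1)) * D $ i $ i) (at s)"
        using DERIV_mult[OF 1 2] by (simp add: algebra_simps)
    next
      show "continuous_on UNIV (\<lambda>y. f (m + y) * L y $ i)"
        by (intro continuous_intros continuous_on_compose2[OF f(1)] cL) auto
      show "continuous_on UNIV (\<lambda>y. pd i f (m + y) * L y $ i + f (m + y) * D $ i $ i)"
        by (intro continuous_intros continuous_on_compose2[OF f(1)] continuous_on_compose2[OF f(3)] cL) auto
      fix y :: "real^'d"
      have 1: "\<bar>f (m + y)\<bar> * \<bar>L y $ i\<bar> \<le> K * (c * (1 + norm y))"
        by (intro mult_mono b bLi K) auto
      have 2: "\<bar>pd i f (m + y)\<bar> * \<bar>L y $ i\<bar> \<le> K * (c * (1 + norm y))"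
        by (intro mult_mono b bLi K) auto
      have 3: "\<bar>f (m + y)\<bar> * \<bar>D $ i $ i\<bar> \<le> K * kD" by (intro mult_mono b Dii K) auto
      have 4: "K * kD \<le> K * kD * (1 + norm y)" using K kD by (simp add: mult_left_le algebra_simps)
      have 5: "(K * c + K * kD) * (1 + norm y) = K * (c * (1 + norm y)) + K * kD * (1 + norm y)"
        by (simp add: algebra_simps)
      have 6: "0 \<le> K * kD" using K kD by simp
      show "\<bar>f (m + y) * L y $ i\<bar> \<le> (K * c + K * kD) * (1 + norm y)"
        using 1 4 5 6 by (simp add: abs_mult)
      show "\<bar>pd i f (m + y) * L y $ i + f (m + y) * D $ i $ i\<bar> \<le> (K * c + K * kD) * (1 + norm y)"
        using abs_triangle_ineq[of "pd i f (m + y) * L y $ i" "f (m + y) * D $ i $ i"] 2 3 4 5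
        by (simp only: abs_mult)
    qed
    moreover have "(matrix_inv S *v axis i 1) \<bullet> Y \<omega> = (P *v Y \<omega>) $ i" for \<omega>
    proof -
      have "(P *v axis i 1) \<bullet> Y \<omega> = axis i 1 \<bullet> (P *v Y \<omega>)"
        using dot_transpose_mult[of "axis i 1" P "Y \<omega>"] Psym by simp
      then show ?thesis by (simp add: inner_axis' P_def)
    qed
    ultimately show ?thesis by simp
  qed
  have sq: "(1 + norm y) * norm y \<le> 1 + norm y + (norm y)\<^sup>2" for y :: "real^'d" by (simp add: algebra_simps power2_eq_square)
  have ia: "integrable M (\<lambda>\<omega>. pd i f (m + Y \<omega>) * L (Y \<omega>) $ i)" for i
  proof (rule integrable_times_linear_bound[OF M Y, where c="K * c"])
    fix \<omega>
    have "\<bar>pd i f (m + Y \<omega>)\<bar> * \<bar>L (Y \<omega>) $ i\<bar> \<le> K * (c * (1 + norm (Y \<omega>)))"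
      by (intro mult_mono b bLi K) auto
    also have "\<dots> \<le> K * c * (1 + norm (Y \<omega>) + (norm (Y \<omega>))\<^sup>2)"
      unfolding mult.assoc[symmetric] using K c0 by (intro mult_left_mono) auto
    finally show "\<bar>pd i f (m + Y \<omega>) * L (Y \<omega>) $ i\<bar> \<le> K * c * (1 + norm (Y \<omega>) + (norm (Y \<omega>))\<^sup>2)"
      by (simp add: abs_mult)
  qed measurable
  have fi: "integrable M (\<lambda>\<omega>. f (m + Y \<omega>))"
    using b(1) by (intro integrable_const_bound[of _ K]) auto
  have ip: "integrable M (\<lambda>\<omega>. (P *v Y \<omega>) $ i * (f (m + Y \<omega>) * L (Y \<omega>) $ i))" for i
  proof (rule integrable_times_linear_bound[OF M Y, where c="kP * K * c"])
    fix \<omega>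
    have "\<bar>(P *v Y \<omega>) $ i\<bar> \<le> kP * norm (Y \<omega>)"
      using component_le_norm_cart[of "P *v Y \<omega>" i] kP(1)[of "Y \<omega>"] by linarith
    then have "\<bar>(P *v Y \<omega>) $ i\<bar> * (\<bar>f (m + Y \<omega>)\<bar> * \<bar>L (Y \<omega>) $ i\<bar>) \<le> (kP * norm (Y \<omega>)) * (K * (c * (1 + norm (Y \<omega>))))"
      using kP K by (intro mult_mono b bLi) auto
    also have "\<dots> = kP * K * c * ((1 + norm (Y \<omega>)) * norm (Y \<omega>))" by (simp only: mult_ac)
    also have "\<dots> \<le> kP * K * c * (1 + norm (Y \<omega>) + (norm (Y \<omega>))\<^sup>2)"
      using kP K c0 by (intro mult_left_mono sq) auto
    finally show "\<bar>(P *v Y \<omega>) $ i * (f (m + Y \<omega>) * L (Y \<omega>) $ i)\<bar> \<le> kP * K * c * (1 + norm (Y \<omega>) + (norm (Y \<omega>))\<^sup>2)"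
      by (simp add: abs_mult)
  qed measurable
  have "(\<integral>\<omega>. f (m + Y \<omega>) * ((P *v Y \<omega>) \<bullet> L (Y \<omega>)) \<partial>M)
     = (\<integral>\<omega>. (\<Sum>i\<in>UNIV. (P *v Y \<omega>) $ i * (f (m + Y \<omega>) * L (Y \<omega>) $ i)) \<partial>M)"
    by (simp add: inner_vec_def sum_distrib_left mult_ac)
  also have "\<dots> = (\<Sum>i\<in>UNIV. \<integral>\<omega>. pd i f (m + Y \<omega>) * L (Y \<omega>) $ i + f (m + Y \<omega>) * D $ i $ i \<partial>M)"
    using ip by (simp add: stein)
  also have "\<dots> = (\<Sum>i\<in>UNIV. \<integral>\<omega>. L (Y \<omega>) $ i * pd i f (m + Y \<omega>) \<partial>M) + (\<Sum>i\<in>UNIV. D $ i $ i) * (\<integral>\<omega>. f (m + Y \<omega>) \<partial>M)"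
    using ia fi by (simp add: sum.distrib sum_distrib_left sum_distrib_right mult_ac)
  also have "(\<Sum>i\<in>UNIV. \<integral>\<omega>. L (Y \<omega>) $ i * pd i f (m + Y \<omega>) \<partial>M) = (\<integral>\<omega>. (\<Sum>i\<in>UNIV. L (Y \<omega>) $ i * pd i f (m + Y \<omega>)) \<partial>M)"
    using ia by (simp add: mult.commute)
  finally show ?thesis by (simp add: L_def P_def)
qed

text \<open>For this \<open>D\<close> the form \<open>(P *v y) \<bullet> (D *v y)\<close> is half of
  \<open>y \<bullet> (P ** Q ** P) *v y\<close>, which is the quadratic part of the score; the trace
  of \<open>D\<close> becomes the subtracted expectation.\<close>

lemma gaussian_score_identity:
  fixes Y :: "'a \<Rightarrow> real^'d" and S Q :: "real^'d^'d" and f :: "real^'d \<Rightarrow> real"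
  assumes M: "prob_space M" and Y: "gaussian_vec M Y 0 S"
    and sym: "transpose S = S" and pos: "\<And>v. v \<noteq> 0 \<Longrightarrow> 0 < v \<bullet> (S *v v)"
    and f: "continuous_on UNIV f" "partially_differentiable f" "\<And>i. continuous_on UNIV (pd i f)"
    and b: "\<And>x. \<bar>f x\<bar> \<le> K" "\<And>i x. \<bar>pd i f x\<bar> \<le> K"
    and D: "D = (1/2) *\<^sub>R (((1/2) *\<^sub>R (Q + transpose Q)) ** matrix_inv S)"
  shows "(\<integral>\<omega>. (\<Sum>i\<in>UNIV. (u + D *v Y \<omega>) $ i * pd i f (m + Y \<omega>)) \<partial>M)
     = gaussian_score M Y (\<lambda>\<omega>. f (m + Y \<omega>)) (matrix_inv S *v u) (matrix_inv S ** Q ** matrix_inv S)"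
proof -
  interpret prob_space M by fact
  have Ym[measurable]: "Y \<in> borel_measurable M" using Y by (simp add: gaussian_vec_def)
  have fm[measurable]: "f \<in> borel_measurable borel" using f by (auto intro: borel_measurable_continuous_onI)
  have K: "0 \<le> K" using b(1)[of 0] by linarith
  define P where "P = matrix_inv S"
  define N where "N = P ** Q ** P"
  have Psym: "transpose P = P" unfolding P_def by (rule transpose_matrix_inv[OF invertible_posdef[OF pos] sym])
  have quad: "(P *v y) \<bullet> (u + D *v y) = y \<bullet> (P *v u) + (y \<bullet> (N *v y)) / 2" for y
  proof -
    have "(P *v y) \<bullet> (D *v y) = (1/2) * ((P *v y) \<bullet> (((1/2) *\<^sub>R (Q + transpose Q)) *v (P *v y)))"
      by (simp add: D P_def[symmetric] bounded_bilinear.scaleR_left[OF matrix_vector_bb] flip: matrix_vector_mul_assoc)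
    also have "\<dots> = (1/2) * ((P *v y) \<bullet> (Q *v (P *v y)))" by (simp only: symmetric_part_quadratic)
    also have "(P *v y) \<bullet> (Q *v (P *v y)) = y \<bullet> (N *v y)"
      using dot_transpose_mult[of y P "Q *v (P *v y)"] Psym by (simp add: N_def matrix_vector_mul_assoc matrix_mul_assoc)
    finally have "(P *v y) \<bullet> (D *v y) = (y \<bullet> (N *v y)) / 2" by simp
    moreover have "(P *v y) \<bullet> u = y \<bullet> (P *v u)" using dot_transpose_mult[of y P u] Psym by simp
    ultimately show ?thesis by (simp add: inner_add_right)
  qed
  have one: "(\<lambda>_ :: 'a. 1 :: real) \<in> borel_measurable M" "\<And>\<omega> :: 'a. \<bar>1 :: real\<bar> \<le> 1" by auto
  have fYm: "(\<lambda>\<omega>. f (m + Y \<omega>)) \<in> borel_measurable M" by measurable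
  note I1 = gaussian_score_integrable[OF M Y one] and If = gaussian_score_integrable[OF M Y fYm b(1)]
  have pd1: "pd i (\<lambda>_. 1) x = 0" for i and x :: "real^'d" by (simp add: pd_def)
  \<comment> \<open>Integration by parts for the constant function 1: its partials vanish, so the
    identity evaluates the trace of \<open>D\<close> as an expectation.\<close>
  have "(\<integral>\<omega>. (\<Sum>i\<in>UNIV. (u + D *v Y \<omega>) $ i * pd i (\<lambda>_. 1) (m + Y \<omega>)) \<partial>M)
     = (\<integral>\<omega>. 1 * ((matrix_inv S *v Y \<omega>) \<bullet> (u + D *v Y \<omega>)) \<partial>M)
       - (\<Sum>i\<in>UNIV. D $ i $ i) * (\<integral>\<omega>. 1 \<partial>M)"
    by (rule gaussian_integration_by_parts[OF M Y sym pos, where K=1]) (auto simp: pd1 partially_differentiable_def)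
  then have tr: "(\<Sum>i\<in>UNIV. D $ i $ i) = (\<integral>\<omega>. (P *v Y \<omega>) \<bullet> (u + D *v Y \<omega>) \<partial>M)"
    by (simp add: pd1 prob_space P_def)
  also have "\<dots> = (\<integral>\<omega>. Y \<omega> \<bullet> (P *v u) \<partial>M) + (\<integral>\<omega>. Y \<omega> \<bullet> (N *v Y \<omega>) \<partial>M) / 2"
    unfolding quad using I1 by simp
  also have "(\<integral>\<omega>. Y \<omega> \<bullet> (P *v u) \<partial>M) = 0"
    using gaussian_vec_moments(3)[OF M Y, of "P *v u"] by (simp add: inner_commute)
  finally have tr: "(\<Sum>i\<in>UNIV. D $ i $ i) = (\<integral>\<omega>. Y \<omega> \<bullet> (N *v Y \<omega>) \<partial>M) / 2" by simp
  have "(\<integral>\<omega>. f (m + Y \<omega>) * ((P *v Y \<omega>) \<bullet> (u + D *v Y \<omega>)) \<partial>M)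
    = (\<integral>\<omega>. f (m + Y \<omega>) * (Y \<omega> \<bullet> (P *v u)) \<partial>M) + (\<integral>\<omega>. f (m + Y \<omega>) * (Y \<omega> \<bullet> (N *v Y \<omega>)) \<partial>M) / 2"
    unfolding quad distrib_left using If by simp
  moreover note gaussian_integration_by_parts[OF M Y sym pos f b, of u D m, folded P_def]
  ultimately show ?thesis
    unfolding gaussian_score_def P_def[symmetric] N_def[symmetric]
    by (simp only: tr diff_divide_distrib) (simp add: mult.commute)
qed

text \<open>\<open>Z \<epsilon>\<close> is given only by its characteristic function, on a space
  that varies with \<epsilon>. Its law is compared with that of
  \<open>m + Y + \<epsilon> *\<^sub>R (u + D *v Y)\<close>, which lives on \<open>M\<close> and
  whose expectation can be differentiated under the integral sign.\<close>

lemma gaussian_perturbation: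
  fixes Y :: "'a \<Rightarrow> real^'d" and S Q :: "real^'d^'d" and f :: "real^'d \<Rightarrow> real"
    and N :: "real \<Rightarrow> 'b measure" and Z :: "real \<Rightarrow> 'b \<Rightarrow> real^'d"
  assumes M: "prob_space M" and Y: "gaussian_vec M Y 0 S"
    and sym: "transpose S = S" and pos: "\<And>v. v \<noteq> 0 \<Longrightarrow> 0 < v \<bullet> (S *v v)"
    and f: "continuous_on UNIV f" "partially_differentiable f" "\<And>i. continuous_on UNIV (pd i f)"
    and f2: "\<And>i. partially_differentiable (pd i f)" "\<And>i j. continuous_on UNIV (pd j (pd i f))"
      "\<And>i j x. \<bar>pd j (pd i f) x\<bar> \<le> K"
    and b: "\<And>x. \<bar>f x\<bar> \<le> K" "\<And>i x. \<bar>pd i f x\<bar> \<le> K"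
    and Z: "\<forall>\<^sub>F \<epsilon> in at 0. prob_space (N \<epsilon>) \<and> Z \<epsilon> \<in> borel_measurable (N \<epsilon>) \<and>
      (\<forall>\<xi> \<theta>. (\<integral>\<omega>. cos (\<xi> \<bullet> Z \<epsilon> \<omega> + \<theta>) \<partial>N \<epsilon>)
         = exp (- (\<xi> \<bullet> (S *v \<xi>) + \<epsilon> * (\<xi> \<bullet> (Q *v \<xi>))) / 2) * cos (\<xi> \<bullet> (m + \<epsilon> *\<^sub>R u) + \<theta>))"
  shows "((\<lambda>\<epsilon>. ((\<integral>\<omega>. f (Z \<epsilon> \<omega>) \<partial>N \<epsilon>) - (\<integral>\<omega>. f (m + Y \<omega>) \<partial>M)) / \<epsilon>)
     \<longlongrightarrow> gaussian_score M Y (\<lambda>\<omega>. f (m + Y \<omega>)) (matrix_inv S *v u) (matrix_inv S ** Q ** matrix_inv S)) (at 0)"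
proof -
  interpret M: prob_space M by fact
  have Ym[measurable]: "Y \<in> borel_measurable M" using Y by (simp add: gaussian_vec_def)
  have fm[measurable]: "f \<in> borel_measurable borel" "\<And>i. pd i f \<in> borel_measurable borel"
    using f by (auto intro: borel_measurable_continuous_onI)
  have psd: "0 \<le> v \<bullet> (S *v v)" for v using pos[of v] by (cases "v = 0") auto
  have K: "0 \<le> K" using b(1)[of 0] by linarith
  define P where "P = matrix_inv S"
  have Psym: "transpose P = P" unfolding P_def by (rule transpose_matrix_inv[OF invertible_posdef[OF pos] sym])
  define Qs where "Qs = (1/2) *\<^sub>R (Q + transpose Q)"
  \<comment> \<open>Chosen so that \<open>D ** S\<close> is half of the symmetric part of
    \<open>Q\<close>: the affine image of \<open>Y\<close> then has covariance correct to first
    order in \<epsilon>, with surplus \<open>\<epsilon>\<^sup>2\<close> times the covariance of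
    \<open>D *v Y\<close>.\<close>
  define D where "D = (1/2) *\<^sub>R (Qs ** P)"
  have D: "D = (1/2) *\<^sub>R (((1/2) *\<^sub>R (Q + transpose Q)) ** matrix_inv S)" by (simp add: D_def Qs_def P_def)
  define L where "L y = u + D *v y" for y
  have cL: "continuous_on UNIV L" unfolding L_def by (intro continuous_intros)
  have cD: "continuous_on UNIV ((*v) D)" by (intro continuous_intros)
  have [measurable]: "L \<in> borel_measurable borel" "((*v) D) \<in> borel_measurable borel"
    by (rule borel_measurable_continuous_onI, rule cL cD)+
  have [measurable]: "(\<lambda>y. L y $ i) \<in> borel_measurable borel" for i
    by (intro borel_measurable_continuous_onI continuous_intros cL)+
  define kD where "kD = onorm ((*v) D)"
  have kD: "norm (D *v y) \<le> kD * norm y" "0 \<le> kD" for y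
    unfolding kD_def by (auto intro: onorm onorm_pos_le)
  define d where "d = real CARD('d)"
  have SD: "\<xi> \<bullet> (S *v (transpose D *v \<xi>)) = (\<xi> \<bullet> (Q *v \<xi>)) / 2" for \<xi>
  proof -
    have "transpose D = (1/2) *\<^sub>R (P ** transpose Qs)"
      by (simp add: D_def transpose_scalar matrix_transpose_mul Psym)
    moreover have "transpose Qs = Qs"
      by (simp add: Qs_def transpose_scalar vec_eq_iff transpose_def add.commute)
    ultimately have "S *v (transpose D *v \<xi>) = (1/2) *\<^sub>R (Qs *v \<xi>)"
      using matrix_inv_mult(3)[OF invertible_posdef[OF pos], of "Qs *v \<xi>"]
      by (simp add: P_def bounded_bilinear.scaleR_left[OF matrix_vector_bb] matrix_vector_mult_scaleR flip: matrix_vector_mul_assoc)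
    then show ?thesis using symmetric_part_quadratic[of \<xi> Q] by (simp add: Qs_def)
  qed
  have ch: "(\<integral>\<omega>. cos (\<xi> \<bullet> Y \<omega> + \<theta>) \<partial>M) = exp (- (\<xi> \<bullet> (S *v \<xi>)) / 2) * cos \<theta>" for \<xi> \<theta>
    using gaussian_vec_char[OF M Y psd] by simp
  define e2 where "e2 = (\<integral>\<omega>. (norm (D *v Y \<omega>))\<^sup>2 \<partial>M)"
  have iD: "integrable M (\<lambda>\<omega>. (norm (D *v Y \<omega>))\<^sup>2)"
  proof (rule integrable_times_linear_bound[OF M Y, where c="kD\<^sup>2"])
    fix \<omega>
    have "(norm (D *v Y \<omega>))\<^sup>2 \<le> (kD * norm (Y \<omega>))\<^sup>2" by (intro power_mono kD) auto
    also have "\<dots> = kD\<^sup>2 * (norm (Y \<omega>))\<^sup>2" by (simp add: power_mult_distrib)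
    also have "\<dots> \<le> kD\<^sup>2 * (1 + norm (Y \<omega>) + (norm (Y \<omega>))\<^sup>2)" by (intro mult_left_mono) auto
    finally show "\<bar>(norm (D *v Y \<omega>))\<^sup>2\<bar> \<le> kD\<^sup>2 * (1 + norm (Y \<omega>) + (norm (Y \<omega>))\<^sup>2)" by simp
  qed measurable
  text \<open>Adding an independent \<open>\<epsilon> D Y\<close> to \<open>Z \<epsilon>\<close> completes the square in the covariance, so the sum has
    the law of \<open>m + Y + \<epsilon> (u + D Y)\<close>; being centred, it costs only \<open>O(\<epsilon>\<^sup>2)\<close>.\<close>
  have main: "\<bar>(\<integral>\<omega>. f (Z \<epsilon> \<omega>) \<partial>N \<epsilon>) - (\<integral>\<omega>. f (m + Y \<omega> + \<epsilon> *\<^sub>R L (Y \<omega>)) \<partial>M)\<bar> \<le> d\<^sup>2 * K * e2 * \<epsilon>\<^sup>2"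
    if N: "prob_space (N \<epsilon>)" and Zm[measurable]: "Z \<epsilon> \<in> borel_measurable (N \<epsilon>)"
      and chZ: "\<And>\<xi> \<theta>. (\<integral>\<omega>. cos (\<xi> \<bullet> Z \<epsilon> \<omega> + \<theta>) \<partial>N \<epsilon>)
         = exp (- (\<xi> \<bullet> (S *v \<xi>) + \<epsilon> * (\<xi> \<bullet> (Q *v \<xi>))) / 2) * cos (\<xi> \<bullet> (m + \<epsilon> *\<^sub>R u) + \<theta>)" for \<epsilon>
  proof -
    interpret N: prob_space "N \<epsilon>" by fact
    interpret R: pair_prob_space "N \<epsilon>" M ..
    let ?W = "\<lambda>(\<omega>, \<omega>'). Z \<epsilon> \<omega> + \<epsilon> *\<^sub>R (D *v Y \<omega>')"
    have Wm[measurable]: "?W \<in> borel_measurable (N \<epsilon> \<Otimes>\<^sub>M M)" by measurable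
    have Xm[measurable]: "(\<lambda>\<omega>. m + Y \<omega> + \<epsilon> *\<^sub>R L (Y \<omega>)) \<in> borel_measurable M" by measurable
    have e1: "(\<integral>x. f (?W x) \<partial>(N \<epsilon> \<Otimes>\<^sub>M M)) = (\<integral>\<omega>. f (m + Y \<omega> + \<epsilon> *\<^sub>R L (Y \<omega>)) \<partial>M)"
    proof (rule expectation_eq_of_char_eq[OF R.prob_space_axioms M Wm Xm _ f(1) b(1)])
      fix \<xi> \<theta>
      define \<eta> where "\<eta> = \<epsilon> *\<^sub>R (transpose D *v \<xi>)"
      have \<eta>: "\<xi> \<bullet> (\<epsilon> *\<^sub>R (D *v y)) = \<eta> \<bullet> y" for y
        by (simp add: \<eta>_def dot_transpose_mult)
      have i: "integrable (N \<epsilon> \<Otimes>\<^sub>M M) (\<lambda>(\<omega>, \<omega>'). cos (\<xi> \<bullet> Z \<epsilon> \<omega> + \<eta> \<bullet> Y \<omega>' + \<theta>))"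
        by (rule R.integrable_const_bound[of _ 1]) auto
      have "(\<integral>x. cos (\<xi> \<bullet> ?W x + \<theta>) \<partial>(N \<epsilon> \<Otimes>\<^sub>M M)) = (\<integral>(\<omega>, \<omega>'). cos (\<xi> \<bullet> Z \<epsilon> \<omega> + \<eta> \<bullet> Y \<omega>' + \<theta>) \<partial>(N \<epsilon> \<Otimes>\<^sub>M M))"
        by (simp only: case_prod_unfold inner_add_right \<eta>)
      also have "\<dots> = (\<integral>\<omega>. (\<integral>\<omega>'. cos (\<xi> \<bullet> Z \<epsilon> \<omega> + \<eta> \<bullet> Y \<omega>' + \<theta>) \<partial>M) \<partial>N \<epsilon>)"
        using R.integral_fst'[OF i] by simp
      also have "\<dots> = (\<integral>\<omega>. exp (- (\<eta> \<bullet> (S *v \<eta>)) / 2) * cos (\<xi> \<bullet> Z \<epsilon> \<omega> + \<theta>) \<partial>N \<epsilon>)"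
      proof (rule Bochner_Integration.integral_cong[OF refl])
        fix \<omega>
        show "(\<integral>\<omega>'. cos (\<xi> \<bullet> Z \<epsilon> \<omega> + \<eta> \<bullet> Y \<omega>' + \<theta>) \<partial>M) = exp (- (\<eta> \<bullet> (S *v \<eta>)) / 2) * cos (\<xi> \<bullet> Z \<epsilon> \<omega> + \<theta>)"
          using ch[of \<eta> "\<xi> \<bullet> Z \<epsilon> \<omega> + \<theta>"] by (simp add: add_ac)
      qed
      also have "\<dots> = exp (- (\<eta> \<bullet> (S *v \<eta>)) / 2) * (exp (- (\<xi> \<bullet> (S *v \<xi>) + \<epsilon> * (\<xi> \<bullet> (Q *v \<xi>))) / 2) * cos (\<xi> \<bullet> (m + \<epsilon> *\<^sub>R u) + \<theta>))"
        by (simp only: integral_mult_right_zero chZ)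
      also have "\<dots> = exp (- ((\<xi> + \<eta>) \<bullet> (S *v (\<xi> + \<eta>))) / 2) * cos (\<xi> \<bullet> (m + \<epsilon> *\<^sub>R u) + \<theta>)"
      proof -
        have "\<xi> \<bullet> (S *v \<eta>) = \<epsilon> * (\<xi> \<bullet> (Q *v \<xi>)) / 2"
          by (simp add: \<eta>_def matrix_vector_mult_scaleR SD del: transpose_matrix_vector)
        moreover have "\<eta> \<bullet> (S *v \<xi>) = \<xi> \<bullet> (S *v \<eta>)"
          using dot_transpose_mult[of \<eta> S \<xi>] sym by (simp add: inner_commute)
        ultimately have "(\<xi> + \<eta>) \<bullet> (S *v (\<xi> + \<eta>)) = \<eta> \<bullet> (S *v \<eta>) + (\<xi> \<bullet> (S *v \<xi>) + \<epsilon> * (\<xi> \<bullet> (Q *v \<xi>)))"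
          by (simp add: matrix_vector_right_distrib inner_add_left inner_add_right)
        then show ?thesis by (simp add: add_divide_distrib diff_divide_distrib flip: exp_add mult.assoc)
      qed
      also have "\<dots> = (\<integral>\<omega>. cos ((\<xi> + \<eta>) \<bullet> Y \<omega> + (\<xi> \<bullet> (m + \<epsilon> *\<^sub>R u) + \<theta>)) \<partial>M)"
        unfolding ch ..
      also have "\<dots> = (\<integral>\<omega>. cos (\<xi> \<bullet> (m + Y \<omega> + \<epsilon> *\<^sub>R L (Y \<omega>)) + \<theta>) \<partial>M)"
      proof (rule Bochner_Integration.integral_cong[OF refl])
        fix \<omega>
        show "cos ((\<xi> + \<eta>) \<bullet> Y \<omega> + (\<xi> \<bullet> (m + \<epsilon> *\<^sub>R u) + \<theta>)) = cos (\<xi> \<bullet> (m + Y \<omega> + \<epsilon> *\<^sub>R L (Y \<omega>)) + \<theta>)"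
          using \<eta>[of "Y \<omega>"] by (simp add: L_def scaleR_add_right inner_add_left inner_add_right add_ac)
      qed
      finally show "(\<integral>x. cos (\<xi> \<bullet> ?W x + \<theta>) \<partial>(N \<epsilon> \<Otimes>\<^sub>M M)) = (\<integral>\<omega>. cos (\<xi> \<bullet> (m + Y \<omega> + \<epsilon> *\<^sub>R L (Y \<omega>)) + \<theta>) \<partial>M)" .
    qed
    have iW: "integrable (N \<epsilon> \<Otimes>\<^sub>M M) (\<lambda>(\<omega>, \<omega>'). f (Z \<epsilon> \<omega> + \<epsilon> *\<^sub>R (D *v Y \<omega>')))"
      using b(1) by (intro R.integrable_const_bound[of _ K]) auto
    have iZ: "integrable (N \<epsilon>) (\<lambda>\<omega>. f (Z \<epsilon> \<omega>))"
      using b(1) by (intro N.integrable_const_bound[of _ K]) auto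
    define J where "J z = (\<integral>\<omega>. f (z + \<epsilon> *\<^sub>R (D *v Y \<omega>)) \<partial>M)" for z
    have e2': "(\<integral>x. f (?W x) \<partial>(N \<epsilon> \<Otimes>\<^sub>M M)) = (\<integral>\<omega>. J (Z \<epsilon> \<omega>) \<partial>N \<epsilon>)"
      using R.integral_fst'[OF iW] by (simp add: J_def case_prod_unfold)
    have iJ: "integrable (N \<epsilon>) (\<lambda>\<omega>. J (Z \<epsilon> \<omega>))"
      using R.integrable_fst'[OF iW] by (simp add: J_def)
    have Jb: "\<bar>f z - J z\<bar> \<le> d\<^sup>2 * K * e2 * \<epsilon>\<^sup>2" for z
    proof -
      \<comment> \<open>The first-order Taylor term is a linear functional of the centred vector
        \<open>Y\<close>, so it integrates to zero and only the quadratic remainder is left.\<close>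
      define g where "g \<omega> = (\<Sum>i\<in>UNIV. (\<epsilon> *\<^sub>R (D *v Y \<omega>)) $ i * pd i f z)" for \<omega>
      have ge: "g \<omega> = (transpose D *v (\<chi> i. \<epsilon> * pd i f z)) \<bullet> Y \<omega>" for \<omega>
        unfolding dot_transpose_mult[symmetric] by (simp add: g_def inner_vec_def mult_ac)
      have gi: "integrable M g" "(\<integral>\<omega>. g \<omega> \<partial>M) = 0"
        unfolding ge using gaussian_vec_moments(1,3)[OF M Y] by simp_all
      have fi: "integrable M (\<lambda>\<omega>. f (z + \<epsilon> *\<^sub>R (D *v Y \<omega>)))"
        using b(1) by (intro M.integrable_const_bound[of _ K]) auto
      have "J z - f z = (\<integral>\<omega>. f (z + \<epsilon> *\<^sub>R (D *v Y \<omega>)) - f z - g \<omega> \<partial>M)"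
        using gi fi by (simp add: J_def M.prob_space)
      also have "\<bar>\<dots>\<bar> \<le> (\<integral>\<omega>. \<bar>f (z + \<epsilon> *\<^sub>R (D *v Y \<omega>)) - f z - g \<omega>\<bar> \<partial>M)"
        by (rule integral_abs_bound)
      also have "\<dots> \<le> (\<integral>\<omega>. d\<^sup>2 * K * \<epsilon>\<^sup>2 * (norm (D *v Y \<omega>))\<^sup>2 \<partial>M)"
      proof (rule integral_mono)
        show "integrable M (\<lambda>\<omega>. \<bar>f (z + \<epsilon> *\<^sub>R (D *v Y \<omega>)) - f z - g \<omega>\<bar>)" using gi fi by auto
        show "integrable M (\<lambda>\<omega>. d\<^sup>2 * K * \<epsilon>\<^sup>2 * (norm (D *v Y \<omega>))\<^sup>2)" using iD by simp
        fix \<omega>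
        show "\<bar>f (z + \<epsilon> *\<^sub>R (D *v Y \<omega>)) - f z - g \<omega>\<bar> \<le> d\<^sup>2 * K * \<epsilon>\<^sup>2 * (norm (D *v Y \<omega>))\<^sup>2"
          using taylor_bound[OF f(2,3) f2, of z "\<epsilon> *\<^sub>R (D *v Y \<omega>)"]
          by (simp add: g_def d_def power_mult_distrib mult_ac)
      qed
      also have "\<dots> = d\<^sup>2 * K * e2 * \<epsilon>\<^sup>2" by (simp add: e2_def)
      finally show ?thesis by (simp add: abs_minus_commute)
    qed
    have "(\<integral>\<omega>. f (Z \<epsilon> \<omega>) \<partial>N \<epsilon>) - (\<integral>\<omega>. f (m + Y \<omega> + \<epsilon> *\<^sub>R L (Y \<omega>)) \<partial>M) = (\<integral>\<omega>. f (Z \<epsilon> \<omega>) - J (Z \<epsilon> \<omega>) \<partial>N \<epsilon>)"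
      using e1 e2' iZ iJ by simp
    also have "\<bar>\<dots>\<bar> \<le> d\<^sup>2 * K * e2 * \<epsilon>\<^sup>2"
      by (rule expectation_abs_le[OF N]) (use iZ iJ Jb in auto)
    finally show ?thesis .
  qed
  have l1: "((\<lambda>\<epsilon>. ((\<integral>\<omega>. f (Z \<epsilon> \<omega>) \<partial>N \<epsilon>) - (\<integral>\<omega>. f (m + Y \<omega> + \<epsilon> *\<^sub>R L (Y \<omega>)) \<partial>M)) / \<epsilon>) \<longlongrightarrow> 0) (at 0)"
  proof (rule Lim_null_comparison)
    show "\<forall>\<^sub>F \<epsilon> in at 0. norm (((\<integral>\<omega>. f (Z \<epsilon> \<omega>) \<partial>N \<epsilon>) - (\<integral>\<omega>. f (m + Y \<omega> + \<epsilon> *\<^sub>R L (Y \<omega>)) \<partial>M)) / \<epsilon>) \<le> d\<^sup>2 * K * e2 * \<bar>\<epsilon>\<bar>"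
      using Z eventually_neq_at_within[of 0 0 UNIV]
    proof eventually_elim
      case (elim \<epsilon>)
      then have "\<bar>(\<integral>\<omega>. f (Z \<epsilon> \<omega>) \<partial>N \<epsilon>) - (\<integral>\<omega>. f (m + Y \<omega> + \<epsilon> *\<^sub>R L (Y \<omega>)) \<partial>M)\<bar> \<le> d\<^sup>2 * K * e2 * \<epsilon>\<^sup>2"
        by (intro main) auto
      also have "\<dots> = d\<^sup>2 * K * e2 * \<bar>\<epsilon>\<bar> * \<bar>\<epsilon>\<bar>" by (simp add: power2_eq_square)
      finally show ?case using elim by (simp add: abs_div pos_divide_le_eq)
    qed
    show "((\<lambda>\<epsilon>. d\<^sup>2 * K * e2 * \<bar>\<epsilon>\<bar>) \<longlongrightarrow> 0) (at 0)"
      by (intro tendsto_mult_right_zero tendsto_rabs_zero tendsto_ident_at)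
  qed
  have l2: "((\<lambda>\<epsilon>. ((\<integral>\<omega>. f (m + Y \<omega> + \<epsilon> *\<^sub>R L (Y \<omega>)) \<partial>M) - (\<integral>\<omega>. f (m + Y \<omega>) \<partial>M)) / \<epsilon>)
     \<longlongrightarrow> (\<integral>\<omega>. (\<Sum>i\<in>UNIV. L (Y \<omega>) $ i * pd i f (m + Y \<omega>)) \<partial>M)) (at 0)"
    unfolding tendsto_at_iff_sequentially comp_def
  proof (intro allI impI)
    fix e :: "nat \<Rightarrow> real" assume e: "\<forall>i. e i \<in> UNIV - {0}" "e \<longlonglongrightarrow> 0"
    have ne: "e n \<noteq> 0" for n using e(1) by blast
    have fe: "filterlim e (at 0) sequentially" using e ne by (simp add: filterlim_at)
    have i: "integrable M (\<lambda>\<omega>. f (m + Y \<omega> + r *\<^sub>R L (Y \<omega>)))" for r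
      using b(1) by (intro M.integrable_const_bound[of _ K]) auto
    have i0: "integrable M (\<lambda>\<omega>. f (m + Y \<omega>))"
      using b(1) by (intro M.integrable_const_bound[of _ K]) auto
    have "(\<lambda>n. \<integral>\<omega>. (f (m + Y \<omega> + e n *\<^sub>R L (Y \<omega>)) - f (m + Y \<omega>)) / e n \<partial>M)
       \<longlonglongrightarrow> (\<integral>\<omega>. (\<Sum>i\<in>UNIV. L (Y \<omega>) $ i * pd i f (m + Y \<omega>)) \<partial>M)"
    \<comment> \<open>The Lipschitz bound on \<open>f\<close> absorbs the division by
      \<open>e n\<close> and leaves a majorant of linear growth in \<open>Y\<close> that does not
      depend on \<open>n\<close>.\<close>
    proof (rule integral_dominated_convergence[where w="\<lambda>\<omega>. d * K * (norm u + kD * norm (Y \<omega>))"])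
      show "integrable M (\<lambda>\<omega>. d * K * (norm u + kD * norm (Y \<omega>)))"
        using gaussian_vec_integrable_norm[OF M Y] by simp
      show "AE \<omega> in M. (\<lambda>n. (f (m + Y \<omega> + e n *\<^sub>R L (Y \<omega>)) - f (m + Y \<omega>)) / e n)
         \<longlonglongrightarrow> (\<Sum>i\<in>UNIV. L (Y \<omega>) $ i * pd i f (m + Y \<omega>))"
      proof (rule AE_I2)
        fix \<omega>
        have "((\<lambda>h. (f (m + Y \<omega> + h *\<^sub>R L (Y \<omega>)) - f (m + Y \<omega>)) / h)
           \<longlongrightarrow> (\<Sum>i\<in>UNIV. L (Y \<omega>) $ i * pd i f (m + Y \<omega>))) (at 0)"
          using line_has_real_derivative[OF f(2,3), of "m + Y \<omega>" "L (Y \<omega>)" 0 UNIV]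
          by (simp add: DERIV_def)
        from filterlim_compose[OF this fe]
        show "(\<lambda>n. (f (m + Y \<omega> + e n *\<^sub>R L (Y \<omega>)) - f (m + Y \<omega>)) / e n)
         \<longlonglongrightarrow> (\<Sum>i\<in>UNIV. L (Y \<omega>) $ i * pd i f (m + Y \<omega>))" .
      qed
      fix n
      show "AE \<omega> in M. norm ((f (m + Y \<omega> + e n *\<^sub>R L (Y \<omega>)) - f (m + Y \<omega>)) / e n) \<le> d * K * (norm u + kD * norm (Y \<omega>))"
      proof (rule AE_I2)
        fix \<omega>
        have "\<bar>f (m + Y \<omega> + e n *\<^sub>R L (Y \<omega>)) - f (m + Y \<omega>)\<bar> \<le> d * K * norm (e n *\<^sub>R L (Y \<omega>))"
          unfolding d_def by (rule lipschitz_of_bounded_pd[OF f(2,3) b(2)])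
        also have "\<dots> = (d * K * norm (L (Y \<omega>))) * \<bar>e n\<bar>" by simp
        finally have "\<bar>f (m + Y \<omega> + e n *\<^sub>R L (Y \<omega>)) - f (m + Y \<omega>)\<bar> / \<bar>e n\<bar> \<le> d * K * norm (L (Y \<omega>))"
          using ne[of n] by (simp add: pos_divide_le_eq)
        also have "\<dots> \<le> d * K * (norm u + kD * norm (Y \<omega>))"
          unfolding L_def using norm_triangle_ineq[of u "D *v Y \<omega>"] kD(1)[of "Y \<omega>"] K
          by (intro mult_left_mono) (auto simp: d_def)
        finally show "norm ((f (m + Y \<omega> + e n *\<^sub>R L (Y \<omega>)) - f (m + Y \<omega>)) / e n) \<le> d * K * (norm u + kD * norm (Y \<omega>))"
          by (simp add: abs_div)
      qed
    qed measurable
    then show "(\<lambda>n. ((\<integral>\<omega>. f (m + Y \<omega> + e n *\<^sub>R L (Y \<omega>)) \<partial>M) - (\<integral>\<omega>. f (m + Y \<omega>) \<partial>M)) / e n)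
       \<longlonglongrightarrow> (\<integral>\<omega>. (\<Sum>i\<in>UNIV. L (Y \<omega>) $ i * pd i f (m + Y \<omega>)) \<partial>M)"
      using i i0 by simp
  qed
  have "(\<integral>\<omega>. (\<Sum>i\<in>UNIV. L (Y \<omega>) $ i * pd i f (m + Y \<omega>)) \<partial>M)
     = gaussian_score M Y (\<lambda>\<omega>. f (m + Y \<omega>)) (matrix_inv S *v u) (matrix_inv S ** Q ** matrix_inv S)"
    unfolding L_def by (rule gaussian_score_identity[OF M Y sym pos f b D])
  with tendsto_add[OF l1 l2] show ?thesis by (simp flip: add_divide_distrib)
qed

section \<open>One-time marginals of the martingale problem\<close>

text \<open>Away from 0 the function is locally a power or zero. At the kink the difference quotient
  is at most \<open>\<bar>h\<bar> ^ Suc n\<close>, which tends to 0 because the exponent is at least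
  2.\<close>

lemma max0_power_has_real_derivative:
  "((\<lambda>v :: real. (max 0 v) ^ Suc (Suc n)) has_real_derivative real (Suc (Suc n)) * (max 0 v) ^ Suc n) (at v)"
proof -
  consider "v > 0" | "v < 0" | "v = 0" by linarith
  then show ?thesis
  proof cases
    case 1
    have "((\<lambda>v :: real. v ^ Suc (Suc n)) has_real_derivative real (Suc (Suc n)) * v ^ Suc n) (at v)"
      using DERIV_pow[of "Suc (Suc n)" v] by simp
    then have d: "((\<lambda>v :: real. v ^ Suc (Suc n)) has_real_derivative real (Suc (Suc n)) * (max 0 v) ^ Suc n) (at v)"
      using 1 by simp
    have ev: "\<forall>\<^sub>F u in nhds v. u ^ Suc (Suc n) = (max 0 u) ^ Suc (Suc n)"
      by (rule eventually_mono[OF eventually_nhds_in_open[of "{0<..}" v]]) (use 1 in auto)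
    show ?thesis by (rule iffD1[OF DERIV_cong_ev[OF refl ev refl] d])
  next
    case 2
    have ev: "\<forall>\<^sub>F u in nhds v. 0 = (max 0 u) ^ Suc (Suc n)"
      by (rule eventually_mono[OF eventually_nhds_in_open[of "{..<0}" v]]) (use 2 in auto)
    have d: "((\<lambda>v :: real. 0) has_real_derivative real (Suc (Suc n)) * (max 0 v) ^ Suc n) (at v)"
      using 2 by simp
    show ?thesis by (rule iffD1[OF DERIV_cong_ev[OF refl ev refl] d])
  next
    case 3
    have "((\<lambda>h :: real. ((max 0 (0 + h)) ^ Suc (Suc n) - (max 0 0) ^ Suc (Suc n)) / h) \<longlongrightarrow> 0) (at 0)"
    proof (rule Lim_null_comparison)
      show "\<forall>\<^sub>F h in at 0. norm (((max 0 (0 + h)) ^ Suc (Suc n) - (max 0 (0::real)) ^ Suc (Suc n)) / h) \<le> \<bar>h\<bar> ^ Suc n"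
        using eventually_neq_at_within[of "0 :: real" 0 UNIV]
        by eventually_elim (auto simp: max_def abs_mult not_le intro!: mult_nonpos_nonneg zero_le_power)
      have "((\<lambda>h :: real. \<bar>h\<bar> ^ Suc n) \<longlongrightarrow> \<bar>0\<bar> ^ Suc n) (at 0)" by (intro tendsto_intros)
      then show "((\<lambda>h :: real. \<bar>h\<bar> ^ Suc n) \<longlongrightarrow> 0) (at 0)" by simp
    qed
    then show ?thesis using 3 by (simp add: DERIV_def)
  qed
qed

text \<open>The cube is the smallest integer power of the positive part with continuous second
  derivative, as membership in \<open>C2c\<close> requires; \<open>cut1\<close> and
  \<open>cut2\<close> are its first two derivatives.\<close>

definition cut :: "real \<Rightarrow> real" where "cut u = (max 0 (1 - u)) ^ 3"
definition cut1 :: "real \<Rightarrow> real" where "cut1 u = - 3 * (max 0 (1 - u))\<^sup>2"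
definition cut2 :: "real \<Rightarrow> real" where "cut2 u = 6 * max 0 (1 - u)"

lemma cut_has_real_derivative: "(cut has_real_derivative cut1 u) (at u)"
proof -
  have "((\<lambda>u. 1 - u) has_real_derivative - 1) (at u)" by (auto intro!: derivative_eq_intros)
  from DERIV_chain2[OF max0_power_has_real_derivative[of 1] this] show ?thesis
    by (simp add: cut_def[abs_def] cut1_def eval_nat_numeral)
qed

lemma cut1_has_real_derivative: "(cut1 has_real_derivative cut2 u) (at u)"
proof -
  have "((\<lambda>u. 1 - u) has_real_derivative - 1) (at u)" by (auto intro!: derivative_eq_intros)
  from DERIV_cmult[OF DERIV_chain2[OF max0_power_has_real_derivative[of 0] this], of "-3"] show ?thesis
    by (simp add: cut1_def[abs_def] cut2_def eval_nat_numeral)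
qed

lemma continuous_on_cut [continuous_intros]:
  assumes "continuous_on S u"
  shows "continuous_on S (\<lambda>x. cut (u x))" "continuous_on S (\<lambda>x. cut1 (u x))" "continuous_on S (\<lambda>x. cut2 (u x))"
  unfolding cut_def cut1_def cut2_def using assms by (auto intro!: continuous_intros)

lemma cut_eq_0: "1 \<le> u \<Longrightarrow> cut u = 0" "1 \<le> u \<Longrightarrow> cut1 u = 0" "1 \<le> u \<Longrightarrow> cut2 u = 0"
  by (auto simp: cut_def cut1_def cut2_def max_def)

lemma cut_bounds:
  assumes "0 \<le> u"
  shows "\<bar>cut u\<bar> \<le> 1" "\<bar>cut1 u\<bar> \<le> 3" "\<bar>cut2 u\<bar> \<le> 6"
proof -
  have m: "0 \<le> max 0 (1 - u)" "max 0 (1 - u) \<le> 1" using assms by auto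
  show "\<bar>cut u\<bar> \<le> 1" unfolding cut_def using power_le_one[OF m, of 3] m by simp
  show "\<bar>cut1 u\<bar> \<le> 3" unfolding cut1_def using power_le_one[OF m, of 2] m by (simp add: abs_mult)
  show "\<bar>cut2 u\<bar> \<le> 6" unfolding cut2_def using m by (simp add: abs_mult)
qed

lemma cut_0 [simp]: "cut 0 = 1" by (simp add: cut_def)

text \<open>The argument of \<open>cut\<close> confines the wave to the ball of radius
  \<open>1 / sqrt \<rho>\<close>; letting \<rho> tend to 0 recovers the plain wave.\<close>

definition wave :: "real \<Rightarrow> real^'d \<Rightarrow> real \<Rightarrow> real \<Rightarrow> real^'d \<Rightarrow> real" where
  "wave A z \<theta> \<rho> x = A * cos (z \<bullet> x + \<theta>) * cut (\<rho> * (x \<bullet> x))"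

lemma line_derivatives:
  fixes x z :: "real^'d"
  shows "((\<lambda>s. z \<bullet> (x + s *\<^sub>R axis i 1)) has_real_derivative z $ i) (at 0)"
    and "((\<lambda>s. (x + s *\<^sub>R axis i 1) \<bullet> (x + s *\<^sub>R axis i 1)) has_real_derivative 2 * x $ i) (at 0)"
    and "((\<lambda>s. (x + s *\<^sub>R axis i 1) $ j) has_real_derivative (if i = j then 1 else 0)) (at 0)"
proof -
  have e1: "z \<bullet> (x + s *\<^sub>R axis i 1) = z \<bullet> x + s * z $ i" for s
    by (simp add: inner_add_right inner_axis)
  show "((\<lambda>s. z \<bullet> (x + s *\<^sub>R axis i 1)) has_real_derivative z $ i) (at 0)"
    unfolding e1 by (auto intro!: derivative_eq_intros)
  have e2: "(x + s *\<^sub>R axis i 1) \<bullet> (x + s *\<^sub>R axis i 1) = x \<bullet> x + 2 * s * x $ i + s\<^sup>2" for s :: real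
    by (simp add: inner_add_right inner_add_left inner_axis inner_axis' inner_axis_axis power2_eq_square algebra_simps)
  show "((\<lambda>s. (x + s *\<^sub>R axis i 1) \<bullet> (x + s *\<^sub>R axis i 1)) has_real_derivative 2 * x $ i) (at 0)"
    unfolding e2 by (auto intro!: derivative_eq_intros)
  have e3: "(x + s *\<^sub>R axis i 1) $ j = x $ j + s * (if i = j then 1 else 0)" for s
    by (auto simp: axis_def)
  show "((\<lambda>s. (x + s *\<^sub>R axis i 1) $ j) has_real_derivative (if i = j then 1 else 0)) (at 0)"
    unfolding e3 by (auto intro!: derivative_eq_intros)
qed

definition wave_d where
  "wave_d A z \<theta> \<rho> i x = A * (cos (z \<bullet> x + \<theta>) * (cut1 (\<rho> * (x \<bullet> x)) * (2 * \<rho> * x $ i))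
     - sin (z \<bullet> x + \<theta>) * z $ i * cut (\<rho> * (x \<bullet> x)))"

definition wave_dd where
  "wave_dd A z \<theta> \<rho> i j x = A * (
      cos (z \<bullet> x + \<theta>) * (cut2 (\<rho> * (x \<bullet> x)) * (4 * \<rho>\<^sup>2 * x $ i * x $ j) + cut1 (\<rho> * (x \<bullet> x)) * (2 * \<rho> * (if i = j then 1 else 0)))
    - sin (z \<bullet> x + \<theta>) * cut1 (\<rho> * (x \<bullet> x)) * (2 * \<rho>) * (z $ j * x $ i + z $ i * x $ j)
    - cos (z \<bullet> x + \<theta>) * cut (\<rho> * (x \<bullet> x)) * (z $ i * z $ j))"

lemma wave_line_derivative:
  "((\<lambda>s. wave A z \<theta> \<rho> (x + s *\<^sub>R axis i 1)) has_real_derivative wave_d A z \<theta> \<rho> i x) (at 0)"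
proof -
  have k: "((\<lambda>s. cut (\<rho> * ((x + s *\<^sub>R axis i 1) \<bullet> (x + s *\<^sub>R axis i 1)))) has_real_derivative cut1 (\<rho> * (x \<bullet> x)) * (\<rho> * (2 * x $ i))) (at 0)"
    using DERIV_chain2[OF cut_has_real_derivative DERIV_cmult[OF line_derivatives(2)]] by simp
  have c: "((\<lambda>s. cos (z \<bullet> (x + s *\<^sub>R axis i 1) + \<theta>)) has_real_derivative - sin (z \<bullet> x + \<theta>) * z $ i) (at 0)"
    by (rule derivative_eq_intros line_derivatives(1) refl)+ simp
  show ?thesis unfolding wave_def
    using DERIV_mult[OF DERIV_cmult[OF c, of A] k] by (rule DERIV_cong) (simp add: wave_d_def algebra_simps)
qed

lemma wave_d_line_derivative:
  "((\<lambda>s. wave_d A z \<theta> \<rho> i (x + s *\<^sub>R axis j 1)) has_real_derivative wave_dd A z \<theta> \<rho> i j x) (at 0)"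
proof -
  have k: "((\<lambda>s. cut (\<rho> * ((x + s *\<^sub>R axis j 1) \<bullet> (x + s *\<^sub>R axis j 1)))) has_real_derivative cut1 (\<rho> * (x \<bullet> x)) * (\<rho> * (2 * x $ j))) (at 0)"
    using DERIV_chain2[OF cut_has_real_derivative DERIV_cmult[OF line_derivatives(2)]] by simp
  have k1: "((\<lambda>s. cut1 (\<rho> * ((x + s *\<^sub>R axis j 1) \<bullet> (x + s *\<^sub>R axis j 1)))) has_real_derivative cut2 (\<rho> * (x \<bullet> x)) * (\<rho> * (2 * x $ j))) (at 0)"
    using DERIV_chain2[OF cut1_has_real_derivative DERIV_cmult[OF line_derivatives(2)]] by simp
  have c: "((\<lambda>s. cos (z \<bullet> (x + s *\<^sub>R axis j 1) + \<theta>)) has_real_derivative - sin (z \<bullet> x + \<theta>) * z $ j) (at 0)"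
    by (rule derivative_eq_intros line_derivatives(1) refl)+ simp
  have s: "((\<lambda>s. sin (z \<bullet> (x + s *\<^sub>R axis j 1) + \<theta>)) has_real_derivative cos (z \<bullet> x + \<theta>) * z $ j) (at 0)"
    by (rule derivative_eq_intros line_derivatives(1) refl)+ simp
  have l: "((\<lambda>s. 2 * \<rho> * (x + s *\<^sub>R axis j 1) $ i) has_real_derivative 2 * \<rho> * (if j = i then 1 else 0)) (at 0)"
    by (rule DERIV_cmult[OF line_derivatives(3)])
  have kl: "((\<lambda>s. cut1 (\<rho> * ((x + s *\<^sub>R axis j 1) \<bullet> (x + s *\<^sub>R axis j 1))) * (2 * \<rho> * (x + s *\<^sub>R axis j 1) $ i)) has_real_derivative
     cut2 (\<rho> * (x \<bullet> x)) * (4 * \<rho>\<^sup>2 * x $ i * x $ j) + cut1 (\<rho> * (x \<bullet> x)) * (2 * \<rho> * (if i = j then 1 else 0))) (at 0)"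
    by (rule DERIV_cong[OF DERIV_mult[OF k1 l]]) (simp add: algebra_simps power2_eq_square)
  show ?thesis unfolding wave_d_def
    by (rule DERIV_cong[OF DERIV_cmult[OF DERIV_diff[OF DERIV_mult[OF c kl] DERIV_mult[OF DERIV_mult[OF s DERIV_const] k]]]])
       (simp add: wave_dd_def algebra_simps)
qed

lemma pd_wave: "pd i (wave A z \<theta> \<rho>) = wave_d A z \<theta> \<rho> i"
  unfolding pd_def using DERIV_imp_deriv[OF wave_line_derivative] by (auto simp: fun_eq_iff)

lemma pd_wave_d: "pd j (wave_d A z \<theta> \<rho> i) = wave_dd A z \<theta> \<rho> i j"
  unfolding pd_def using DERIV_imp_deriv[OF wave_d_line_derivative] by (auto simp: fun_eq_iff)

lemma norm_le_of_cut_ne_0: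
  assumes "0 < \<rho>" "\<rho> * (x \<bullet> x) < 1"
  shows "norm x \<le> 1 / sqrt \<rho>"
proof -
  have "(norm x)\<^sup>2 \<le> 1 / \<rho>" using assms by (simp add: power2_norm_eq_inner field_simps)
  then have "norm x \<le> sqrt (1 / \<rho>)" by (simp add: real_le_rsqrt)
  then show ?thesis by (simp add: real_sqrt_divide)
qed

lemma C2c_wave:
  fixes z :: "real^'d"
  assumes "0 < \<rho>"
  shows "C2c (wave A z \<theta> \<rho>)"
proof -
  have "C2 (wave A z \<theta> \<rho>)"
    unfolding C2_def
  proof (intro conjI allI)
    show "continuous_on UNIV (wave A z \<theta> \<rho>)" unfolding wave_def by (intro continuous_intros)
    show "partially_differentiable (wave A z \<theta> \<rho>)"
      unfolding partially_differentiable_def using wave_line_derivative real_differentiable_def by blast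
    fix i
    show "continuous_on UNIV (pd i (wave A z \<theta> \<rho>))" unfolding pd_wave wave_d_def by (intro continuous_intros)
    show "partially_differentiable (pd i (wave A z \<theta> \<rho>))"
      unfolding pd_wave partially_differentiable_def using wave_d_line_derivative real_differentiable_def by blast
    fix j
    show "continuous_on UNIV (pd j (pd i (wave A z \<theta> \<rho>)))"
      unfolding pd_wave pd_wave_d wave_dd_def by (intro continuous_intros)
  qed
  moreover have "{x. wave A z \<theta> \<rho> x \<noteq> 0} \<subseteq> cball 0 (1 / sqrt \<rho>)"
  proof
    fix x assume "x \<in> {x. wave A z \<theta> \<rho> x \<noteq> 0}"
    then have "\<rho> * (x \<bullet> x) < 1" using cut_eq_0(1)[of "\<rho> * (x \<bullet> x)"] by (force simp: wave_def)
    then show "x \<in> cball 0 (1 / sqrt \<rho>)" using norm_le_of_cut_ne_0[OF assms] by simp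
  qed
  then have "compact (closure {x. wave A z \<theta> \<rho> x \<noteq> 0})"
    using bounded_subset[OF bounded_cball] by (simp add: compact_closure)
  ultimately show ?thesis by (simp add: C2c_def)
qed

text \<open>The terms containing \<open>cut\<close> itself are the generator applied to the plain
  wave; those with \<open>cut1\<close> or \<open>cut2\<close> are due to the truncation and carry at
  least one factor \<rho>.\<close>

lemma diff_gen_wave:
  fixes z :: "real^'d"
  shows "diff_gen b c r (wave A z \<theta> \<rho>) x
    = A * (cos (z \<bullet> x + \<theta>) * cut1 (\<rho> * (x \<bullet> x)) * (2 * \<rho>) * (b r x \<bullet> x) - sin (z \<bullet> x + \<theta>) * cut (\<rho> * (x \<bullet> x)) * (b r x \<bullet> z))
    + (A / 2) * (cos (z \<bullet> x + \<theta>) * (cut2 (\<rho> * (x \<bullet> x)) * (4 * \<rho>\<^sup>2) * (x \<bullet> (c r *v x)) + cut1 (\<rho> * (x \<bullet> x)) * (2 * \<rho>) * (\<Sum>i\<in>UNIV. c r $ i $ i))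
       - sin (z \<bullet> x + \<theta>) * cut1 (\<rho> * (x \<bullet> x)) * (2 * \<rho>) * (x \<bullet> (c r *v z) + z \<bullet> (c r *v x))
       - cos (z \<bullet> x + \<theta>) * cut (\<rho> * (x \<bullet> x)) * (z \<bullet> (c r *v z)))"
proof -
  define C where "C = cos (z \<bullet> x + \<theta>)"
  define S where "S = sin (z \<bullet> x + \<theta>)"
  define k where "k = cut (\<rho> * (x \<bullet> x))"
  define k1 where "k1 = cut1 (\<rho> * (x \<bullet> x))"
  define k2 where "k2 = cut2 (\<rho> * (x \<bullet> x))"
  have bil: "(\<Sum>i\<in>UNIV. \<Sum>j\<in>UNIV. c r $ i $ j * (u $ i * v $ j)) = u \<bullet> (c r *v v)" for u v :: "real^'d"
    by (simp add: inner_vec_def matrix_vector_mult_def sum_distrib_left mult_ac)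
  have tr: "(\<Sum>i\<in>UNIV. \<Sum>j\<in>UNIV. c r $ i $ j * (if i = j then 1 else 0)) = (\<Sum>i\<in>UNIV. c r $ i $ i)"
    by (simp add: if_distrib cong: if_cong)
  have 1: "(\<Sum>i\<in>UNIV. b r x $ i * wave_d A z \<theta> \<rho> i x) = A * (C * k1 * (2 * \<rho>) * (b r x \<bullet> x) - S * k * (b r x \<bullet> z))"
    unfolding wave_d_def C_def[symmetric] S_def[symmetric] k_def[symmetric] k1_def[symmetric]
    by (simp add: inner_vec_def sum_distrib_left right_diff_distrib sum_subtractf mult_ac)
  have "c r $ i $ j * wave_dd A z \<theta> \<rho> i j x =
      A * C * k2 * (4 * \<rho>\<^sup>2) * (c r $ i $ j * (x $ i * x $ j)) + A * C * k1 * (2 * \<rho>) * (c r $ i $ j * (if i = j then 1 else 0))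
      - A * S * k1 * (2 * \<rho>) * (c r $ i $ j * (x $ i * z $ j)) - A * S * k1 * (2 * \<rho>) * (c r $ i $ j * (z $ i * x $ j))
      - A * C * k * (c r $ i $ j * (z $ i * z $ j))" for i j
    unfolding wave_dd_def C_def[symmetric] S_def[symmetric] k_def[symmetric] k1_def[symmetric] k2_def[symmetric]
    by (simp add: algebra_simps)
  then have 2: "(\<Sum>i\<in>UNIV. \<Sum>j\<in>UNIV. c r $ i $ j * wave_dd A z \<theta> \<rho> i j x)
    = A * C * k2 * (4 * \<rho>\<^sup>2) * (x \<bullet> (c r *v x)) + A * C * k1 * (2 * \<rho>) * (\<Sum>i\<in>UNIV. c r $ i $ i)
      - A * S * k1 * (2 * \<rho>) * (x \<bullet> (c r *v z)) - A * S * k1 * (2 * \<rho>) * (z \<bullet> (c r *v x)) - A * C * k * (z \<bullet> (c r *v z))"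
    by (simp only: sum.distrib sum_subtractf sum_distrib_left[symmetric] bil tr)
  show ?thesis
    unfolding diff_gen_def pd_wave pd_wave_d 1 2 C_def[symmetric] S_def[symmetric] k_def[symmetric] k1_def[symmetric] k2_def[symmetric]
    by (simp add: algebra_simps)
qed

section \<open>Time-dependent test functions in the martingale problem\<close>

lemma bounded_of_compact_support:
  fixes u :: "real \<Rightarrow> real^'d \<Rightarrow> real"
  assumes c: "continuous_on ({0..T} \<times> UNIV) (\<lambda>(r, x). u r x)"
    and z: "\<And>r x. R < norm x \<Longrightarrow> u r x = 0"
  obtains C where "\<And>r x. r \<in> {0..T} \<Longrightarrow> \<bar>u r x\<bar> \<le> C"
proof -
  have "compact ((\<lambda>(r, x). u r x) ` ({0..T} \<times> cball 0 R))"
    by (intro compact_continuous_image continuous_on_subset[OF c] compact_Times) auto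
  from compact_imp_bounded[OF this, unfolded bounded_iff]
  obtain C where C: "\<And>y. y \<in> (\<lambda>(r, x). u r x) ` ({0..T} \<times> cball 0 R) \<Longrightarrow> norm y \<le> C"
    by blast
  have "\<bar>u r x\<bar> \<le> max C 0" if "r \<in> {0..T}" for r x
  proof (cases "norm x \<le> R")
    case True
    then have "(\<lambda>(r, x). u r x) (r, x) \<in> (\<lambda>(r, x). u r x) ` ({0..T} \<times> cball 0 R)"
      using that by (intro imageI) simp
    from C[OF this] show ?thesis by simp
  qed (use z in auto)
  then show thesis by (rule that)
qed

text \<open>The whole space is the event on which the martingale identity is integrated; it turns
  into constancy of the expectation.\<close>

lemma nat_filtration_top: "space M \<in> sets (nat_filtration M X s)"
  using sets.top[of "nat_filtration M X s"] by (simp add: nat_filtration_def space_measure_of_conv)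

lemma diffusion_expectation_derivative:
  fixes X :: "real \<Rightarrow> 'a \<Rightarrow> real^'d" and G Gt :: "real \<Rightarrow> real^'d \<Rightarrow> real"
  assumes M: "prob_space M" and X: "diffusion_sol M T b c X" and r: "r \<in> {0..T}"
    and G: "\<And>r. r \<in> {0..T} \<Longrightarrow> C2c (G r)" "\<And>r x. R < norm x \<Longrightarrow> G r x = 0"
    and Gt: "\<And>r x. r \<in> {0..T} \<Longrightarrow> ((\<lambda>r. G r x) has_real_derivative Gt r x) (at r within {0..T})"
      "continuous_on ({0..T} \<times> UNIV) (\<lambda>(r, x). Gt r x)" "\<And>r x. R < norm x \<Longrightarrow> Gt r x = 0"
    and L: "continuous_on ({0..T} \<times> UNIV) (\<lambda>(p, x). diff_gen b c p (G r) x)"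
      "\<And>p x. R < norm x \<Longrightarrow> diff_gen b c p (G r) x = 0"
  shows "((\<lambda>r. \<integral>\<omega>. G r (X r \<omega>) \<partial>M) has_real_derivative
     (\<integral>\<omega>. Gt r (X r \<omega>) + diff_gen b c r (G r) (X r \<omega>) \<partial>M)) (at r within {0..T})"
proof -
  interpret prob_space M by fact
  have Xm[measurable]: "X q \<in> borel_measurable M" if "q \<in> {0..T}" for q
    using X that unfolding diffusion_sol_def by blast
  have Xc: "continuous_on {0..T} (\<lambda>q. X q \<omega>)" if "\<omega> \<in> space M" for \<omega>
    using X that unfolding diffusion_sol_def by blast
  obtain C1 where C1: "\<And>r x. r \<in> {0..T} \<Longrightarrow> \<bar>Gt r x\<bar> \<le> C1"
    using bounded_of_compact_support[OF Gt(2,3)] by blast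
  obtain C2 where C2: "\<And>p x. p \<in> {0..T} \<Longrightarrow> \<bar>diff_gen b c p (G r) x\<bar> \<le> C2"
    using bounded_of_compact_support[OF L] by blast
  have Gc: "continuous_on UNIV (G q)" if "q \<in> {0..T}" for q
    using G(1)[OF that] by (simp add: C2c_def C2_def)
  have Gm: "G q \<in> borel_measurable borel" if "q \<in> {0..T}" for q
    by (rule borel_measurable_continuous_onI[OF Gc[OF that]])
  have Gi: "integrable M (\<lambda>\<omega>. G q (X p \<omega>))" if q: "q \<in> {0..T}" and p: "p \<in> {0..T}" for q p
  proof -
    \<comment> \<open>The degenerate time interval lets the space-time bound apply to a single
      function.\<close>
    have "continuous_on ({0..0} \<times> UNIV) (\<lambda>(r :: real, x). G q x)"
      unfolding case_prod_beta by (intro continuous_on_compose2[OF Gc[OF q]] continuous_intros) auto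
    from bounded_of_compact_support[OF this G(2)] obtain C where C: "\<And>r x. r \<in> {0..0::real} \<Longrightarrow> \<bar>G q x\<bar> \<le> C" by blast
    show ?thesis
    proof (rule integrable_const_bound[of _ C])
      show "AE \<omega> in M. norm (G q (X p \<omega>)) \<le> C" using C[of 0] by (intro AE_I2) simp
    qed (rule measurable_compose[OF Xm[OF p] Gm[OF q]])
  qed
  define \<Phi> where "\<Phi> q \<omega> = integral {0..q} (\<lambda>p. diff_gen b c p (G r) (X p \<omega>))" for q \<omega>
  have mart: "integrable M (\<lambda>\<omega>. G r (X q \<omega>) - G r (X 0 \<omega>) - \<Phi> q \<omega>)"
    "(\<integral>\<omega>. G r (X q \<omega>) - G r (X 0 \<omega>) - \<Phi> q \<omega> \<partial>M) = 0" if q: "q \<in> {0..T}" for q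
  proof -
    define Mf where "Mf q \<omega> = G r (X q \<omega>) - G r (X 0 \<omega>) - \<Phi> q \<omega>" for q \<omega>
    have "let Mf = (\<lambda>t \<omega>. G r (X t \<omega>) - G r (X 0 \<omega>) - integral {0..t} (\<lambda>p. diff_gen b c p (G r) (X p \<omega>))) in
         (\<forall>t\<in>{0..T}. integrable M (Mf t)) \<and>
         (\<forall>s t. 0 \<le> s \<and> s \<le> t \<and> t \<le> T \<longrightarrow>
            (\<forall>F\<in>sets (nat_filtration M X s). (\<integral>\<omega>\<in>F. Mf t \<omega> \<partial>M) = (\<integral>\<omega>\<in>F. Mf s \<omega> \<partial>M)))"
      using X G(1)[OF r] unfolding diffusion_sol_def by blast
    then have i: "\<And>t. t \<in> {0..T} \<Longrightarrow> integrable M (Mf t)"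
      and e: "\<And>s t F. 0 \<le> s \<Longrightarrow> s \<le> t \<Longrightarrow> t \<le> T \<Longrightarrow> F \<in> sets (nat_filtration M X s) \<Longrightarrow> (\<integral>\<omega>\<in>F. Mf t \<omega> \<partial>M) = (\<integral>\<omega>\<in>F. Mf s \<omega> \<partial>M)"
      unfolding Let_def Mf_def \<Phi>_def by auto
    show "integrable M (\<lambda>\<omega>. G r (X q \<omega>) - G r (X 0 \<omega>) - \<Phi> q \<omega>)"
      using i[OF q] by (simp add: Mf_def[abs_def])
    have "(\<integral>\<omega>\<in>space M. Mf q \<omega> \<partial>M) = (\<integral>\<omega>\<in>space M. Mf 0 \<omega> \<partial>M)"
      using q by (intro e nat_filtration_top) auto
    then have "(\<integral>\<omega>. Mf q \<omega> \<partial>M) = (\<integral>\<omega>. Mf 0 \<omega> \<partial>M)"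
      using set_integral_space[OF i[OF q]] set_integral_space[OF i[of 0]] q by simp
    also have "\<dots> = 0" by (simp add: Mf_def \<Phi>_def)
    finally show "(\<integral>\<omega>. G r (X q \<omega>) - G r (X 0 \<omega>) - \<Phi> q \<omega> \<partial>M) = 0" by (simp add: Mf_def)
  qed
  have \<Phi>i: "integrable M (\<Phi> q)" if q: "q \<in> {0..T}" for q
  proof -
    have "integrable M (\<lambda>\<omega>. G r (X q \<omega>) - G r (X 0 \<omega>) - (G r (X q \<omega>) - G r (X 0 \<omega>) - \<Phi> q \<omega>))"
      using q r by (intro Bochner_Integration.integrable_diff mart Gi) auto
    then show ?thesis by simp
  qed
  have E\<Phi>: "(\<integral>\<omega>. G r (X q \<omega>) \<partial>M) = (\<integral>\<omega>. G r (X 0 \<omega>) \<partial>M) + (\<integral>\<omega>. \<Phi> q \<omega> \<partial>M)" if q: "q \<in> {0..T}" for q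
    using mart(2)[OF q] Gi[OF r q] Gi[OF r, of 0] \<Phi>i[OF q] q by simp
  have \<Phi>': "((\<lambda>q. \<Phi> q \<omega>) has_real_derivative diff_gen b c q (G r) (X q \<omega>)) (at q within {0..T})"
    if "\<omega> \<in> space M" "q \<in> {0..T}" for \<omega> q
    unfolding \<Phi>_def
  proof (rule integral_has_real_derivative[OF _ that(2)])
    have "continuous_on {0..T} (\<lambda>p. (\<lambda>(p, x). diff_gen b c p (G r) x) (p, X p \<omega>))"
      by (rule continuous_on_compose2[OF L(1)]) (auto intro!: continuous_intros Xc that)
    then show "continuous_on {0..T} (\<lambda>p. diff_gen b c p (G r) (X p \<omega>))" by simp
  qed
  have C10: "0 \<le> C1" using C1[OF r, of 0] by linarith
  have C20: "0 \<le> C2" using C2[OF r, of 0] by linarith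
  \<comment> \<open>The interval may lie on either side of \<open>r\<close>; the bound on
    \<open>\<bar>p - r\<bar>\<close> later forces the intermediate times to converge to
    \<open>r\<close>.\<close>
  have mvt: "\<exists>p\<in>{0..T}. \<bar>p - r\<bar> \<le> \<bar>q - r\<bar> \<and> G q x - G r x = (q - r) * Gt p x" if q: "q \<in> {0..T}" for q x
  proof -
    have ex: "\<exists>p. l \<le> p \<and> p \<le> u \<and> G u x - G l x = (u - l) * Gt p x" if "l < u" "{l..u} \<subseteq> {0..T}" for l u
    proof -
      have "\<exists>p\<in>{l<..<u}. G u x - G l x = (\<lambda>v. v * Gt p x) (u - l)"
      proof (rule mvt_simple[OF that(1)])
        fix p assume "l \<le> p" "p \<le> u"
        then have "((\<lambda>r. G r x) has_real_derivative Gt p x) (at p within {l..u})"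
          using that by (intro DERIV_subset[OF Gt(1)]) auto
        then show "((\<lambda>a. G a x) has_derivative (\<lambda>v. v * Gt p x)) (at p within {l..u})"
          by (simp add: has_field_derivative_def mult_commute_abs)
      qed
      then obtain p where "p \<in> {l<..<u}" "G u x - G l x = (u - l) * Gt p x" by blast
      then show ?thesis by (intro exI[of _ p]) simp
    qed
    consider "q = r" | "r < q" | "q < r" by linarith
    then show ?thesis
    proof cases
      case 1 then show ?thesis using r by (intro bexI[of _ r]) auto
    next
      case 2
      then obtain p where "r \<le> p" "p \<le> q" "G q x - G r x = (q - r) * Gt p x" using ex[of r q] q r by auto
      then show ?thesis using q r by (intro bexI[of _ p]) auto
    next
      case 3
      then obtain p where "q \<le> p" "p \<le> r" "G r x - G q x = (r - q) * Gt p x" using ex[of q r] q r by auto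
      then show ?thesis using q r by (intro bexI[of _ p]) (auto simp: algebra_simps)
    qed
  qed
  have \<Phi>b: "\<bar>\<Phi> q \<omega> - \<Phi> r \<omega>\<bar> \<le> C2 * \<bar>q - r\<bar>" if "\<omega> \<in> space M" "q \<in> {0..T}" for \<omega> q
  proof -
    have "norm (\<Phi> q \<omega> - \<Phi> r \<omega>) \<le> C2 * norm (q - r)"
      by (rule field_differentiable_bound[of "{0..T}" "\<lambda>q. \<Phi> q \<omega>", OF _ \<Phi>'[OF that(1)]])
         (use C2 r that(2) in \<open>simp_all only: convex_real_interval real_norm_def\<close>)
    then show ?thesis by simp
  qed
  show ?thesis unfolding has_field_derivative_iff tendsto_at_iff_sequentially comp_def
  proof (intro allI impI)
    fix q :: "nat \<Rightarrow> real" assume "\<forall>i. q i \<in> {0..T} - {r}" and ql: "q \<longlonglongrightarrow> r"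
    then have q: "q n \<in> {0..T}" "q n \<noteq> r" for n by auto
    have fq: "filterlim q (at r within {0..T}) sequentially"
      using q ql by (auto simp: filterlim_at)
    \<comment> \<open>The first quotient compares \<open>G (q n)\<close> with \<open>G r\<close> at
      the same position \<open>X (q n) \<omega>\<close>; the second replaces the displacement of the
      process by the time integral of the generator, which has the same mean.\<close>
    have "(\<lambda>n. \<integral>\<omega>. (G (q n) (X (q n) \<omega>) - G r (X (q n) \<omega>)) / (q n - r) + (\<Phi> (q n) \<omega> - \<Phi> r \<omega>) / (q n - r) \<partial>M)
      \<longlonglongrightarrow> (\<integral>\<omega>. Gt r (X r \<omega>) + diff_gen b c r (G r) (X r \<omega>) \<partial>M)"
    proof (rule integral_dominated_convergence[where w="\<lambda>_. C1 + C2"])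
      have cr: "continuous_on UNIV (\<lambda>x. (\<lambda>(r, x). Gt r x) (r, x))" "continuous_on UNIV (\<lambda>x. (\<lambda>(p, x). diff_gen b c p (G r) x) (r, x))"
        by (intro continuous_on_compose2[OF Gt(2)] continuous_on_compose2[OF L(1)] continuous_intros; use r in auto)+
      show "(\<lambda>\<omega>. Gt r (X r \<omega>) + diff_gen b c r (G r) (X r \<omega>)) \<in> borel_measurable M"
        using measurable_compose[OF Xm[OF r] borel_measurable_continuous_onI[OF cr(1)]]
          measurable_compose[OF Xm[OF r] borel_measurable_continuous_onI[OF cr(2)]] by simp
      fix n
      have im: "integrable M (\<lambda>\<omega>. (G (q n) (X (q n) \<omega>) - G r (X (q n) \<omega>)) / (q n - r) + (\<Phi> (q n) \<omega> - \<Phi> r \<omega>) / (q n - r))"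
        by (simp add: Gi[OF q(1)[of n] q(1)[of n]] Gi[OF r q(1)[of n]] \<Phi>i[OF q(1)[of n]] \<Phi>i[OF r])
      then show "(\<lambda>\<omega>. (G (q n) (X (q n) \<omega>) - G r (X (q n) \<omega>)) / (q n - r) + (\<Phi> (q n) \<omega> - \<Phi> r \<omega>) / (q n - r)) \<in> borel_measurable M"
        by simp
      show "AE \<omega> in M. norm ((G (q n) (X (q n) \<omega>) - G r (X (q n) \<omega>)) / (q n - r) + (\<Phi> (q n) \<omega> - \<Phi> r \<omega>) / (q n - r)) \<le> C1 + C2"
      proof (rule AE_I2)
        fix \<omega> assume \<omega>: "\<omega> \<in> space M"
        obtain p where p: "p \<in> {0..T}" "G (q n) (X (q n) \<omega>) - G r (X (q n) \<omega>) = (q n - r) * Gt p (X (q n) \<omega>)"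
          using mvt[OF q(1)] by blast
        have "\<bar>(G (q n) (X (q n) \<omega>) - G r (X (q n) \<omega>)) / (q n - r)\<bar> \<le> C1"
          using p C1 q(2)[of n] by simp
        moreover have "\<bar>(\<Phi> (q n) \<omega> - \<Phi> r \<omega>) / (q n - r)\<bar> \<le> C2"
          using \<Phi>b[OF \<omega> q(1)[of n]] q(2)[of n] by (simp add: abs_div pos_divide_le_eq)
        ultimately show "norm ((G (q n) (X (q n) \<omega>) - G r (X (q n) \<omega>)) / (q n - r) + (\<Phi> (q n) \<omega> - \<Phi> r \<omega>) / (q n - r)) \<le> C1 + C2"
          unfolding real_norm_def by linarith
      qed
    next
      show "AE \<omega> in M. (\<lambda>n. (G (q n) (X (q n) \<omega>) - G r (X (q n) \<omega>)) / (q n - r) + (\<Phi> (q n) \<omega> - \<Phi> r \<omega>) / (q n - r))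
         \<longlonglongrightarrow> Gt r (X r \<omega>) + diff_gen b c r (G r) (X r \<omega>)"
      proof (rule AE_I2)
        fix \<omega> assume \<omega>: "\<omega> \<in> space M"
        \<comment> \<open>The intermediate time depends on the path and on \<open>n\<close>, so
          convergence rests on joint continuity of \<open>Gt\<close> and on continuity of the
          path.\<close>
        have "\<forall>n. \<exists>p. p \<in> {0..T} \<and> \<bar>p - r\<bar> \<le> \<bar>q n - r\<bar> \<and> G (q n) (X (q n) \<omega>) - G r (X (q n) \<omega>) = (q n - r) * Gt p (X (q n) \<omega>)"
          using mvt[OF q(1)] by blast
        from choice[OF this] obtain p where p: "\<And>n. p n \<in> {0..T}" "\<And>n. \<bar>p n - r\<bar> \<le> \<bar>q n - r\<bar>"
           "\<And>n. G (q n) (X (q n) \<omega>) - G r (X (q n) \<omega>) = (q n - r) * Gt (p n) (X (q n) \<omega>)"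
          by blast
        have pl: "p \<longlonglongrightarrow> r"
        proof -
          have "(\<lambda>n. p n - r) \<longlonglongrightarrow> 0"
            by (rule Lim_null_comparison[of _ "\<lambda>n. \<bar>q n - r\<bar>"]) (use p(2) ql in \<open>auto intro!: tendsto_eq_intros\<close>)
          then show ?thesis by (simp add: LIM_zero_iff)
        qed
        have Xl: "(\<lambda>n. X (q n) \<omega>) \<longlonglongrightarrow> X r \<omega>"
          using continuous_on_tendsto_compose[OF Xc[OF \<omega>] ql r] q by simp
        have "(\<lambda>n. (\<lambda>(r, x). Gt r x) (p n, X (q n) \<omega>)) \<longlonglongrightarrow> (\<lambda>(r, x). Gt r x) (r, X r \<omega>)"
          by (rule continuous_on_tendsto_compose[OF Gt(2) tendsto_Pair[OF pl Xl]]) (use r p in auto)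
        then have 1: "(\<lambda>n. (G (q n) (X (q n) \<omega>) - G r (X (q n) \<omega>)) / (q n - r)) \<longlonglongrightarrow> Gt r (X r \<omega>)"
          using q(2) by (simp add: p(3))
        have 2: "(\<lambda>n. (\<Phi> (q n) \<omega> - \<Phi> r \<omega>) / (q n - r)) \<longlonglongrightarrow> diff_gen b c r (G r) (X r \<omega>)"
          using filterlim_compose[OF \<Phi>'[OF \<omega> r, unfolded has_field_derivative_iff] fq] .
        show "(\<lambda>n. (G (q n) (X (q n) \<omega>) - G r (X (q n) \<omega>)) / (q n - r) + (\<Phi> (q n) \<omega> - \<Phi> r \<omega>) / (q n - r))
         \<longlonglongrightarrow> Gt r (X r \<omega>) + diff_gen b c r (G r) (X r \<omega>)"
          by (rule tendsto_add[OF 1 2])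
      qed
    qed simp
    moreover have "(\<integral>\<omega>. (G (q n) (X (q n) \<omega>) - G r (X (q n) \<omega>)) / (q n - r) + (\<Phi> (q n) \<omega> - \<Phi> r \<omega>) / (q n - r) \<partial>M)
       = ((\<integral>\<omega>. G (q n) (X (q n) \<omega>) \<partial>M) - (\<integral>\<omega>. G r (X r \<omega>) \<partial>M)) / (q n - r)" for n
    proof -
      note [simp] = Gi[OF q(1)[of n] q(1)[of n]] Gi[OF r q(1)[of n]] \<Phi>i[OF q(1)[of n]] \<Phi>i[OF r]
      have "(\<integral>\<omega>. (G (q n) (X (q n) \<omega>) - G r (X (q n) \<omega>)) / (q n - r) + (\<Phi> (q n) \<omega> - \<Phi> r \<omega>) / (q n - r) \<partial>M)
        = ((\<integral>\<omega>. G (q n) (X (q n) \<omega>) \<partial>M) - (\<integral>\<omega>. G r (X (q n) \<omega>) \<partial>M)) / (q n - r)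
          + ((\<integral>\<omega>. \<Phi> (q n) \<omega> \<partial>M) - (\<integral>\<omega>. \<Phi> r \<omega> \<partial>M)) / (q n - r)" by simp
      then show ?thesis unfolding E\<Phi>[OF q(1)[of n]] E\<Phi>[OF r] by (simp flip: add_divide_distrib)
    qed
    ultimately show "(\<lambda>n. ((\<integral>\<omega>. G (q n) (X (q n) \<omega>) \<partial>M) - (\<integral>\<omega>. G r (X r \<omega>) \<partial>M)) / (q n - r))
       \<longlonglongrightarrow> (\<integral>\<omega>. Gt r (X r \<omega>) + diff_gen b c r (G r) (X r \<omega>) \<partial>M)" by simp
  qed
qed

lemma continuous_on_interval_bounded:
  fixes u :: "real \<Rightarrow> 'b::real_normed_vector"
  assumes "continuous_on {0..T} u"
  obtains C where "0 \<le> C" "\<And>r. r \<in> {0..T} \<Longrightarrow> norm (u r) \<le> C"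
proof -
  have "bounded (u ` {0..T})"
    by (intro compact_imp_bounded compact_continuous_image assms) auto
  then obtain C where "\<And>r. r \<in> {0..T} \<Longrightarrow> norm (u r) \<le> C" unfolding bounded_iff by blast
  then show thesis using that[of "max C 0"] by (simp add: le_max_iff_disj)
qed

text \<open>The plane wave with frequency \<open>z r\<close> solving \<open>z' = - B z\<close> and with the right amplitude and phase
  solves the backward equation; only the cut-off terms survive.  As the linear part of the drift is
  cancelled by the motion of \<open>z\<close>, they are bounded uniformly in the cut-off radius.\<close>

lemma diffusion_char:
  fixes X :: "real \<Rightarrow> 'a \<Rightarrow> real^'d" and B S a atl :: "real^'d^'d" and h :: "real \<Rightarrow> real"
  assumes M: "prob_space M" and t: "t \<in> {0..T}"
    and B: "transpose B = B" and Bm: "B *v m = - g" and S: "B ** S + S ** B = - a"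
    and h: "continuous_on {0..T} h"
    and X: "diffusion_sol M T (\<lambda>r x. B *v x + g + h r *\<^sub>R gt) (\<lambda>r. a + h r *\<^sub>R atl) X"
    and X0: "gaussian_vec M (X 0) m S" and psd: "\<And>v. 0 \<le> v \<bullet> (S *v v)"
  shows "(\<integral>\<omega>. cos (\<xi> \<bullet> X t \<omega> + \<theta>) \<partial>M) = exp (- (\<xi> \<bullet> (S *v \<xi>)
        + integral {0..t} (\<lambda>r. h r * ((mexp ((t - r) *\<^sub>R B) *v \<xi>) \<bullet> (atl *v (mexp ((t - r) *\<^sub>R B) *v \<xi>))))) / 2)
      * cos (\<xi> \<bullet> m + integral {0..t} (\<lambda>r. h r * ((mexp ((t - r) *\<^sub>R B) *v \<xi>) \<bullet> gt)) + \<theta>)"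
proof -
  interpret prob_space M by fact
  have Xm: "X q \<in> borel_measurable M" if "q \<in> {0..T}" for q
    using X that unfolding diffusion_sol_def by blast
  define b where "b r x = B *v x + g + h r *\<^sub>R gt" for r x
  define c where "c r = a + h r *\<^sub>R atl" for r
  define z where "z r = mexp ((t - r) *\<^sub>R B) *v \<xi>" for r
  define I1 where "I1 r = integral {0..r} (\<lambda>p. h p * (z p \<bullet> gt))" for r
  define I2 where "I2 r = integral {0..r} (\<lambda>p. h p * (z p \<bullet> (atl *v z p)))" for r
  \<comment> \<open>Logarithm of the amplitude. Its derivative must be half of
    \<open>z r \<bullet> (c r *v z r)\<close> to balance the second-order part of the generator; the
    \<open>a\<close> part has the antiderivative given by the \<open>S\<close>-form, the
    \<open>h\<close> part is integrated by \<open>I2\<close>.\<close>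
  define q where "q r = (z r \<bullet> (S *v z r)) / 2 + I2 r / 2" for r
  define \<theta>0 where "\<theta>0 = \<theta> + \<xi> \<bullet> m + I1 t"
  \<comment> \<open>The phase compensates the constant part of the drift, using
    \<open>B *v m = - g\<close>. The offset \<theta>0 is fixed by requiring phase \<theta> and
    frequency \<xi> at the final time \<open>t\<close>.\<close>
  define \<phi> where "\<phi> r = \<theta>0 - z r \<bullet> m - I1 r" for r
  have symB: "(B *v u) \<bullet> v = u \<bullet> (B *v v)" for u v
    by (metis B dot_transpose_mult)
  have cz: "continuous_on Q z" for Q unfolding z_def by (intro continuous_intros)
  have z': "(z has_vector_derivative - (B *v z r)) (at r within Q)" for r Q
    unfolding z_def by (rule mexp_orbit_has_vector_derivative)
  have zlin: "((\<lambda>r. z r \<bullet> v) has_real_derivative - ((B *v z r) \<bullet> v)) (at r within Q)" for v r Q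
    using bounded_linear.has_vector_derivative[OF bounded_linear_inner_left z', of v r Q]
    by (simp add: has_real_derivative_iff_has_vector_derivative)
  have zS: "((\<lambda>r. z r \<bullet> (S *v z r)) has_real_derivative z r \<bullet> (a *v z r)) (at r within Q)" for r Q
    by (rule mexp_orbit_quadratic_derivative[OF B S z_def])
  have c1: "continuous_on {0..T} (\<lambda>p. h p * (z p \<bullet> gt))" "continuous_on {0..T} (\<lambda>p. h p * (z p \<bullet> (atl *v z p)))"
    by (intro continuous_intros h cz)+
  have I1': "(I1 has_real_derivative h r * (z r \<bullet> gt)) (at r within {0..T})" if "r \<in> {0..T}" for r
    unfolding I1_def by (rule integral_has_real_derivative[OF c1(1) that])
  have I2': "(I2 has_real_derivative h r * (z r \<bullet> (atl *v z r))) (at r within {0..T})" if "r \<in> {0..T}" for r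
    unfolding I2_def by (rule integral_has_real_derivative[OF c1(2) that])
  have q': "(q has_real_derivative (z r \<bullet> (c r *v z r)) / 2) (at r within {0..T})" if "r \<in> {0..T}" for r
    unfolding q_def c_def
    by (rule DERIV_cong[OF DERIV_add[OF DERIV_cdivide[OF zS] DERIV_cdivide[OF I2'[OF that]]]])
       (simp add: bounded_bilinear.scaleR_left[OF matrix_vector_bb] matrix_vector_mult_add_rdistrib inner_add_right add_divide_distrib)
  have \<phi>': "(\<phi> has_real_derivative - (z r \<bullet> g) - h r * (z r \<bullet> gt)) (at r within {0..T})" if "r \<in> {0..T}" for r
    unfolding \<phi>_def
    by (rule DERIV_cong[OF DERIV_diff[OF DERIV_diff[OF DERIV_const zlin] I1'[OF that]]])
       (simp add: symB Bm)
  have cq: "continuous_on {0..T} q" by (rule DERIV_continuous_on) (rule q')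
  have c\<phi>: "continuous_on {0..T} \<phi>" by (rule DERIV_continuous_on) (rule \<phi>')
  have cc: "continuous_on {0..T} c" unfolding c_def by (intro continuous_intros h)
  define G where "G \<rho> r x = wave (exp (q r)) (z r) (\<phi> r) \<rho> x" for \<rho> r x
  define Gt where "Gt \<rho> r x = exp (q r) * cut (\<rho> * (x \<bullet> x)) *
     ((z r \<bullet> (c r *v z r)) / 2 * cos (z r \<bullet> x + \<phi> r) + (b r x \<bullet> z r) * sin (z r \<bullet> x + \<phi> r))" for \<rho> r x
  \<comment> \<open>Exactly the terms of the generator with \<open>cut1\<close> or
    \<open>cut2\<close>; all terms with \<open>cut\<close> cancel against the time derivative
    \<open>Gt\<close>.\<close>
  define err where "err \<rho> r x = exp (q r) * cos (z r \<bullet> x + \<phi> r) * cut1 (\<rho> * (x \<bullet> x)) * (2 * \<rho>) * (b r x \<bullet> x)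
     + exp (q r) / 2 * (cos (z r \<bullet> x + \<phi> r) * (cut2 (\<rho> * (x \<bullet> x)) * (4 * \<rho>\<^sup>2) * (x \<bullet> (c r *v x))
            + cut1 (\<rho> * (x \<bullet> x)) * (2 * \<rho>) * (\<Sum>i\<in>UNIV. c r $ i $ i))
       - sin (z r \<bullet> x + \<phi> r) * cut1 (\<rho> * (x \<bullet> x)) * (2 * \<rho>) * (x \<bullet> (c r *v z r) + z r \<bullet> (c r *v x)))" for \<rho> r x
  have sum_err: "Gt \<rho> r x + diff_gen b c r (G \<rho> r) x = err \<rho> r x" for \<rho> r x
    unfolding G_def diff_gen_wave Gt_def err_def by (simp add: algebra_simps)
  have G': "((\<lambda>r. G \<rho> r x) has_real_derivative Gt \<rho> r x) (at r within {0..T})" if r: "r \<in> {0..T}" for \<rho> r x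
  proof -
    have e: "((\<lambda>r. exp (q r)) has_real_derivative exp (q r) * ((z r \<bullet> (c r *v z r)) / 2)) (at r within {0..T})"
      by (rule DERIV_chain2[OF DERIV_exp q'[OF r]])
    have "((\<lambda>r. z r \<bullet> x + \<phi> r) has_real_derivative - (b r x \<bullet> z r)) (at r within {0..T})"
      by (rule DERIV_cong[OF DERIV_add[OF zlin \<phi>'[OF r]]])
         (simp add: symB b_def inner_commute[of _ "z r"] inner_add_right)
    then have k: "((\<lambda>r. cos (z r \<bullet> x + \<phi> r)) has_real_derivative - sin (z r \<bullet> x + \<phi> r) * - (b r x \<bullet> z r)) (at r within {0..T})"
      by (rule DERIV_chain2[OF DERIV_cos])
    show ?thesis unfolding G_def wave_def Gt_def
      by (rule DERIV_cong[OF DERIV_cmult_right[OF DERIV_mult[OF e k]]]) (simp add: algebra_simps)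
  qed
  have cfst: "continuous_on ({0..T} \<times> (UNIV :: (real^'d) set)) (\<lambda>p. u (fst p))" if "continuous_on {0..T} u" for u :: "real \<Rightarrow> 'z::topological_space"
    by (rule continuous_on_compose2[OF that continuous_on_fst[OF continuous_on_id]]) auto
  note cint = cfst[OF cq] cfst[OF cz] cfst[OF c\<phi>] cfst[OF cc] cfst[OF h]
  have cGt: "continuous_on ({0..T} \<times> UNIV) (\<lambda>(r, x). Gt \<rho> r x)" for \<rho>
    unfolding case_prod_beta Gt_def b_def by (intro continuous_intros cint) auto
  have cL: "continuous_on ({0..T} \<times> UNIV) (\<lambda>(p, x). diff_gen b c p (G \<rho> r) x)" for \<rho> r
    unfolding case_prod_beta G_def diff_gen_wave b_def by (intro continuous_intros cint) auto
  have out: "1 \<le> \<rho> * (x \<bullet> x)" if "0 < \<rho>" "1 / sqrt \<rho> < norm x" for \<rho> and x :: "real^'d"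
    using norm_le_of_cut_ne_0[OF that(1), of x] that(2) by linarith
  have dH: "((\<lambda>r. \<integral>\<omega>. G \<rho> r (X r \<omega>) \<partial>M) has_real_derivative (\<integral>\<omega>. err \<rho> r (X r \<omega>) \<partial>M)) (at r within {0..T})"
    if \<rho>: "0 < \<rho>" and r: "r \<in> {0..T}" for \<rho> r
  proof -
    have "((\<lambda>r. \<integral>\<omega>. G \<rho> r (X r \<omega>) \<partial>M) has_real_derivative
      (\<integral>\<omega>. Gt \<rho> r (X r \<omega>) + diff_gen b c r (G \<rho> r) (X r \<omega>) \<partial>M)) (at r within {0..T})"
    proof (rule diffusion_expectation_derivative[OF M _ r, where R="1 / sqrt \<rho>"])
      show "diffusion_sol M T b c X" using X by (simp add: b_def[abs_def] c_def[abs_def])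
      show "C2c (G \<rho> r)" for r unfolding G_def[abs_def] by (rule C2c_wave[OF \<rho>])
      show "G \<rho> r x = 0" if "1 / sqrt \<rho> < norm x" for r x
        using cut_eq_0[OF out[OF \<rho> that]] by (simp add: G_def wave_def)
      show "Gt \<rho> r x = 0" if "1 / sqrt \<rho> < norm x" for r x
        using cut_eq_0[OF out[OF \<rho> that]] by (simp add: Gt_def)
      show "diff_gen b c p (G \<rho> r) x = 0" if "1 / sqrt \<rho> < norm x" for p x
        unfolding G_def diff_gen_wave using cut_eq_0[OF out[OF \<rho> that]] by simp
    qed (rule G' cGt cL; assumption)+
    then show ?thesis unfolding sum_err .
  qed
  obtain A0 where A0: "0 \<le> A0" "\<And>r. r \<in> {0..T} \<Longrightarrow> norm (exp (q r)) \<le> A0"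
    using continuous_on_interval_bounded[OF continuous_on_exp[OF cq]] by blast
  obtain Z0 where Z0: "0 \<le> Z0" "\<And>r. r \<in> {0..T} \<Longrightarrow> norm (z r) \<le> Z0"
    using continuous_on_interval_bounded[OF cz] by blast
  obtain C0 where C0: "0 \<le> C0" "\<And>r. r \<in> {0..T} \<Longrightarrow> norm (c r) \<le> C0"
    using continuous_on_interval_bounded[OF cc] by blast
  have "continuous_on {0..T} (\<lambda>r. g + h r *\<^sub>R gt)" by (intro continuous_intros h)
  from continuous_on_interval_bounded[OF this]
  obtain b0 where b0: "0 \<le> b0" "\<And>r. r \<in> {0..T} \<Longrightarrow> norm (g + h r *\<^sub>R gt) \<le> b0" by blast
  have "continuous_on {0..T} (\<lambda>r. \<Sum>i\<in>UNIV. c r $ i $ i)" by (intro continuous_intros cc)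
  from continuous_on_interval_bounded[OF this]
  obtain t0 where t0: "0 \<le> t0" "\<And>r. r \<in> {0..T} \<Longrightarrow> norm (\<Sum>i\<in>UNIV. c r $ i $ i) \<le> t0" by blast
  obtain K where K: "0 \<le> K" "\<And>(P :: real^'d^'d) v. norm (P *v v) \<le> norm P * norm v * K"
    using bounded_bilinear.nonneg_bounded[OF matrix_vector_bb] by blast
  define k0 where "k0 = C0 * K"
  have k0: "0 \<le> k0" using C0 K by (simp add: k0_def)
  have quad: "\<bar>u \<bullet> (c r *v v)\<bar> \<le> k0 * (norm u * norm v)" if "r \<in> {0..T}" for r u v
  proof -
    have "\<bar>u \<bullet> (c r *v v)\<bar> \<le> norm u * norm (c r *v v)" by (rule Cauchy_Schwarz_ineq2)
    also have "\<dots> \<le> norm u * (norm (c r) * norm v * K)" by (intro mult_left_mono K) simp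
    also have "\<dots> \<le> norm u * (C0 * norm v * K)" using C0(2)[OF that] K by (intro mult_left_mono mult_right_mono) auto
    finally show ?thesis by (simp add: k0_def mult_ac)
  qed
  define k1 where "k1 = norm B * K"
  have k1: "0 \<le> k1" using K by (simp add: k1_def)
  \<comment> \<open>The numbers 3 and 6 bound \<open>cut1\<close> and \<open>cut2\<close>, while 2
    and 4 come from the factors \<open>2 * \<rho>\<close> and \<open>4 * \<rho>\<^sup>2\<close>; the
    letters bound amplitude, drift, diffusion form, trace and frequency over
    \<open>[0, T]\<close>.\<close>
  define E0 where "E0 = A0 * (3 * 2 * (b0 + k1)) + A0 / 2 * ((6 * 4 * k0 + 3 * 2 * t0) + 3 * 2 * (2 * (k0 * Z0)))"
  have errb: "\<bar>err \<rho> r x\<bar> \<le> E0" if \<rho>: "0 < \<rho>" "\<rho> \<le> 1" and r: "r \<in> {0..T}" for \<rho> r x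
  proof (cases "1 \<le> \<rho> * (x \<bullet> x)")
    case True
    have "0 \<le> E0" unfolding E0_def using A0 b0 k0 k1 t0 Z0 by auto
    then show ?thesis using cut_eq_0[OF True] by (simp add: err_def)
  next
    case False
    \<comment> \<open>On the support of the cut-off, \<rho> times the squared norm of
      \<open>x\<close> is at most 1, and since \<open>\<rho> \<le> 1\<close> so is \<rho> times the
      norm. Each growing factor of the error is thus paired with enough powers of \<rho>.\<close>
    then have n2: "\<rho> * (norm x * norm x) \<le> 1" by (simp add: power2_eq_square[symmetric] power2_norm_eq_inner)
    have n1: "\<rho> * norm x \<le> 1"
    proof -
      have "(\<rho> * norm x)\<^sup>2 = \<rho> * (\<rho> * (norm x * norm x))" by (simp add: power2_eq_square)
      also have "\<dots> \<le> 1 * 1" using \<rho> n2 by (intro mult_mono) auto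
      finally have "(\<rho> * norm x)\<^sup>2 \<le> 1\<^sup>2" by simp
      then show ?thesis by (rule power2_le_imp_le) simp
    qed
    have u: "0 \<le> \<rho> * (x \<bullet> x)" using \<rho> by simp
    note cb = cut_bounds[OF u]
    have B1: "\<rho> * \<bar>b r x \<bullet> x\<bar> \<le> b0 + k1"
    proof -
      have "norm (b r x) \<le> k1 * norm x + b0"
        unfolding b_def add.assoc
        using norm_triangle_ineq[of "B *v x" "g + h r *\<^sub>R gt"] K(2)[of B x] b0(2)[OF r] by (simp add: k1_def mult_ac)
      then have "\<bar>b r x \<bullet> x\<bar> \<le> (k1 * norm x + b0) * norm x"
        by (intro order.trans[OF Cauchy_Schwarz_ineq2] mult_right_mono) auto
      then have "\<rho> * \<bar>b r x \<bullet> x\<bar> \<le> \<rho> * ((k1 * norm x + b0) * norm x)" using \<rho> by (intro mult_left_mono) auto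
      also have "\<dots> = b0 * (\<rho> * norm x) + k1 * (\<rho> * (norm x * norm x))" by (simp add: algebra_simps)
      also have "\<dots> \<le> b0 * 1 + k1 * 1" using n1 n2 b0 k1 by (intro add_mono mult_left_mono) auto
      finally show ?thesis by simp
    qed
    have B2: "\<rho>\<^sup>2 * \<bar>x \<bullet> (c r *v x)\<bar> \<le> k0"
    proof -
      have "\<rho>\<^sup>2 * \<bar>x \<bullet> (c r *v x)\<bar> \<le> \<rho>\<^sup>2 * (k0 * (norm x * norm x))" by (intro mult_left_mono quad[OF r]) simp
      also have "\<dots> = k0 * (\<rho> * (\<rho> * (norm x * norm x)))" by (simp add: power2_eq_square)
      also have "\<dots> \<le> k0 * (1 * 1)" using \<rho> n2 k0 by (intro mult_left_mono mult_mono) auto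
      finally show ?thesis by simp
    qed
    have B3: "\<rho> * \<bar>x \<bullet> (c r *v z r) + z r \<bullet> (c r *v x)\<bar> \<le> 2 * (k0 * Z0)"
    proof -
      have "\<bar>x \<bullet> (c r *v z r) + z r \<bullet> (c r *v x)\<bar> \<le> k0 * (norm x * norm (z r)) + k0 * (norm (z r) * norm x)"
        using quad[OF r, of x "z r"] quad[OF r, of "z r" x] by linarith
      then have "\<rho> * \<bar>x \<bullet> (c r *v z r) + z r \<bullet> (c r *v x)\<bar> \<le> \<rho> * (k0 * (norm x * norm (z r)) + k0 * (norm (z r) * norm x))"
        using \<rho> by (intro mult_left_mono) auto
      also have "\<dots> = 2 * (k0 * ((\<rho> * norm x) * norm (z r)))" by (simp add: algebra_simps)
      also have "\<dots> \<le> 2 * (k0 * (1 * Z0))" using n1 Z0(2)[OF r] k0 \<rho> by (intro mult_left_mono mult_mono) auto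
      finally show ?thesis by simp
    qed
    have B4: "\<rho> * \<bar>\<Sum>i\<in>UNIV. c r $ i $ i\<bar> \<le> t0"
    proof -
      have "\<rho> * \<bar>\<Sum>i\<in>UNIV. c r $ i $ i\<bar> \<le> 1 * t0" using \<rho> t0(2)[OF r] by (intro mult_mono) auto
      then show ?thesis by simp
    qed
    define C where "C = cos (z r \<bullet> x + \<phi> r)"
    define Sn where "Sn = sin (z r \<bullet> x + \<phi> r)"
    have CS: "\<bar>C\<bar> \<le> 1" "\<bar>Sn\<bar> \<le> 1" by (simp_all add: C_def Sn_def)
    have A: "\<bar>exp (q r)\<bar> \<le> A0" using A0(2)[OF r] by simp
    have T1: "\<bar>exp (q r) * C * cut1 (\<rho> * (x \<bullet> x)) * (2 * \<rho>) * (b r x \<bullet> x)\<bar> \<le> A0 * (3 * 2 * (b0 + k1))"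
    proof -
      have "\<bar>exp (q r)\<bar> * (\<bar>C\<bar> * (\<bar>cut1 (\<rho> * (x \<bullet> x))\<bar> * (2 * (\<rho> * \<bar>b r x \<bullet> x\<bar>)))) \<le> A0 * (1 * (3 * (2 * (b0 + k1))))"
        using \<rho> by (intro mult_mono A CS cb B1 order.refl A0(1)) auto
      then show ?thesis using \<rho> by (simp add: abs_mult mult_ac)
    qed
    have T2: "\<bar>C * (cut2 (\<rho> * (x \<bullet> x)) * (4 * \<rho>\<^sup>2) * (x \<bullet> (c r *v x)) + cut1 (\<rho> * (x \<bullet> x)) * (2 * \<rho>) * (\<Sum>i\<in>UNIV. c r $ i $ i))\<bar>
       \<le> 6 * 4 * k0 + 3 * 2 * t0"
    proof -
      have "\<bar>cut2 (\<rho> * (x \<bullet> x))\<bar> * (4 * (\<rho>\<^sup>2 * \<bar>x \<bullet> (c r *v x)\<bar>)) \<le> 6 * (4 * k0)"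
        by (intro mult_mono cb B2 order.refl) auto
      then have 1: "\<bar>cut2 (\<rho> * (x \<bullet> x)) * (4 * \<rho>\<^sup>2) * (x \<bullet> (c r *v x))\<bar> \<le> 6 * 4 * k0" by (simp add: abs_mult mult_ac)
      have "\<bar>cut1 (\<rho> * (x \<bullet> x))\<bar> * (2 * (\<rho> * \<bar>\<Sum>i\<in>UNIV. c r $ i $ i\<bar>)) \<le> 3 * (2 * t0)"
        using \<rho> by (intro mult_mono cb B4 order.refl) auto
      then have 2: "\<bar>cut1 (\<rho> * (x \<bullet> x)) * (2 * \<rho>) * (\<Sum>i\<in>UNIV. c r $ i $ i)\<bar> \<le> 3 * 2 * t0" using \<rho> by (simp add: abs_mult mult_ac)
      have "\<bar>C\<bar> * \<bar>cut2 (\<rho> * (x \<bullet> x)) * (4 * \<rho>\<^sup>2) * (x \<bullet> (c r *v x)) + cut1 (\<rho> * (x \<bullet> x)) * (2 * \<rho>) * (\<Sum>i\<in>UNIV. c r $ i $ i)\<bar>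
         \<le> 1 * (6 * 4 * k0 + 3 * 2 * t0)"
        by (intro mult_mono CS order.trans[OF abs_triangle_ineq] add_mono 1 2) auto
      then show ?thesis by (simp add: abs_mult)
    qed
    have T3: "\<bar>Sn * cut1 (\<rho> * (x \<bullet> x)) * (2 * \<rho>) * (x \<bullet> (c r *v z r) + z r \<bullet> (c r *v x))\<bar> \<le> 3 * 2 * (2 * (k0 * Z0))"
    proof -
      have "\<bar>Sn\<bar> * (\<bar>cut1 (\<rho> * (x \<bullet> x))\<bar> * (2 * (\<rho> * \<bar>x \<bullet> (c r *v z r) + z r \<bullet> (c r *v x)\<bar>))) \<le> 1 * (3 * (2 * (2 * (k0 * Z0))))"
        using \<rho> by (intro mult_mono CS cb B3 order.refl) auto
      then show ?thesis using \<rho> by (simp add: abs_mult mult_ac)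
    qed
    define U where "U = C * (cut2 (\<rho> * (x \<bullet> x)) * (4 * \<rho>\<^sup>2) * (x \<bullet> (c r *v x)) + cut1 (\<rho> * (x \<bullet> x)) * (2 * \<rho>) * (\<Sum>i\<in>UNIV. c r $ i $ i))"
    define V where "V = Sn * cut1 (\<rho> * (x \<bullet> x)) * (2 * \<rho>) * (x \<bullet> (c r *v z r) + z r \<bullet> (c r *v x))"
    have UV: "\<bar>U - V\<bar> \<le> (6 * 4 * k0 + 3 * 2 * t0) + 3 * 2 * (2 * (k0 * Z0))"
      using T2[folded U_def] T3[folded V_def] abs_triangle_ineq4[of U V] by linarith
    have "\<bar>exp (q r) / 2\<bar> * \<bar>U - V\<bar> \<le> A0 / 2 * ((6 * 4 * k0 + 3 * 2 * t0) + 3 * 2 * (2 * (k0 * Z0)))"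
      using A A0(1) by (intro mult_mono UV) auto
    then have "\<bar>exp (q r) / 2 * (U - V)\<bar> \<le> A0 / 2 * ((6 * 4 * k0 + 3 * 2 * t0) + 3 * 2 * (2 * (k0 * Z0)))"
      by (simp only: abs_mult)
    moreover have "err \<rho> r x = exp (q r) * C * cut1 (\<rho> * (x \<bullet> x)) * (2 * \<rho>) * (b r x \<bullet> x) + exp (q r) / 2 * (U - V)"
      by (simp add: err_def C_def Sn_def U_def V_def)
    ultimately show ?thesis unfolding E0_def using T1 by linarith
  qed
  define \<rho> where "\<rho> n = 1 / real (Suc n)" for n
  have \<rho>: "0 < \<rho> n" "\<rho> n \<le> 1" for n by (simp_all add: \<rho>_def)
  have \<rho>0: "\<rho> \<longlonglongrightarrow> 0" unfolding \<rho>_def using LIMSEQ_inverse_real_of_nat by (simp add: inverse_eq_divide)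
  have ccut: "isCont cut 0" "isCont cut1 0" "isCont cut2 0"
    using continuous_on_cut[OF continuous_on_id, of UNIV] by (simp_all add: continuous_on_eq_continuous_at)
  have u0: "(\<lambda>n. \<rho> n * (x \<bullet> x)) \<longlonglongrightarrow> 0" for x :: "real^'d"
    using tendsto_mult[OF \<rho>0 tendsto_const[of "x \<bullet> x"]] by simp
  have cut_lim: "(\<lambda>n. cut (\<rho> n * (x \<bullet> x))) \<longlonglongrightarrow> 1" "(\<lambda>n. cut1 (\<rho> n * (x \<bullet> x))) \<longlonglongrightarrow> cut1 0"
    "(\<lambda>n. cut2 (\<rho> n * (x \<bullet> x))) \<longlonglongrightarrow> cut2 0" for x :: "real^'d"
    using isCont_tendsto_compose[OF ccut(1) u0[of x]] isCont_tendsto_compose[OF ccut(2) u0[of x]]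
      isCont_tendsto_compose[OF ccut(3) u0[of x]] by simp_all
  \<comment> \<open>Pointwise convergence: at fixed \<open>x\<close> every term carries a factor
    \<rho>. The linear drift prevents this argument from being uniform in \<open>x\<close>, so the
    bound \<open>E0\<close> and dominated convergence take over.\<close>
  have err_lim: "(\<lambda>n. err (\<rho> n) r x) \<longlonglongrightarrow> 0" for r x
    unfolding err_def by (rule tendsto_eq_intros cut_lim \<rho>0 refl)+ simp
  have err_meas: "(\<lambda>\<omega>. err p r (X r \<omega>)) \<in> borel_measurable M" if "r \<in> {0..T}" for p r
  proof -
    have "continuous_on UNIV (err p r)" unfolding err_def b_def by (intro continuous_intros)
    from measurable_compose[OF Xm[OF that] borel_measurable_continuous_onI[OF this]] show ?thesis .
  qed
  define H where "H n r = (\<integral>\<omega>. G (\<rho> n) r (X r \<omega>) \<partial>M)" for n r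
  define D where "D n r = (\<integral>\<omega>. err (\<rho> n) r (X r \<omega>) \<partial>M)" for n r
  have T0: "{0..t} \<subseteq> {0..T}" "0 \<le> t" using t by auto
  have FTC: "(D n has_integral (H n t - H n 0)) {0..t}" for n
  proof (rule fundamental_theorem_of_calculus[OF T0(2)])
    fix r assume "r \<in> {0..t}"
    then have "r \<in> {0..T}" using T0 by blast
    from DERIV_subset[OF dH[OF \<rho>(1) this] T0(1)]
    show "(H n has_vector_derivative D n r) (at r within {0..t})"
      unfolding H_def[abs_def] D_def by (simp add: has_real_derivative_iff_has_vector_derivative)
  qed
  have Db: "norm (D n r) \<le> E0" if "r \<in> {0..t}" for n r
  proof -
    have r: "r \<in> {0..T}" using that T0 by blast
    have "\<bar>D n r\<bar> \<le> E0" unfolding D_def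
    proof (rule expectation_abs_le[OF M])
      show "integrable M (\<lambda>\<omega>. err (\<rho> n) r (X r \<omega>))"
        using errb[OF \<rho> r] err_meas[OF r] by (intro integrable_const_bound[of _ E0]) simp_all
      show "\<bar>err (\<rho> n) r (X r \<omega>)\<bar> \<le> E0" for \<omega> by (rule errb[OF \<rho> r])
    qed
    then show ?thesis by simp
  qed
  have Dl: "(\<lambda>n. D n r) \<longlonglongrightarrow> 0" if "r \<in> {0..t}" for r
  proof -
    have r: "r \<in> {0..T}" using that T0 by blast
    have "(\<lambda>n. D n r) \<longlonglongrightarrow> (\<integral>\<omega>. 0 \<partial>M)" unfolding D_def
      using errb[OF \<rho> r] err_meas[OF r] err_lim
      by (intro integral_dominated_convergence[where w="\<lambda>_. E0"]) simp_all
    then show ?thesis by simp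
  qed
  have "(\<lambda>n. integral {0..t} (D n)) \<longlonglongrightarrow> integral {0..t} (\<lambda>_. 0)"
    by (rule dominated_convergence(2)[where h="\<lambda>_. E0"]) (use FTC Db Dl in \<open>auto simp: integrable_on_def\<close>)
  then have "(\<lambda>n. H n t - H n 0) \<longlonglongrightarrow> 0"
    using integral_unique[OF FTC] by simp
  moreover have Hl: "(\<lambda>n. H n r) \<longlonglongrightarrow> (\<integral>\<omega>. exp (q r) * cos (z r \<bullet> X r \<omega> + \<phi> r) \<partial>M)" if r: "r \<in> {0..T}" for r
    unfolding H_def
  proof (rule integral_dominated_convergence[where w="\<lambda>_. exp (q r)"])
    note [measurable] = Xm[OF r]
    show "(\<lambda>\<omega>. exp (q r) * cos (z r \<bullet> X r \<omega> + \<phi> r)) \<in> borel_measurable M" by measurable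
    show "(\<lambda>\<omega>. G (\<rho> n) r (X r \<omega>)) \<in> borel_measurable M" for n
    proof -
      have "continuous_on UNIV (G (\<rho> n) r)" unfolding G_def wave_def by (intro continuous_intros)
      from measurable_compose[OF Xm[OF r] borel_measurable_continuous_onI[OF this]] show ?thesis .
    qed
    show "AE \<omega> in M. (\<lambda>n. G (\<rho> n) r (X r \<omega>)) \<longlonglongrightarrow> exp (q r) * cos (z r \<bullet> X r \<omega> + \<phi> r)"
    proof (rule AE_I2)
      fix \<omega>
      show "(\<lambda>n. G (\<rho> n) r (X r \<omega>)) \<longlonglongrightarrow> exp (q r) * cos (z r \<bullet> X r \<omega> + \<phi> r)"
        unfolding G_def wave_def by (rule tendsto_eq_intros cut_lim refl)+ simp
    qed
    show "AE \<omega> in M. norm (G (\<rho> n) r (X r \<omega>)) \<le> exp (q r)" for n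
    proof (rule AE_I2)
      fix \<omega>
      have "\<bar>cos (z r \<bullet> X r \<omega> + \<phi> r)\<bar> * \<bar>cut (\<rho> n * (X r \<omega> \<bullet> X r \<omega>))\<bar> \<le> 1 * 1"
        using \<rho>(1)[of n] by (intro mult_mono cut_bounds) auto
      then show "norm (G (\<rho> n) r (X r \<omega>)) \<le> exp (q r)" by (simp add: G_def wave_def abs_mult)
    qed
  qed simp
  have "(\<lambda>n. H n t - H n 0) \<longlonglongrightarrow> (\<integral>\<omega>. exp (q t) * cos (z t \<bullet> X t \<omega> + \<phi> t) \<partial>M) - (\<integral>\<omega>. exp (q 0) * cos (z 0 \<bullet> X 0 \<omega> + \<phi> 0) \<partial>M)"
    using t by (intro tendsto_diff Hl) auto
  ultimately have eq: "(\<integral>\<omega>. exp (q t) * cos (z t \<bullet> X t \<omega> + \<phi> t) \<partial>M) = (\<integral>\<omega>. exp (q 0) * cos (z 0 \<bullet> X 0 \<omega> + \<phi> 0) \<partial>M)"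
    using LIMSEQ_unique by fastforce
  \<comment> \<open>At time 0 the integrals \<open>I1\<close> and \<open>I2\<close> vanish, and the
    amplitude is the reciprocal of the Gaussian factor contributed by the initial law.\<close>
  also have "\<dots> = cos \<theta>0"
    unfolding integral_mult_right_zero gaussian_vec_char[OF M X0 psd]
    by (simp add: q_def \<phi>_def I1_def I2_def flip: exp_add mult.assoc)
  finally have "exp (q t) * (\<integral>\<omega>. cos (\<xi> \<bullet> X t \<omega> + \<theta>) \<partial>M) = cos \<theta>0"
    by (simp add: z_def \<phi>_def \<theta>0_def)
  moreover have "exp (- q t) * exp (q t) = 1" by (simp flip: exp_add)
  ultimately have "(\<integral>\<omega>. cos (\<xi> \<bullet> X t \<omega> + \<theta>) \<partial>M) = exp (- q t) * cos \<theta>0"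
    by (metis mult.assoc mult_1)
  moreover have "- q t = - (\<xi> \<bullet> (S *v \<xi>) + I2 t) / 2" by (simp add: q_def z_def add_divide_distrib)
  ultimately show ?thesis by (simp add: \<theta>0_def I1_def I2_def z_def add_ac)
qed

section \<open>Two-time law of the stationary process\<close>

lemma sum_integral_partition:
  fixes f :: "real \<Rightarrow> real"
  assumes "\<And>k. k < N \<Longrightarrow> p k \<le> p (Suc k)" "continuous_on {p 0..p N} f"
  shows "(\<Sum>k<N. integral {p k..p (Suc k)} f) = integral {p 0..p N} f"
  using assms
proof (induction N)
  case (Suc N)
  have m: "p 0 \<le> p N"
    \<comment> \<open>The order of the points is known only up to index \<open>N\<close>, so the
      sequence is frozen beyond it before monotonicity is invoked.\<close>
    using Suc.prems(1) by (intro lift_Suc_mono_le[of "\<lambda>k. p (min k N)" 0 N, simplified]) (auto simp: min_def not_less_eq_eq less_Suc_eq_le le_Suc_eq)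
  have l: "p N \<le> p (Suc N)" using Suc.prems(1) by simp
  have "(\<Sum>k<N. integral {p k..p (Suc k)} f) = integral {p 0..p N} f"
    using l by (intro Suc.IH Suc.prems continuous_on_subset[OF Suc.prems(2)]) auto
  moreover have "integral {p 0..p N} f + integral {p N..p (Suc N)} f = integral {p 0..p (Suc N)} f"
    using m l by (intro Henstock_Kurzweil_Integration.integral_combine integrable_continuous_real Suc.prems(2)) auto
  ultimately show ?case by simp
qed simp

text \<open>Summation by parts turns the left Riemann--Stieltjes sums of \<open>z\<close> against \<open>w\<close> into Riemann sums of
  \<open>z' \<bullet> w\<close>, so that \<open>w\<close> need not have bounded variation.\<close>

lemma stieltjes_sum_tendsto:
  fixes z z' w :: "real \<Rightarrow> 'v::euclidean_space"
  assumes ab: "a < b" and z: "\<And>r. (z has_vector_derivative z' r) (at r)" and z': "continuous_on UNIV z'"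
    and w: "continuous_on {a..b} w"
    and p: "\<And>n k. p n k = a + (b - a) * real k / real (Suc n)"
  shows "(\<lambda>n. \<Sum>k<Suc n. z (p n k) \<bullet> (w (p n (Suc k)) - w (p n k)))
     \<longlonglongrightarrow> z b \<bullet> w b - z a \<bullet> w a - integral {a..b} (\<lambda>r. z' r \<bullet> w r)"
proof -
  have p0: "p n 0 = a" and pN: "p n (Suc n) = b" for n
    by (simp_all add: p del: of_nat_Suc)
  have step: "p n (Suc k) - p n k = (b - a) / real (Suc n)" for n k
    by (simp add: p field_simps del: of_nat_Suc) (simp add: algebra_simps)
  have pm: "p n k \<le> p n (Suc k)" for n k
  proof -
    have "0 \<le> (b - a) / real (Suc n)" using ab by simp
    then show ?thesis using step[of n k] by linarith
  qed
  have inab: "{p n k..p n (Suc k)} \<subseteq> {a..b}" if "k < Suc n" for n k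
  proof -
    have "mono (p n)" using pm by (intro mono_iff_le_Suc[THEN iffD2]) auto
    then have "p n 0 \<le> p n k" "p n (Suc k) \<le> p n (Suc n)" using that monoD[of "p n" 0 k] monoD[of "p n" "Suc k" "Suc n"] by auto
    then show ?thesis by (auto simp: p0 pN)
  qed
  obtain Z where Z: "0 \<le> Z" "\<And>r. r \<in> {a..b} \<Longrightarrow> norm (z' r) \<le> Z"
  proof -
    have "bounded (z' ` {a..b})"
      by (intro compact_imp_bounded compact_continuous_image continuous_on_subset[OF z']) auto
    then obtain C where "\<And>r. r \<in> {a..b} \<Longrightarrow> norm (z' r) \<le> C" unfolding bounded_iff by blast
    then show thesis using that[of "max C 0"] by (simp add: le_max_iff_disj)
  qed
  \<comment> \<open>The error made by replacing \<open>w\<close> on each subinterval by its value at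
    the right end point; uniform continuity of \<open>w\<close> will make it small.\<close>
  define e where "e n = (\<Sum>k<Suc n. integral {p n k..p n (Suc k)} (\<lambda>r. z' r \<bullet> (w r - w (p n (Suc k)))))" for n
  have cw: "continuous_on {p n k..p n (Suc k)} w" if "k < Suc n" for n k
    by (rule continuous_on_subset[OF w inab[OF that]])
  have cz': "continuous_on Q z'" for Q by (rule continuous_on_subset[OF z']) simp
  have eq: "(\<Sum>k<Suc n. z (p n k) \<bullet> (w (p n (Suc k)) - w (p n k)))
     = z b \<bullet> w b - z a \<bullet> w a - integral {a..b} (\<lambda>r. z' r \<bullet> w r) + e n" for n
  proof -
    have i1: "integral {p n k..p n (Suc k)} (\<lambda>r. z' r \<bullet> w (p n (Suc k))) = (z (p n (Suc k)) - z (p n k)) \<bullet> w (p n (Suc k))" for k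
    proof (rule integral_unique)
      have "((\<lambda>r. z' r \<bullet> w (p n (Suc k))) has_integral z (p n (Suc k)) \<bullet> w (p n (Suc k)) - z (p n k) \<bullet> w (p n (Suc k))) {p n k..p n (Suc k)}"
        by (rule fundamental_theorem_of_calculus[OF pm])
           (rule has_vector_derivative_at_within, rule bounded_linear.has_vector_derivative[OF bounded_linear_inner_left z])
      then show "((\<lambda>r. z' r \<bullet> w (p n (Suc k))) has_integral (z (p n (Suc k)) - z (p n k)) \<bullet> w (p n (Suc k))) {p n k..p n (Suc k)}"
        by (simp add: inner_diff_left)
    qed
    have "e n = (\<Sum>k<Suc n. integral {p n k..p n (Suc k)} (\<lambda>r. z' r \<bullet> w r) - (z (p n (Suc k)) - z (p n k)) \<bullet> w (p n (Suc k)))"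
      unfolding e_def
    proof (rule sum.cong[OF refl])
      fix k assume k: "k \<in> {..<Suc n}"
      have "integral {p n k..p n (Suc k)} (\<lambda>r. z' r \<bullet> w r - z' r \<bullet> w (p n (Suc k)))
        = integral {p n k..p n (Suc k)} (\<lambda>r. z' r \<bullet> w r) - integral {p n k..p n (Suc k)} (\<lambda>r. z' r \<bullet> w (p n (Suc k)))"
        using k by (intro Henstock_Kurzweil_Integration.integral_diff integrable_continuous_real continuous_intros cz' cw) auto
      then show "integral {p n k..p n (Suc k)} (\<lambda>r. z' r \<bullet> (w r - w (p n (Suc k))))
        = integral {p n k..p n (Suc k)} (\<lambda>r. z' r \<bullet> w r) - (z (p n (Suc k)) - z (p n k)) \<bullet> w (p n (Suc k))"
        by (simp add: inner_diff_right i1)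
    qed
    also have "\<dots> = (\<Sum>k<Suc n. integral {p n k..p n (Suc k)} (\<lambda>r. z' r \<bullet> w r))
       - (\<Sum>k<Suc n. (z (p n (Suc k)) - z (p n k)) \<bullet> w (p n (Suc k)))" by (rule sum_subtractf)
    also have "(\<Sum>k<Suc n. integral {p n k..p n (Suc k)} (\<lambda>r. z' r \<bullet> w r)) = integral {a..b} (\<lambda>r. z' r \<bullet> w r)"
      using sum_integral_partition[of "Suc n" "p n" "\<lambda>r. z' r \<bullet> w r"] pm w cz'
      by (simp only: p0 pN) (auto intro!: continuous_intros)
    finally have e: "e n = integral {a..b} (\<lambda>r. z' r \<bullet> w r) - (\<Sum>k<Suc n. (z (p n (Suc k)) - z (p n k)) \<bullet> w (p n (Suc k)))" .
    have "(\<Sum>k<Suc n. z (p n k) \<bullet> (w (p n (Suc k)) - w (p n k)))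
      = (\<Sum>k<Suc n. (z (p n (Suc k)) \<bullet> w (p n (Suc k)) - z (p n k) \<bullet> w (p n k)) - (z (p n (Suc k)) - z (p n k)) \<bullet> w (p n (Suc k)))"
      by (intro sum.cong refl) (simp add: inner_diff_left inner_diff_right)
    also have "\<dots> = (\<Sum>k<Suc n. z (p n (Suc k)) \<bullet> w (p n (Suc k)) - z (p n k) \<bullet> w (p n k))
       - (\<Sum>k<Suc n. (z (p n (Suc k)) - z (p n k)) \<bullet> w (p n (Suc k)))" by (rule sum_subtractf)
    also have "(\<Sum>k<Suc n. z (p n (Suc k)) \<bullet> w (p n (Suc k)) - z (p n k) \<bullet> w (p n k)) = z b \<bullet> w b - z a \<bullet> w a"
      using sum_lessThan_telescope[of "\<lambda>k. z (p n k) \<bullet> w (p n k)" "Suc n"] by (simp only: p0 pN)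
    finally show ?thesis using e by linarith
  qed
  have "e \<longlonglongrightarrow> 0"
  proof (rule LIMSEQ_I)
    fix \<epsilon> :: real assume \<epsilon>: "0 < \<epsilon>"
    \<comment> \<open>Makes the total error at most half of \<epsilon>; \<open>Z + 1\<close> avoids
      division by zero when the bound \<open>Z\<close> on the derivative vanishes.\<close>
    define \<delta> where "\<delta> = \<epsilon> / ((Z + 1) * (b - a) * 2)"
    have \<delta>: "0 < \<delta>" using \<epsilon> Z ab by (simp add: \<delta>_def)
    have "uniformly_continuous_on {a..b} w" by (rule compact_uniformly_continuous[OF w]) simp
    then obtain d where d: "0 < d" "\<And>x y. x \<in> {a..b} \<Longrightarrow> y \<in> {a..b} \<Longrightarrow> dist y x < d \<Longrightarrow> dist (w y) (w x) < \<delta>"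
      unfolding uniformly_continuous_on_def using \<delta> by metis
    obtain N :: nat where N: "(b - a) / d < real N" using reals_Archimedean2 by blast
    have "norm (e n - 0) < \<epsilon>" if n: "N \<le> n" for n
    proof -
      have hd: "(b - a) / real (Suc n) < d"
      proof -
        have "(b - a) / d < real (Suc n)" using N n by simp
        then show ?thesis using d(1) by (simp add: field_simps del: of_nat_Suc)
      qed
      have "norm (e n) \<le> (\<Sum>k<Suc n. Z * \<delta> * ((b - a) / real (Suc n)))"
        unfolding e_def
      proof (rule order.trans[OF norm_sum sum_mono])
        fix k assume "k \<in> {..<Suc n}"
        then have k: "k < Suc n" by simp
        have "norm (integral {p n k..p n (Suc k)} (\<lambda>r. z' r \<bullet> (w r - w (p n (Suc k))))) \<le> Z * \<delta> * (p n (Suc k) - p n k)"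
        proof (rule integral_bound[OF pm])
          show "continuous_on {p n k..p n (Suc k)} (\<lambda>r. z' r \<bullet> (w r - w (p n (Suc k))))"
            by (intro continuous_intros cz' cw k)
          fix r assume r: "r \<in> {p n k..p n (Suc k)}"
          have "dist r (p n (Suc k)) < d" using r step[of n k] hd by (auto simp: dist_real_def)
          then have "norm (w r - w (p n (Suc k))) \<le> \<delta>"
            using d(2)[of "p n (Suc k)" r] inab[OF k] r pm[of n k] by (force simp: dist_norm less_imp_le)
          then show "norm (z' r \<bullet> (w r - w (p n (Suc k)))) \<le> Z * \<delta>"
            using Z r inab[OF k] unfolding real_norm_def
            by (intro order.trans[OF Cauchy_Schwarz_ineq2] mult_mono) auto
        qed
        then show "norm (integral {p n k..p n (Suc k)} (\<lambda>r. z' r \<bullet> (w r - w (p n (Suc k))))) \<le> Z * \<delta> * ((b - a) / real (Suc n))"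
          by (simp only: step)
      qed
      also have "\<dots> = Z * \<delta> * (b - a)" by (simp del: of_nat_Suc)
      also have "\<dots> \<le> (Z + 1) * \<delta> * (b - a)" using \<delta> ab by (intro mult_right_mono) auto
      also have "\<dots> = \<epsilon> / 2"
      proof -
        have "y * (\<epsilon> / (y * l * 2)) * l = \<epsilon> / 2" if "0 < y" "0 < l" for y l :: real
          using that by simp
        from this[of "Z + 1" "b - a"] show ?thesis using Z ab by (simp add: \<delta>_def)
      qed
      finally show ?thesis using \<epsilon> by simp
    qed
    then show "\<exists>no. \<forall>n\<ge>no. norm (e n - 0) < \<epsilon>" by blast
  qed
  from tendsto_add[OF tendsto_const this, of "z b \<bullet> w b - z a \<bullet> w a - integral {a..b} (\<lambda>r. z' r \<bullet> w r)"]
  show ?thesis unfolding eq by simp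
qed

text \<open>The path \<open>x\<close> need not be differentiable, but \<open>x - A w\<close> is,
  with derivative \<open>B x + g\<close>. Pairing it with \<open>z\<close>, where
  \<open>z' = - B z\<close> and \<open>B m = - g\<close>, cancels all drift terms, so the integral
  of \<open>z\<close> against \<open>A w\<close> is the increment of
  \<open>z \<bullet> (x - m)\<close>. This is variation of constants, path by path.\<close>

lemma ou_path_stieltjes:
  fixes B :: "real^'d^'d" and A :: "real^'n^'d" and x :: "real \<Rightarrow> real^'d" and w :: "real \<Rightarrow> real^'n"
  assumes B: "transpose B = B" and Bm: "B *v m = - g"
    and x: "continuous_on {0..} x" "\<And>t. 0 \<le> t \<Longrightarrow> x t = x 0 + integral {0..t} (\<lambda>r. B *v x r + g) + A *v w t"
    and w: "continuous_on {0..} w" and uv: "0 \<le> u" "u < v"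
    and z: "\<And>r. z r = mexp ((v - r) *\<^sub>R B) *v \<zeta>"
    and p: "\<And>n k. p n k = u + (v - u) * real k / real (Suc n)"
  shows "(\<lambda>n. \<Sum>k<Suc n. (transpose A *v z (p n k)) \<bullet> (w (p n (Suc k)) - w (p n k)))
     \<longlonglongrightarrow> \<zeta> \<bullet> (x v - m) - z u \<bullet> (x u - m)"
proof -
  have symB: "(B *v y) \<bullet> y' = y \<bullet> (B *v y')" for y y'
    by (metis B dot_transpose_mult)
  have z': "(z has_vector_derivative - (B *v z r)) (at r within Q)" for r Q
    using mexp_orbit_has_vector_derivative[of v B \<zeta> r Q] by (simp add: z[abs_def])
  have cz: "continuous_on Q z" for Q unfolding z by (intro continuous_intros)
  have cz': "continuous_on UNIV (\<lambda>r. - (B *v z r))" by (intro continuous_intros cz)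
  have sub: "{u..v} \<subseteq> {0..}" "{0..v} \<subseteq> {0..}" "{u..v} \<subseteq> {0..v}" using uv by auto
  have cw: "continuous_on {u..v} (\<lambda>r. A *v w r)"
    by (intro continuous_intros continuous_on_subset[OF w sub(1)])
  define V where "V r = x r - A *v w r" for r
  have V': "(V has_vector_derivative (B *v x r + g)) (at r within {u..v})" if r: "r \<in> {u..v}" for r
  proof -
    have "((\<lambda>r. integral {0..r} (\<lambda>r. B *v x r + g)) has_vector_derivative (B *v x r + g)) (at r within {0..v})"
      using r uv by (intro integral_has_vector_derivative continuous_intros continuous_on_subset[OF x(1) sub(2)]) auto
    then have "((\<lambda>r. x 0 + integral {0..r} (\<lambda>r. B *v x r + g)) has_vector_derivative (B *v x r + g)) (at r within {u..v})"
      using has_vector_derivative_within_subset[OF _ sub(3)] by (auto intro!: derivative_eq_intros)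
    then show ?thesis
    proof (rule has_vector_derivative_transform[OF r, rotated])
      fix q assume "q \<in> {u..v}"
      then have "0 \<le> q" using uv by simp
      from x(2)[OF this] show "V q = x 0 + integral {0..q} (\<lambda>r. B *v x r + g)" by (simp add: V_def)
    qed
  qed
  have d: "((\<lambda>r. z r \<bullet> (V r - m)) has_vector_derivative - (- (B *v z r) \<bullet> (A *v w r))) (at r within {u..v})" if r: "r \<in> {u..v}" for r
  proof -
    have "((\<lambda>r. V r - m) has_vector_derivative (B *v x r + g)) (at r within {u..v})"
      using has_vector_derivative_diff[OF V'[OF r] has_vector_derivative_const[of m]] by simp
    from bounded_bilinear.has_vector_derivative[OF bounded_bilinear_inner z'[of r "{u..v}"] this]
    have "((\<lambda>r. z r \<bullet> (V r - m)) has_vector_derivative z r \<bullet> (B *v x r + g) + - (B *v z r) \<bullet> (V r - m)) (at r within {u..v})" .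
    moreover have "z r \<bullet> (B *v x r + g) + - (B *v z r) \<bullet> (V r - m) = - (- (B *v z r) \<bullet> (A *v w r))"
      by (simp add: symB V_def matrix_vector_mult_diff_distrib Bm inner_diff_right inner_add_right)
    ultimately show ?thesis by simp
  qed
  have "((\<lambda>r. - (- (B *v z r) \<bullet> (A *v w r))) has_integral z v \<bullet> (V v - m) - z u \<bullet> (V u - m)) {u..v}"
    using uv by (intro fundamental_theorem_of_calculus d) auto
  from integral_unique[OF has_integral_neg[OF this]]
  have i: "integral {u..v} (\<lambda>r. - (B *v z r) \<bullet> (A *v w r)) = - (z v \<bullet> (V v - m) - z u \<bullet> (V u - m))"
    by (simp only: minus_minus)
  have "(\<lambda>n. \<Sum>k<Suc n. z (p n k) \<bullet> (A *v w (p n (Suc k)) - A *v w (p n k)))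
     \<longlonglongrightarrow> z v \<bullet> (A *v w v) - z u \<bullet> (A *v w u) - integral {u..v} (\<lambda>r. - (B *v z r) \<bullet> (A *v w r))"
    by (rule stieltjes_sum_tendsto[OF uv(2) z' cz' cw p])
  moreover have "z v \<bullet> (A *v w v) - z u \<bullet> (A *v w u) - integral {u..v} (\<lambda>r. - (B *v z r) \<bullet> (A *v w r)) = \<zeta> \<bullet> (x v - m) - z u \<bullet> (x u - m)"
    unfolding i by (simp add: V_def inner_diff_right z)
  moreover have "z q \<bullet> (A *v w q1 - A *v w q2) = (transpose A *v z q) \<bullet> (w q1 - w q2)" for q q1 q2
    using dot_transpose_mult[of "z q" A "w q1 - w q2"] by (simp only: matrix_vector_mult_diff_distrib)
  ultimately show ?thesis by simp
qed

text \<open>The Riemann sums are Stieltjes sums against the identity. The integral in their limit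
  has the antiderivative \<open>f r * r - z r \<bullet> (S *v z r)\<close>, since the
  \<open>S\<close>-form has derivative \<open>f\<close> along the orbit.\<close>

lemma variance_sum_tendsto:
  fixes B S a :: "real^'d^'d"
  assumes B: "transpose B = B" and S: "B ** S + S ** B = - a" and uv: "u < v"
    and z: "\<And>r. z r = mexp ((v - r) *\<^sub>R B) *v \<zeta>"
    and p: "\<And>n k. p n k = u + (v - u) * real k / real (Suc n)"
  shows "(\<lambda>n. \<Sum>k<Suc n. (p n (Suc k) - p n k) * (z (p n k) \<bullet> (a *v z (p n k))))
     \<longlonglongrightarrow> \<zeta> \<bullet> (S *v \<zeta>) - z u \<bullet> (S *v z u)"
proof -
  have z': "(z has_vector_derivative - (B *v z r)) (at r within Q)" for r Q
    using mexp_orbit_has_vector_derivative[of v B \<zeta> r Q] by (simp add: z[abs_def])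
  have cz: "continuous_on Q z" for Q unfolding z by (intro continuous_intros)
  define f where "f r = z r \<bullet> (a *v z r)" for r
  define f' where "f' r = z r \<bullet> (a *v (- (B *v z r))) + (- (B *v z r)) \<bullet> (a *v z r)" for r
  have f: "(f has_vector_derivative f' r) (at r)" for r
  proof -
    have "((\<lambda>r. a *v z r) has_vector_derivative a *v (- (B *v z r))) (at r)"
      by (rule bounded_linear.has_vector_derivative[OF bounded_bilinear.bounded_linear_right[OF matrix_vector_bb] z'])
    from bounded_bilinear.has_vector_derivative[OF bounded_bilinear_inner z' this]
    show ?thesis by (simp add: f_def[abs_def] f'_def)
  qed
  have cf': "continuous_on UNIV f'" unfolding f'_def by (intro continuous_intros cz)
  have "(\<lambda>n. \<Sum>k<Suc n. f (p n k) \<bullet> (p n (Suc k) - p n k)) \<longlonglongrightarrow> f v \<bullet> v - f u \<bullet> u - integral {u..v} (\<lambda>r. f' r \<bullet> r)"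
    by (rule stieltjes_sum_tendsto[OF uv f cf' continuous_on_id p])
  moreover have "integral {u..v} (\<lambda>r. f' r \<bullet> r) = (f v * v - z v \<bullet> (S *v z v)) - (f u * u - z u \<bullet> (S *v z u))"
  proof (rule integral_unique)
    have "((\<lambda>r. f r * r - z r \<bullet> (S *v z r)) has_real_derivative f' r * r) (at r within {u..v})" for r
    proof -
      have "(f has_real_derivative f' r) (at r within {u..v})"
        using f[of r] by (simp add: has_real_derivative_iff_has_vector_derivative has_vector_derivative_at_within)
      from DERIV_diff[OF DERIV_mult[OF this DERIV_ident] mexp_orbit_quadratic_derivative[OF B S z]]
      show ?thesis by (simp add: f_def)
    qed
    then show "((\<lambda>r. f' r \<bullet> r) has_integral (f v * v - z v \<bullet> (S *v z v)) - (f u * u - z u \<bullet> (S *v z u))) {u..v}"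
      using uv by (intro fundamental_theorem_of_calculus) (auto simp: has_real_derivative_iff_has_vector_derivative)
  qed
  ultimately show ?thesis by (simp add: f_def z mult.commute)
qed

section \<open>Finite sums of Brownian increments\<close>

text \<open>The complex form is wanted because independence factorises products of exponentials, not
  of cosines. The imaginary part is the real formula with the phase shifted by
  \<open>pi / 2\<close>.\<close>

lemma gaussian_vec_cis:
  fixes Z :: "'a \<Rightarrow> real^'d"
  assumes M: "prob_space M" and Z: "gaussian_vec M Z \<mu> C" and nn: "0 \<le> \<xi> \<bullet> (C *v \<xi>)"
  shows "(\<integral>\<omega>. cis (\<xi> \<bullet> (Z \<omega> - \<mu>)) \<partial>M) = complex_of_real (exp (- (\<xi> \<bullet> (C *v \<xi>)) / 2))"
proof -
  interpret prob_space M by fact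
  have [measurable]: "Z \<in> borel_measurable M" using Z by (simp add: gaussian_vec_def)
  have cis: "cis \<in> borel_measurable borel"
    by (intro borel_measurable_continuous_onI) (simp add: cis_conv_exp continuous_intros)
  have i: "integrable M (\<lambda>\<omega>. cis (\<xi> \<bullet> (Z \<omega> - \<mu>)))"
    by (rule integrable_const_bound[of _ 1]) (auto intro!: measurable_compose[OF _ cis])
  have re: "(\<integral>\<omega>. cos (\<xi> \<bullet> Z \<omega> + \<theta>) \<partial>M) = exp (- (\<xi> \<bullet> (C *v \<xi>)) / 2) * cos (\<xi> \<bullet> \<mu> + \<theta>)" for \<theta>
    by (rule gaussian_vec_char[OF M Z nn])
  show ?thesis
  proof (rule complex_eqI)
    show "Re (\<integral>\<omega>. cis (\<xi> \<bullet> (Z \<omega> - \<mu>)) \<partial>M) = Re (complex_of_real (exp (- (\<xi> \<bullet> (C *v \<xi>)) / 2)))"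
      using integral_Re[OF i] re[of "- (\<xi> \<bullet> \<mu>)"] by (simp add: inner_diff_right)
    show "Im (\<integral>\<omega>. cis (\<xi> \<bullet> (Z \<omega> - \<mu>)) \<partial>M) = Im (complex_of_real (exp (- (\<xi> \<bullet> (C *v \<xi>)) / 2)))"
    proof -
      have "sin (\<xi> \<bullet> (Z \<omega> - \<mu>)) = cos (\<xi> \<bullet> Z \<omega> + (- (\<xi> \<bullet> \<mu>) - pi / 2))" for \<omega>
        using cos_diff[of "\<xi> \<bullet> (Z \<omega> - \<mu>)" "pi / 2"] by (simp add: inner_diff_right add_diff_eq)
      then show ?thesis
        using integral_Im[OF i] re[of "- (\<xi> \<bullet> \<mu>) - pi / 2"] by simp
    qed
  qed
qed

lemma cis_sum: "finite I \<Longrightarrow> (\<Prod>i\<in>I. cis (f i)) = cis (\<Sum>i\<in>I. f i)"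
  by (induction I rule: finite_induct) (auto simp: cis_mult)

text \<open>The initial value and the increments are jointly independent, so the exponential of the
  sum is a product of independent factors, each with a known Gaussian mean value.\<close>

lemma brownian_sum_char:
  fixes X0 :: "'a \<Rightarrow> real^'d" and W :: "real \<Rightarrow> 'a \<Rightarrow> real^'n" and c :: "nat \<Rightarrow> real^'n"
  assumes M: "prob_space M" and X0: "gaussian_vec M X0 m S" and psd: "\<And>v. 0 \<le> v \<bullet> (S *v v)"
    and W: "brownian_indep M X0 W" and \<tau>: "\<tau> 0 = 0" "\<And>i. i < K \<Longrightarrow> \<tau> i < \<tau> (Suc i)"
  shows "(\<integral>\<omega>. cos (v \<bullet> (X0 \<omega> - m) + (\<Sum>i<K. c i \<bullet> (W (\<tau> (Suc i)) \<omega> - W (\<tau> i) \<omega>)) + \<theta>) \<partial>M)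
     = exp (- (v \<bullet> (S *v v) + (\<Sum>i<K. (\<tau> (Suc i) - \<tau> i) * (c i \<bullet> c i))) / 2) * cos \<theta>"
proof -
  interpret prob_space M by fact
  \<comment> \<open>As in \<open>brownian_indep\<close>, index 0 carries the initial value and index
    \<open>i + 1\<close> the increment from \<open>\<tau> i\<close> to
    \<open>\<tau> (i + 1)\<close>; hence the coefficient \<open>c (i - 1)\<close>.\<close>
  define f :: "nat \<Rightarrow> (real^'d) \<times> (real^'n) \<Rightarrow> complex" where
    "f i = (\<lambda>(x, w). if i = 0 then cis (v \<bullet> (x - m)) else cis (c (i - 1) \<bullet> w))" for i
  define Z where "Z i \<omega> = (if i = 0 then (X0 \<omega>, 0) else (0, W (\<tau> i) \<omega> - W (\<tau> (i - 1)) \<omega>))" for i \<omega>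
  have ind: "indep_vars (\<lambda>_. borel) Z {0..K}"
    using W \<tau> unfolding brownian_indep_def Z_def[abs_def] by blast
  have fm: "f i \<in> borel_measurable borel" for i
    unfolding f_def case_prod_beta
    by (rule borel_measurable_continuous_onI, cases "i = 0"; simp add: cis_conv_exp; intro continuous_intros)
  have ind': "indep_vars (\<lambda>_. borel) (\<lambda>i \<omega>. f i (Z i \<omega>)) {0..K}"
    by (rule indep_vars_compose2[OF ind fm])
  have fZ: "f 0 (Z 0 \<omega>) = cis (v \<bullet> (X0 \<omega> - m))" "f (Suc i) (Z (Suc i) \<omega>) = cis (c i \<bullet> (W (\<tau> (Suc i)) \<omega> - W (\<tau> i) \<omega>))" for i \<omega>
    by (simp_all add: f_def Z_def)
  have rv: "(\<lambda>\<omega>. f i (Z i \<omega>)) \<in> borel_measurable M" if "i \<in> {0..K}" for i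
    using ind' that unfolding indep_vars_def by blast
  have nf: "norm (f i y) \<le> 1" for i y by (cases y) (simp add: f_def)
  have int: "integrable M (\<lambda>\<omega>. f i (Z i \<omega>))" if "i \<in> {0..K}" for i
    by (rule integrable_const_bound[of _ 1]) (use nf rv[OF that] in auto)
  have split: "(\<Prod>i\<in>{0..K}. h i) = h 0 * (\<Prod>i<K. h (Suc i))" for h :: "nat \<Rightarrow> complex"
    by (induction K) (simp_all add: mult.assoc)
  have E0: "(\<integral>\<omega>. f 0 (Z 0 \<omega>) \<partial>M) = complex_of_real (exp (- (v \<bullet> (S *v v)) / 2))"
    unfolding fZ by (rule gaussian_vec_cis[OF M X0 psd])
  have Ei: "(\<integral>\<omega>. f (Suc i) (Z (Suc i) \<omega>) \<partial>M) = complex_of_real (exp (- ((\<tau> (Suc i) - \<tau> i) * (c i \<bullet> c i)) / 2))" if i: "i < K" for i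
  proof -
    have "0 \<le> \<tau> i"
    proof -
      have "\<tau> 0 \<le> \<tau> j" if "j \<le> K" for j using that
      proof (induction j)
        case (Suc j)
        then show ?case using \<tau>(2)[of j] by simp
      qed simp
      then show ?thesis using i \<tau>(1) by simp
    qed
    then have g: "gaussian_vec M (\<lambda>\<omega>. W (\<tau> (Suc i)) \<omega> - W (\<tau> i) \<omega>) 0 ((\<tau> (Suc i) - \<tau> i) *\<^sub>R mat 1)"
      using W \<tau>(2)[OF i] unfolding brownian_indep_def by blast
    have q: "c i \<bullet> (((\<tau> (Suc i) - \<tau> i) *\<^sub>R mat 1) *v c i) = (\<tau> (Suc i) - \<tau> i) * (c i \<bullet> c i)"
      by (simp add: bounded_bilinear.scaleR_left[OF matrix_vector_bb])
    have "0 \<le> (\<tau> (Suc i) - \<tau> i) * (c i \<bullet> c i)" using \<tau>(2)[OF i] by simp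
    then show ?thesis unfolding fZ using gaussian_vec_cis[OF M g, of "c i"] unfolding q by simp
  qed
  have "(\<integral>\<omega>. (\<Prod>i\<in>{0..K}. f i (Z i \<omega>)) \<partial>M) = (\<Prod>i\<in>{0..K}. \<integral>\<omega>. f i (Z i \<omega>) \<partial>M)"
    by (rule indep_vars_lebesgue_integral[OF _ ind' int]) simp
  also have "\<dots> = complex_of_real (exp (- (v \<bullet> (S *v v)) / 2)) * (\<Prod>i<K. complex_of_real (exp (- ((\<tau> (Suc i) - \<tau> i) * (c i \<bullet> c i)) / 2)))"
    unfolding split E0 by (simp add: Ei)
  also have "\<dots> = complex_of_real (exp (- (v \<bullet> (S *v v)) / 2) * (\<Prod>i<K. exp (- ((\<tau> (Suc i) - \<tau> i) * (c i \<bullet> c i)) / 2)))"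
    by simp
  also have "(\<Prod>i<K. exp (- ((\<tau> (Suc i) - \<tau> i) * (c i \<bullet> c i)) / 2)) = exp (\<Sum>i<K. - ((\<tau> (Suc i) - \<tau> i) * (c i \<bullet> c i)) / 2)"
    by (simp add: exp_sum)
  also have "exp (- (v \<bullet> (S *v v)) / 2) * \<dots> = exp (- (v \<bullet> (S *v v) + (\<Sum>i<K. (\<tau> (Suc i) - \<tau> i) * (c i \<bullet> c i))) / 2)"
    by (simp add: sum_divide_distrib[symmetric] sum_negf add_divide_distrib diff_divide_distrib flip: exp_add)
  finally have E: "(\<integral>\<omega>. (\<Prod>i\<in>{0..K}. f i (Z i \<omega>)) \<partial>M) = complex_of_real (exp (- (v \<bullet> (S *v v) + (\<Sum>i<K. (\<tau> (Suc i) - \<tau> i) * (c i \<bullet> c i))) / 2))" .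
  have P: "(\<Prod>i\<in>{0..K}. f i (Z i \<omega>)) = cis (v \<bullet> (X0 \<omega> - m) + (\<Sum>i<K. c i \<bullet> (W (\<tau> (Suc i)) \<omega> - W (\<tau> i) \<omega>)))" for \<omega>
    unfolding split fZ by (simp add: cis_sum cis_mult)
  have iP: "integrable M (\<lambda>\<omega>. (\<Prod>i\<in>{0..K}. f i (Z i \<omega>)))"
    by (rule indep_vars_integrable[OF _ ind' int]) simp
  have "(\<integral>\<omega>. cos (v \<bullet> (X0 \<omega> - m) + (\<Sum>i<K. c i \<bullet> (W (\<tau> (Suc i)) \<omega> - W (\<tau> i) \<omega>)) + \<theta>) \<partial>M)
    = (\<integral>\<omega>. Re (cis \<theta> * (\<Prod>i\<in>{0..K}. f i (Z i \<omega>))) \<partial>M)"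
    unfolding P cis_mult by (simp add: add_ac)
  also have "\<dots> = Re (\<integral>\<omega>. cis \<theta> * (\<Prod>i\<in>{0..K}. f i (Z i \<omega>)) \<partial>M)"
    using iP by (intro integral_Re) simp
  also have "\<dots> = Re (cis \<theta> * (\<integral>\<omega>. (\<Prod>i\<in>{0..K}. f i (Z i \<omega>)) \<partial>M))" by simp
  finally show ?thesis unfolding E by (simp add: mult.commute)
qed

lemma sum_lessThan_add: "(\<Sum>i<M + N. f i) = (\<Sum>i<M. f i) + (\<Sum>i<N. f (M + i :: nat) :: real)"
  by (induction N) auto

text \<open>On \<open>[s, t]\<close> the orbit ending at \<xi> expresses \<open>X t\<close> through
  \<open>X s\<close> and the noise; it leaves the frequency \<open>E *v \<xi>\<close> at time
  \<open>s\<close>, which joins \<eta>. An orbit on \<open>[0, s]\<close> with end value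
  \<open>\<zeta> = E *v \<xi> + \<eta>\<close> then reaches back to \<open>X 0\<close>. The
  approximating sums have known characteristic functions, and bounded convergence passes to the
  limit.\<close>

lemma ou_joint_char:
  fixes B S :: "real^'d^'d" and A :: "real^'n^'d" and X :: "real \<Rightarrow> 'a \<Rightarrow> real^'d"
  assumes M: "prob_space M" and B: "transpose B = B" and Bm: "B *v m = - g"
    and S: "B ** S + S ** B = - (A ** transpose A)" and psd: "\<And>v. 0 \<le> v \<bullet> (S *v v)"
    and X0: "gaussian_vec M (X 0) m S" and W: "brownian_indep M (X 0) W" and X: "ou_sde_sol M B g A W X"
    and st: "0 < s" "s < t"
  defines "E \<equiv> mexp ((t - s) *\<^sub>R B)"
  shows "(\<integral>\<omega>. cos (\<xi> \<bullet> (X t \<omega> - m) + \<eta> \<bullet> (X s \<omega> - m) + \<theta>) \<partial>M)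
     = exp (- ((E *v \<xi> + \<eta>) \<bullet> (S *v (E *v \<xi> + \<eta>)) + \<xi> \<bullet> (S *v \<xi>) - (E *v \<xi>) \<bullet> (S *v (E *v \<xi>))) / 2) * cos \<theta>"
proof -
  interpret prob_space M by fact
  have Xm[measurable]: "X r \<in> borel_measurable M" if "0 \<le> r" for r
    using X that unfolding ou_sde_sol_def by blast
  have Wm: "W r \<in> borel_measurable M" if "0 \<le> r" for r
    using W that unfolding brownian_indep_def by blast
  define \<zeta> where "\<zeta> = E *v \<xi> + \<eta>"
  define z1 where "z1 r = mexp ((s - r) *\<^sub>R B) *v \<zeta>" for r
  define z2 where "z2 r = mexp ((t - r) *\<^sub>R B) *v \<xi>" for r
  define p1 where "p1 n k = 0 + (s - 0) * real k / real (Suc n)" for n k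
  define p2 where "p2 n k = s + (t - s) * real k / real (Suc n)" for n k
  \<comment> \<open>One grid from the two partitions of \<open>n + 1\<close> steps each. Both assign
    the time \<open>s\<close> to the index \<open>n + 1\<close> where they meet, so the grid is
    consistent; strict growth uses \<open>0 < s < t\<close>.\<close>
  define \<tau> where "\<tau> n i = (if i \<le> Suc n then p1 n i else p2 n (i - Suc n))" for n i
  have \<tau>2: "\<tau> n (Suc n + k) = p2 n k" for n k
    by (cases k) (simp_all add: \<tau>_def p1_def p2_def del: of_nat_Suc)
  have \<tau>1: "\<tau> n k = p1 n k" if "k \<le> Suc n" for n k using that by (simp add: \<tau>_def)
  have m1: "p1 n k < p1 n (Suc k)" and m2: "p2 n k < p2 n (Suc k)" for n k
    using st by (auto simp: p1_def p2_def divide_strict_right_mono)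
  have \<tau>m: "\<tau> n i < \<tau> n (Suc i)" for n i
  proof (cases "i < Suc n")
    case True
    then show ?thesis using m1[of n i] by (simp add: \<tau>1)
  next
    case False
    then obtain k where k: "i = Suc n + k" using le_Suc_ex not_less by blast
    have "\<tau> n (Suc n + k) < \<tau> n (Suc n + Suc k)" unfolding \<tau>2 by (rule m2)
    then show ?thesis by (simp add: k)
  qed
  have \<tau>0: "\<tau> n 0 = 0" for n by (simp add: \<tau>_def p1_def)
  define c where "c n i = (if i < Suc n then transpose A *v z1 (\<tau> n i) else transpose A *v z2 (\<tau> n i))" for n i
  define a where "a = A ** transpose A"
  have aq: "(transpose A *v y) \<bullet> (transpose A *v y) = y \<bullet> (a *v y)" for y
    unfolding a_def using dot_transpose_mult[of y A "transpose A *v y"] by (simp only: matrix_vector_mul_assoc)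
  define J where "J n \<omega> = (\<Sum>i<Suc n + Suc n. c n i \<bullet> (W (\<tau> n (Suc i)) \<omega> - W (\<tau> n i) \<omega>))" for n \<omega>
  have Jsplit: "J n \<omega> = (\<Sum>k<Suc n. (transpose A *v z1 (p1 n k)) \<bullet> (W (p1 n (Suc k)) \<omega> - W (p1 n k) \<omega>))
      + (\<Sum>k<Suc n. (transpose A *v z2 (p2 n k)) \<bullet> (W (p2 n (Suc k)) \<omega> - W (p2 n k) \<omega>))" for n \<omega>
  proof -
    have "\<tau> n (Suc (Suc n + k)) = p2 n (Suc k)" for k using \<tau>2[of n "Suc k"] by simp
    then show ?thesis unfolding J_def sum_lessThan_add
      by (intro arg_cong2[where f="(+)"] sum.cong refl) (simp_all add: c_def \<tau>1 \<tau>2 del: add_Suc add_Suc_right)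
  qed
  have Vsplit: "(\<Sum>i<Suc n + Suc n. (\<tau> n (Suc i) - \<tau> n i) * (c n i \<bullet> c n i))
     = (\<Sum>k<Suc n. (p1 n (Suc k) - p1 n k) * (z1 (p1 n k) \<bullet> (a *v z1 (p1 n k))))
      + (\<Sum>k<Suc n. (p2 n (Suc k) - p2 n k) * (z2 (p2 n k) \<bullet> (a *v z2 (p2 n k))))" for n
  proof -
    have "\<tau> n (Suc (Suc n + k)) = p2 n (Suc k)" for k using \<tau>2[of n "Suc k"] by simp
    then show ?thesis unfolding sum_lessThan_add
      by (intro arg_cong2[where f="(+)"] sum.cong refl)
         (simp_all add: c_def \<tau>1 \<tau>2 aq del: add_Suc add_Suc_right transpose_matrix_vector)
  qed
  have chn: "(\<integral>\<omega>. cos (z1 0 \<bullet> (X 0 \<omega> - m) + J n \<omega> + \<theta>) \<partial>M)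
     = exp (- (z1 0 \<bullet> (S *v z1 0) + (\<Sum>i<Suc n + Suc n. (\<tau> n (Suc i) - \<tau> n i) * (c n i \<bullet> c n i))) / 2) * cos \<theta>" for n
    unfolding J_def by (rule brownian_sum_char[OF M X0 psd W \<tau>0 \<tau>m])
  have lim\<omega>: "(\<lambda>n. z1 0 \<bullet> (X 0 \<omega> - m) + J n \<omega> + \<theta>) \<longlonglongrightarrow> \<xi> \<bullet> (X t \<omega> - m) + \<eta> \<bullet> (X s \<omega> - m) + \<theta>" if \<omega>: "\<omega> \<in> space M" for \<omega>
  proof -
    have x: "continuous_on {0..} (\<lambda>r. X r \<omega>)" "\<And>t. 0 \<le> t \<Longrightarrow> X t \<omega> = X 0 \<omega> + integral {0..t} (\<lambda>r. B *v X r \<omega> + g) + A *v W t \<omega>"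
      using X \<omega> unfolding ou_sde_sol_def by blast+
    have w: "continuous_on {0..} (\<lambda>r. W r \<omega>)" using W \<omega> unfolding brownian_indep_def by blast
    have 1: "(\<lambda>n. \<Sum>k<Suc n. (transpose A *v z1 (p1 n k)) \<bullet> (W (p1 n (Suc k)) \<omega> - W (p1 n k) \<omega>)) \<longlonglongrightarrow> \<zeta> \<bullet> (X s \<omega> - m) - z1 0 \<bullet> (X 0 \<omega> - m)"
      by (rule ou_path_stieltjes[OF B Bm x w order.refl st(1) z1_def p1_def])
    have 2: "(\<lambda>n. \<Sum>k<Suc n. (transpose A *v z2 (p2 n k)) \<bullet> (W (p2 n (Suc k)) \<omega> - W (p2 n k) \<omega>)) \<longlonglongrightarrow> \<xi> \<bullet> (X t \<omega> - m) - z2 s \<bullet> (X s \<omega> - m)"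
      by (rule ou_path_stieltjes[OF B Bm x w less_imp_le[OF st(1)] st(2) z2_def p2_def])
    have "(\<lambda>n. z1 0 \<bullet> (X 0 \<omega> - m) + J n \<omega> + \<theta>) \<longlonglongrightarrow> z1 0 \<bullet> (X 0 \<omega> - m)
       + ((\<zeta> \<bullet> (X s \<omega> - m) - z1 0 \<bullet> (X 0 \<omega> - m)) + (\<xi> \<bullet> (X t \<omega> - m) - z2 s \<bullet> (X s \<omega> - m))) + \<theta>"
      unfolding Jsplit by (intro tendsto_add tendsto_const 1 2)
    then show ?thesis by (simp add: \<zeta>_def z2_def E_def inner_add_left algebra_simps)
  qed
  have "(\<lambda>n. \<integral>\<omega>. cos (z1 0 \<bullet> (X 0 \<omega> - m) + J n \<omega> + \<theta>) \<partial>M) \<longlonglongrightarrow> (\<integral>\<omega>. cos (\<xi> \<bullet> (X t \<omega> - m) + \<eta> \<bullet> (X s \<omega> - m) + \<theta>) \<partial>M)"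
  proof (rule integral_dominated_convergence[where w="\<lambda>_. 1"])
    note [measurable] = Xm[of 0, simplified] Xm[of s] Xm[of t]
    have [simp]: "0 \<le> s" "0 \<le> t" using st by auto
    have [measurable]: "X s \<in> borel_measurable M" "X t \<in> borel_measurable M" by (simp_all add: Xm)
    show "(\<lambda>\<omega>. cos (\<xi> \<bullet> (X t \<omega> - m) + \<eta> \<bullet> (X s \<omega> - m) + \<theta>)) \<in> borel_measurable M" by measurable
    show "(\<lambda>\<omega>. cos (z1 0 \<bullet> (X 0 \<omega> - m) + J n \<omega> + \<theta>)) \<in> borel_measurable M" for n
    proof -
      have "0 \<le> \<tau> n i" for i
      proof (induction i)
        case (Suc i)
        then show ?case using \<tau>m[of n i] by simp
      qed (simp add: \<tau>0)
      then have [measurable]: "W (\<tau> n i) \<in> borel_measurable M" for i by (rule Wm)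
      show ?thesis unfolding J_def by measurable
    qed
    show "AE \<omega> in M. (\<lambda>n. cos (z1 0 \<bullet> (X 0 \<omega> - m) + J n \<omega> + \<theta>)) \<longlonglongrightarrow> cos (\<xi> \<bullet> (X t \<omega> - m) + \<eta> \<bullet> (X s \<omega> - m) + \<theta>)"
      by (intro AE_I2 tendsto_cos lim\<omega>)
  qed simp_all
  \<comment> \<open>The variance sums converge to differences of the \<open>S\<close>-form, so the
    contribution of \<open>X 0\<close> cancels against the lower end of the first orbit.\<close>
  moreover have "(\<lambda>n. \<integral>\<omega>. cos (z1 0 \<bullet> (X 0 \<omega> - m) + J n \<omega> + \<theta>) \<partial>M) \<longlonglongrightarrow>
    exp (- (z1 0 \<bullet> (S *v z1 0) + ((\<zeta> \<bullet> (S *v \<zeta>) - z1 0 \<bullet> (S *v z1 0)) + (\<xi> \<bullet> (S *v \<xi>) - z2 s \<bullet> (S *v z2 s)))) / 2) * cos \<theta>"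
    unfolding chn Vsplit
    by (intro tendsto_mult tendsto_exp tendsto_divide tendsto_minus tendsto_add tendsto_const
        variance_sum_tendsto[OF B S[folded a_def] st(1) z1_def p1_def] variance_sum_tendsto[OF B S[folded a_def] st(2) z2_def p2_def]) simp
  ultimately have "(\<integral>\<omega>. cos (\<xi> \<bullet> (X t \<omega> - m) + \<eta> \<bullet> (X s \<omega> - m) + \<theta>) \<partial>M)
    = exp (- (z1 0 \<bullet> (S *v z1 0) + ((\<zeta> \<bullet> (S *v \<zeta>) - z1 0 \<bullet> (S *v z1 0)) + (\<xi> \<bullet> (S *v \<xi>) - z2 s \<bullet> (S *v z2 s)))) / 2) * cos \<theta>"
    by (rule LIMSEQ_unique)
  then show ?thesis by (simp add: \<zeta>_def z2_def E_def add_diff_eq)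
qed

section \<open>The stationary correlation expressed by the score\<close>

text \<open>A linear map on a finite-dimensional space is bounded. This is what allows
  differentiation in \<open>s\<close> and integration in time to be carried out on the directions
  inside the score.\<close>

lemma bounded_linear_gaussian_score:
  fixes Y :: "'a \<Rightarrow> real^'d" and \<phi> :: "'a \<Rightarrow> real"
  assumes M: "prob_space M" and Y: "gaussian_vec M Y 0 S"
    and \<phi>: "\<phi> \<in> borel_measurable M" "\<And>\<omega>. \<bar>\<phi> \<omega>\<bar> \<le> K"
  shows "bounded_linear (\<lambda>p. gaussian_score M Y \<phi> (fst p) (snd p))"
proof -
  note [simp] = gaussian_score_integrable[OF M Y \<phi>]
  show ?thesis
    unfolding linear_conv_bounded_linear[symmetric]
  proof (rule linearI)
    fix p q :: "(real^'d) \<times> (real^'d^'d)" and r :: real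
    show "gaussian_score M Y \<phi> (fst (p + q)) (snd (p + q)) = gaussian_score M Y \<phi> (fst p) (snd p) + gaussian_score M Y \<phi> (fst q) (snd q)"
      by (simp add: gaussian_score_def inner_add_right matrix_vector_mult_add_rdistrib distrib_left add_divide_distrib diff_divide_distrib)
    show "gaussian_score M Y \<phi> (fst (r *\<^sub>R p)) (snd (r *\<^sub>R p)) = r *\<^sub>R gaussian_score M Y \<phi> (fst p) (snd p)"
      by (simp add: gaussian_score_def bounded_bilinear.scaleR_left[OF matrix_vector_bb] mult.left_commute[of _ r]
          right_diff_distrib distrib_left diff_divide_distrib)
  qed
qed

lemma law_transfer:
  fixes X X' :: "'a \<Rightarrow> real^'d" and h :: "real^'d \<Rightarrow> real"
  assumes d: "distr M borel X = distr M borel X'" and m: "X \<in> borel_measurable M" "X' \<in> borel_measurable M"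
    and h: "h \<in> borel_measurable borel"
  shows "(\<integral>\<omega>. h (X \<omega>) \<partial>M) = (\<integral>\<omega>. h (X' \<omega>) \<partial>M)" "integrable M (\<lambda>\<omega>. h (X \<omega>)) = integrable M (\<lambda>\<omega>. h (X' \<omega>))"
  using integral_distr[OF m(1) h] integral_distr[OF m(2) h] integrable_distr_eq[OF m(1) h] integrable_distr_eq[OF m(2) h] d
  by simp_all

text \<open>Regression of the earlier on the later value: \<open>Y\<^sub>s - C Y\<^sub>t\<close> is independent of \<open>Y\<^sub>t\<close>.\<close>

lemma ou_two_time_expectation:
  fixes B S :: "real^'d^'d" and A :: "real^'n^'d" and X :: "real \<Rightarrow> 'a \<Rightarrow> real^'d" and f :: "real^'d \<Rightarrow> real"
  assumes M: "prob_space M" and B: "transpose B = B" and Bm: "B *v m = - g"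
    and S: "B ** S + S ** B = - (A ** transpose A)"
    and sym: "transpose S = S" and pos: "\<And>v. v \<noteq> 0 \<Longrightarrow> 0 < v \<bullet> (S *v v)"
    and X0: "gaussian_vec M (X 0) m S" and W: "brownian_indep M (X 0) W" and X: "ou_sde_sol M B g A W X"
    and st: "0 < s" "s < t"
    and f: "f \<in> borel_measurable borel" "\<And>x. \<bar>f x\<bar> \<le> K"
  defines "E \<equiv> mexp ((t - s) *\<^sub>R B)"
  shows "(\<integral>\<omega>. f (X t \<omega>) * (c0 + p \<bullet> (X s \<omega> - m) + ((X s \<omega> - m) \<bullet> (N *v (X s \<omega> - m))) / 2) \<partial>M)
     = (\<integral>\<omega>. f (X 0 \<omega>) \<partial>M) * (c0 + (\<integral>\<omega>. (X 0 \<omega> - m) \<bullet> (N *v (X 0 \<omega> - m)) \<partial>M) / 2)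
       + gaussian_score M (\<lambda>\<omega>. X 0 \<omega> - m) (\<lambda>\<omega>. f (X 0 \<omega>)) (matrix_inv S *v (E *v (S *v p)))
           (matrix_inv S ** E ** S ** N ** S ** E ** matrix_inv S)"
proof -
  interpret prob_space M by fact
  note f(1)[measurable]
  have psd: "0 \<le> v \<bullet> (S *v v)" for v using pos[of v] by (cases "v = 0") auto
  have nn: "0 \<le> s" "0 \<le> t" using st by auto
  have Xm[measurable]: "X 0 \<in> borel_measurable M" "X s \<in> borel_measurable M" "X t \<in> borel_measurable M"
    using X nn unfolding ou_sde_sol_def by blast+
  define P where "P = matrix_inv S"
  have inv: "invertible S" by (rule invertible_posdef[OF pos])
  note PS = matrix_inv_mult[OF inv, folded P_def]
  have Psym: "transpose P = P" unfolding P_def by (rule transpose_matrix_inv[OF inv sym])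
  have Esym: "transpose E = E" unfolding E_def by (simp add: transpose_mexp transpose_scalar B)
  have sS: "(S *v u) \<bullet> v = u \<bullet> (S *v v)" and sE: "(E *v u) \<bullet> v = u \<bullet> (E *v v)" and sP: "(P *v u) \<bullet> v = u \<bullet> (P *v v)" for u v
    using dot_transpose_mult[of u S v] dot_transpose_mult[of u E v] dot_transpose_mult[of u P v]
    by (simp_all only: sym Esym Psym)
  define Y where "Y r \<omega> = X r \<omega> - m" for r \<omega>
  have Ym[measurable]: "Y 0 \<in> borel_measurable M" "Y s \<in> borel_measurable M" "Y t \<in> borel_measurable M"
    unfolding Y_def by measurable
  have J: "(\<integral>\<omega>. cos (\<xi> \<bullet> Y t \<omega> + \<eta> \<bullet> Y s \<omega> + \<theta>) \<partial>M)
     = exp (- (\<eta> \<bullet> (S *v \<eta>) + \<xi> \<bullet> (S *v \<xi>) + 2 * (\<eta> \<bullet> (S *v (E *v \<xi>)))) / 2) * cos \<theta>" for \<xi> \<eta> \<theta>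
  proof -
    have "(E *v \<xi> + \<eta>) \<bullet> (S *v (E *v \<xi> + \<eta>)) + \<xi> \<bullet> (S *v \<xi>) - (E *v \<xi>) \<bullet> (S *v (E *v \<xi>))
      = \<eta> \<bullet> (S *v \<eta>) + \<xi> \<bullet> (S *v \<xi>) + 2 * (\<eta> \<bullet> (S *v (E *v \<xi>)))"
      using sS[of "E *v \<xi>" \<eta>]
      by (simp add: matrix_vector_right_distrib inner_add_left inner_add_right inner_commute)
    then show ?thesis
      using ou_joint_char[OF M B Bm S psd X0 W X st, of \<xi> \<eta> \<theta>] unfolding E_def[symmetric] Y_def by simp
  qed
  have G0: "gaussian_vec M (Y 0) 0 S" unfolding Y_def[abs_def] by (rule gaussian_vec_centered[OF M X0])
  have ch0: "(\<integral>\<omega>. cos (\<xi> \<bullet> Y 0 \<omega> + \<theta>) \<partial>M) = exp (- (\<xi> \<bullet> (S *v \<xi>)) / 2) * cos \<theta>" for \<xi> \<theta>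
    using gaussian_vec_char[OF M G0 psd] by simp
  have lt: "distr M borel (Y t) = distr M borel (Y 0)"
  proof (rule distr_eq_of_char_eq[OF M M])
    show "(\<integral>\<omega>. cos (\<xi> \<bullet> Y t \<omega> + \<theta>) \<partial>M) = (\<integral>\<omega>. cos (\<xi> \<bullet> Y 0 \<omega> + \<theta>) \<partial>M)" for \<xi> \<theta>
      using J[of \<xi> 0 \<theta>] ch0[of \<xi> \<theta>] by simp
  qed measurable
  have ls: "distr M borel (Y s) = distr M borel (Y 0)"
  proof (rule distr_eq_of_char_eq[OF M M])
    show "(\<integral>\<omega>. cos (\<xi> \<bullet> Y s \<omega> + \<theta>) \<partial>M) = (\<integral>\<omega>. cos (\<xi> \<bullet> Y 0 \<omega> + \<theta>) \<partial>M)" for \<xi> \<theta>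
      using J[of 0 \<xi> \<theta>] ch0[of \<xi> \<theta>] by simp
  qed measurable
  define C where "C = S ** E ** P"
  define V where "V \<omega> = Y s \<omega> - C *v Y t \<omega>" for \<omega>
  have cC: "((*v) C) \<in> borel_measurable borel" by (intro borel_measurable_continuous_onI continuous_intros)
  have Vm[measurable]: "V \<in> borel_measurable M"
    unfolding V_def using measurable_compose[OF Ym(3) cC] by simp
  have Ct: "\<eta> \<bullet> (C *v y) = (P *v (E *v (S *v \<eta>))) \<bullet> y" for \<eta> y
    by (simp add: C_def sP sE sS flip: matrix_vector_mul_assoc)
  have law: "distr M borel (\<lambda>\<omega>. (V \<omega>, Y t \<omega>)) = distr M borel V \<Otimes>\<^sub>M distr M borel (Y t)"
  proof (rule indep_of_char_factor[OF M Vm Ym(3)])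
    fix \<eta> \<xi> :: "real^'d" and \<theta> :: real
    \<comment> \<open>The transpose of \<open>C\<close> applied to \<eta>, so that \<eta> tested on
      \<open>V\<close> becomes a frequency pair for \<open>Y t\<close> and \<open>Y s\<close>. Then
      \<open>S *v \<kappa>\<close> equals the covariance term of \<open>J\<close>, which removes the
      mixed terms in \<xi> and \<eta>.\<close>
    define \<kappa> where "\<kappa> = P *v (E *v (S *v \<eta>))"
    have V: "\<eta> \<bullet> V \<omega> = (- \<kappa>) \<bullet> Y t \<omega> + \<eta> \<bullet> Y s \<omega>" for \<omega>
      by (simp add: V_def inner_diff_right Ct \<kappa>_def)
    define v where "v = \<eta> \<bullet> (S *v \<eta>) + (- \<kappa>) \<bullet> (S *v (- \<kappa>)) + 2 * (\<eta> \<bullet> (S *v (E *v (- \<kappa>))))"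
    have Sk: "S *v \<kappa> = E *v (S *v \<eta>)" by (simp add: \<kappa>_def PS)
    have q: "\<eta> \<bullet> (S *v \<eta>) + (\<xi> - \<kappa>) \<bullet> (S *v (\<xi> - \<kappa>)) + 2 * (\<eta> \<bullet> (S *v (E *v (\<xi> - \<kappa>)))) = \<xi> \<bullet> (S *v \<xi>) + v"
    proof -
      have "\<eta> \<bullet> (S *v (E *v \<xi>)) = \<xi> \<bullet> (S *v \<kappa>)" unfolding Sk
        by (metis sS sE inner_commute)
      moreover have "\<kappa> \<bullet> (S *v \<xi>) = \<xi> \<bullet> (S *v \<kappa>)" by (metis sS inner_commute)
      ultimately show ?thesis
        by (simp add: v_def matrix_vector_mult_diff_distrib inner_diff_left inner_diff_right
            bounded_bilinear.minus_right[OF matrix_vector_bb] algebra_simps)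
    qed
    have inner: "(\<integral>\<omega>'. cos (\<eta> \<bullet> V \<omega> + \<xi> \<bullet> Y t \<omega>' + \<theta>) \<partial>M) = exp (- (\<xi> \<bullet> (S *v \<xi>)) / 2) * cos (\<eta> \<bullet> V \<omega> + \<theta>)" for \<omega>
      using J[of \<xi> 0 "\<eta> \<bullet> V \<omega> + \<theta>"] by (simp add: add_ac)
    have "(\<integral>\<omega>. cos (\<eta> \<bullet> V \<omega> + \<xi> \<bullet> Y t \<omega> + \<theta>) \<partial>M) = (\<integral>\<omega>. cos ((\<xi> - \<kappa>) \<bullet> Y t \<omega> + \<eta> \<bullet> Y s \<omega> + \<theta>) \<partial>M)"
      by (simp add: V inner_diff_left algebra_simps)
    also have "\<dots> = exp (- (\<xi> \<bullet> (S *v \<xi>)) / 2) * (exp (- v / 2) * cos \<theta>)"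
      unfolding J q by (simp add: add_divide_distrib diff_divide_distrib flip: exp_add mult.assoc)
    also have "exp (- v / 2) * cos \<theta> = (\<integral>\<omega>. cos (\<eta> \<bullet> V \<omega> + \<theta>) \<partial>M)"
      unfolding V v_def J ..
    also have "exp (- (\<xi> \<bullet> (S *v \<xi>)) / 2) * (\<integral>\<omega>. cos (\<eta> \<bullet> V \<omega> + \<theta>) \<partial>M) = (\<integral>\<omega>. (\<integral>\<omega>'. cos (\<eta> \<bullet> V \<omega> + \<xi> \<bullet> Y t \<omega>' + \<theta>) \<partial>M) \<partial>M)"
      unfolding inner by simp
    finally show "(\<integral>\<omega>. cos (\<eta> \<bullet> V \<omega> + \<xi> \<bullet> Y t \<omega> + \<theta>) \<partial>M) = (\<integral>\<omega>. (\<integral>\<omega>'. cos (\<eta> \<bullet> V \<omega> + \<xi> \<bullet> Y t \<omega>' + \<theta>) \<partial>M) \<partial>M)" .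
  qed
  have ind: "indep_var borel V borel (Y t)"
    unfolding indep_var_distribution_eq using law Vm Ym(3) by (simp add: borel_prod)
  have prod: "(\<integral>\<omega>. h (V \<omega>) * k (Y t \<omega>) \<partial>M) = (\<integral>\<omega>. h (V \<omega>) \<partial>M) * (\<integral>\<omega>. k (Y t \<omega>) \<partial>M)"
    "integrable M (\<lambda>\<omega>. h (V \<omega>) * k (Y t \<omega>))"
    if "h \<in> borel_measurable borel" "k \<in> borel_measurable borel" "integrable M (\<lambda>\<omega>. h (V \<omega>))" "integrable M (\<lambda>\<omega>. k (Y t \<omega>))" for h k :: "real^'d \<Rightarrow> real"
    using indep_var_lebesgue_integral[OF indep_var_compose[OF ind that(1,2), unfolded comp_def] that(3,4)]
      indep_var_integrable[OF indep_var_compose[OF ind that(1,2), unfolded comp_def] that(3,4)] by simp_all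
  have bm: "(\<lambda>y :: real^'d. y \<bullet> v) \<in> borel_measurable borel" "(\<lambda>y :: real^'d. y \<bullet> (Q *v y)) \<in> borel_measurable borel" for v Q
    by (intro borel_measurable_continuous_onI continuous_intros)+
  have fm: "(\<lambda>y. f (m + y)) \<in> borel_measurable borel" by measurable
  have one: "(\<lambda>_ :: 'a. 1 :: real) \<in> borel_measurable M" "\<And>\<omega> :: 'a. \<bar>1 :: real\<bar> \<le> 1" by auto
  have f0: "(\<lambda>\<omega>. f (m + Y 0 \<omega>)) \<in> borel_measurable M" by measurable
  note I0 = gaussian_score_integrable[OF M G0 f0 f(2)] and I1 = gaussian_score_integrable[OF M G0 one]
  have iY: "integrable M (\<lambda>\<omega>. Y t \<omega> \<bullet> v)" "integrable M (\<lambda>\<omega>. Y s \<omega> \<bullet> v)"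
    "(\<integral>\<omega>. Y t \<omega> \<bullet> v \<partial>M) = 0" "(\<integral>\<omega>. Y s \<omega> \<bullet> v \<partial>M) = 0" for v
    using law_transfer[OF lt Ym(3,1) bm(1)[of v]] law_transfer[OF ls Ym(2,1) bm(1)[of v]]
      gaussian_vec_moments(1,3)[OF M G0, of v] by (simp_all add: inner_commute)
  have iQ: "integrable M (\<lambda>\<omega>. Y s \<omega> \<bullet> (Q *v Y s \<omega>))" "integrable M (\<lambda>\<omega>. Y t \<omega> \<bullet> (Q *v Y t \<omega>))" for Q
    using law_transfer(2)[OF ls Ym(2,1) bm(2)[of Q]] law_transfer(2)[OF lt Ym(3,1) bm(2)[of Q]] I1(3) by simp_all
  have V0: "integrable M (\<lambda>\<omega>. V \<omega> \<bullet> v)" "(\<integral>\<omega>. V \<omega> \<bullet> v \<partial>M) = 0" for v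
  proof -
    have e: "V \<omega> \<bullet> v = Y s \<omega> \<bullet> v - Y t \<omega> \<bullet> (P *v (E *v (S *v v)))" for \<omega>
      using Ct[of v "Y t \<omega>"] by (simp add: V_def inner_diff_left inner_diff_right inner_commute)
    show "integrable M (\<lambda>\<omega>. V \<omega> \<bullet> v)" "(\<integral>\<omega>. V \<omega> \<bullet> v \<partial>M) = 0"
      unfolding e using iY by simp_all
  qed
  \<comment> \<open>The form \<open>N\<close> pulled back along \<open>C\<close>: its value at
    \<open>y\<close> is the \<open>N\<close>-form at \<open>C *v y\<close>.\<close>
  define N' where "N' = P ** E ** S ** N ** S ** E ** P"
  have N': "y \<bullet> (N' *v y) = (C *v y) \<bullet> (N *v (C *v y))" for y
  proof -
    have "(C *v y) \<bullet> (N *v (C *v y)) = (N *v (C *v y)) \<bullet> (C *v y)" by (rule inner_commute)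
    also have "\<dots> = y \<bullet> (P *v (E *v (S *v (N *v (C *v y)))))"
      unfolding Ct by (rule inner_commute)
    also have "\<dots> = y \<bullet> (N' *v y)" by (simp add: N'_def C_def matrix_vector_mul_assoc matrix_mul_assoc)
    finally show ?thesis ..
  qed
  \<comment> \<open>The mixed term is expanded in coordinates so that each summand is a function of
    \<open>V\<close> times a function of \<open>Y t\<close>; independence and the zero mean of
    \<open>V\<close> then annihilate it.\<close>
  have Ysplit: "Y s \<omega> \<bullet> (N *v Y s \<omega>) = V \<omega> \<bullet> (N *v V \<omega>) + Y t \<omega> \<bullet> (N' *v Y t \<omega>) + (\<Sum>i\<in>UNIV. (V \<omega> \<bullet> axis i 1) * (((N + transpose N) *v (C *v Y t \<omega>)) \<bullet> axis i 1))" for \<omega>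
  proof -
    have "Y s \<omega> = V \<omega> + C *v Y t \<omega>" by (simp add: V_def)
    then have "Y s \<omega> \<bullet> (N *v Y s \<omega>) = V \<omega> \<bullet> (N *v V \<omega>) + (C *v Y t \<omega>) \<bullet> (N *v (C *v Y t \<omega>)) + (V \<omega> \<bullet> (N *v (C *v Y t \<omega>)) + (C *v Y t \<omega>) \<bullet> (N *v V \<omega>))"
      by (simp add: matrix_vector_right_distrib inner_add_left inner_add_right)
    also have "(C *v Y t \<omega>) \<bullet> (N *v V \<omega>) = V \<omega> \<bullet> (transpose N *v (C *v Y t \<omega>))"
      by (subst dot_transpose_mult) (rule inner_commute)
    also have "V \<omega> \<bullet> (N *v (C *v Y t \<omega>)) + V \<omega> \<bullet> (transpose N *v (C *v Y t \<omega>)) = V \<omega> \<bullet> ((N + transpose N) *v (C *v Y t \<omega>))"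
      by (simp only: matrix_vector_mult_add_rdistrib inner_add_right)
    also have "\<dots> = (\<Sum>i\<in>UNIV. (V \<omega> \<bullet> axis i 1) * (((N + transpose N) *v (C *v Y t \<omega>)) \<bullet> axis i 1))"
      by (simp only: inner_axis) (simp add: inner_vec_def del: transpose_matrix_vector)
    finally show ?thesis by (simp only: N')
  qed
  \<comment> \<open>Kept general in \<open>k\<close> because it is used both for the observable and
    for the constant 1.\<close>
  have main: "integrable M (\<lambda>\<omega>. k (Y t \<omega>) * (V \<omega> \<bullet> (N *v V \<omega>)))"
     "(\<integral>\<omega>. k (Y t \<omega>) * (Y s \<omega> \<bullet> (N *v Y s \<omega>)) \<partial>M) = (\<integral>\<omega>. k (Y t \<omega>) \<partial>M) * (\<integral>\<omega>. V \<omega> \<bullet> (N *v V \<omega>) \<partial>M) + (\<integral>\<omega>. k (Y t \<omega>) * (Y t \<omega> \<bullet> (N' *v Y t \<omega>)) \<partial>M)"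
     "integrable M (\<lambda>\<omega>. k (Y t \<omega>) * (Y s \<omega> \<bullet> (N *v Y s \<omega>)))"
     "(\<integral>\<omega>. k (Y t \<omega>) * (p \<bullet> Y s \<omega>) \<partial>M) = (\<integral>\<omega>. k (Y t \<omega>) * (Y t \<omega> \<bullet> (P *v (E *v (S *v p)))) \<partial>M)"
     "integrable M (\<lambda>\<omega>. k (Y t \<omega>) * (p \<bullet> Y s \<omega>))"
     "integrable M (\<lambda>\<omega>. k (Y t \<omega>))"
    if k[measurable]: "k \<in> borel_measurable borel" and kb: "\<And>y. \<bar>k y\<bar> \<le> c" for k c
  proof -
    have k0: "(\<lambda>\<omega>. k (Y 0 \<omega>)) \<in> borel_measurable M" by measurable
    note Ik = gaussian_score_integrable[OF M G0 k0 kb]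
    have kl[measurable]: "(\<lambda>y. k y * (y \<bullet> v)) \<in> borel_measurable borel" "(\<lambda>y. k y * (y \<bullet> (Q *v y))) \<in> borel_measurable borel" for v Q
      using bm(1)[of v] bm(2)[of Q] by measurable
    have ikl: "integrable M (\<lambda>\<omega>. k (Y t \<omega>) * (Y t \<omega> \<bullet> v))" "integrable M (\<lambda>\<omega>. k (Y t \<omega>) * (Y t \<omega> \<bullet> (Q *v Y t \<omega>)))" for v Q
      using law_transfer(2)[OF lt Ym(3,1) kl(1)[of v]] law_transfer(2)[OF lt Ym(3,1) kl(2)[of Q]] Ik(1,2) by simp_all
    show ik: "integrable M (\<lambda>\<omega>. k (Y t \<omega>))"
      using kb by (intro integrable_const_bound[of _ c]) auto
    define D where "D = (N + transpose N) ** C"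
    have Dv: "((N + transpose N) *v (C *v y)) \<bullet> axis i 1 = y \<bullet> (transpose D *v axis i 1)" for y i
    proof -
      have "((N + transpose N) *v (C *v y)) \<bullet> axis i 1 = axis i 1 \<bullet> (D *v y)"
        unfolding D_def matrix_vector_mul_assoc by (rule inner_commute)
      also have "\<dots> = (transpose D *v axis i 1) \<bullet> y" by (rule dot_transpose_mult)
      finally show ?thesis by (simp only: inner_commute)
    qed
    have cross: "integrable M (\<lambda>\<omega>. (V \<omega> \<bullet> axis i 1) * (k (Y t \<omega>) * (Y t \<omega> \<bullet> (transpose D *v axis i 1))))"
      "(\<integral>\<omega>. (V \<omega> \<bullet> axis i 1) * (k (Y t \<omega>) * (Y t \<omega> \<bullet> (transpose D *v axis i 1))) \<partial>M) = 0" for i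
      using prod[OF bm(1)[of "axis i 1"] kl(1)[of "transpose D *v axis i 1"] V0(1) ikl(1)] V0(2) by simp_all
    have cross': "integrable M (\<lambda>\<omega>. V \<omega> \<bullet> axis i 1 * (Y t \<omega> \<bullet> (transpose D *v axis i 1)))" for i
      using prod(2)[OF bm(1)[of "axis i 1"] bm(1)[of "transpose D *v axis i 1"] V0(1) iY(1)] by simp
    have e1: "V \<omega> \<bullet> (N *v V \<omega>) = Y s \<omega> \<bullet> (N *v Y s \<omega>) - Y t \<omega> \<bullet> (N' *v Y t \<omega>) - (\<Sum>i\<in>UNIV. V \<omega> \<bullet> axis i 1 * (Y t \<omega> \<bullet> (transpose D *v axis i 1)))" for \<omega>
      using Ysplit[of \<omega>] unfolding Dv by linarith
    have iV: "integrable M (\<lambda>\<omega>. V \<omega> \<bullet> (N *v V \<omega>))"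
      unfolding e1 using iQ cross' by (intro Bochner_Integration.integrable_diff Bochner_Integration.integrable_sum) auto
    have pV: "(\<integral>\<omega>. (V \<omega> \<bullet> (N *v V \<omega>)) * k (Y t \<omega>) \<partial>M) = (\<integral>\<omega>. V \<omega> \<bullet> (N *v V \<omega>) \<partial>M) * (\<integral>\<omega>. k (Y t \<omega>) \<partial>M)"
      "integrable M (\<lambda>\<omega>. (V \<omega> \<bullet> (N *v V \<omega>)) * k (Y t \<omega>))"
      using prod[OF bm(2)[of N] k iV ik] by simp_all
    then show ikV: "integrable M (\<lambda>\<omega>. k (Y t \<omega>) * (V \<omega> \<bullet> (N *v V \<omega>)))" by (simp add: mult.commute)
    have e2: "k (Y t \<omega>) * (Y s \<omega> \<bullet> (N *v Y s \<omega>)) = (V \<omega> \<bullet> (N *v V \<omega>)) * k (Y t \<omega>) + k (Y t \<omega>) * (Y t \<omega> \<bullet> (N' *v Y t \<omega>))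
        + (\<Sum>i\<in>UNIV. (V \<omega> \<bullet> axis i 1) * (k (Y t \<omega>) * (Y t \<omega> \<bullet> (transpose D *v axis i 1))))" for \<omega>
      unfolding Ysplit Dv distrib_left sum_distrib_left by (simp only: mult_ac)
    have ics: "integrable M (\<lambda>\<omega>. \<Sum>i\<in>UNIV. (V \<omega> \<bullet> axis i 1) * (k (Y t \<omega>) * (Y t \<omega> \<bullet> (transpose D *v axis i 1))))"
      by (intro Bochner_Integration.integrable_sum cross)
    have cs: "(\<integral>\<omega>. (\<Sum>i\<in>UNIV. (V \<omega> \<bullet> axis i 1) * (k (Y t \<omega>) * (Y t \<omega> \<bullet> (transpose D *v axis i 1)))) \<partial>M) = 0"
      using cross by (subst Bochner_Integration.integral_sum) (auto simp del: transpose_matrix_vector)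
    show "integrable M (\<lambda>\<omega>. k (Y t \<omega>) * (Y s \<omega> \<bullet> (N *v Y s \<omega>)))"
      unfolding e2 by (intro Bochner_Integration.integrable_add pV ikl ics)
    show "(\<integral>\<omega>. k (Y t \<omega>) * (Y s \<omega> \<bullet> (N *v Y s \<omega>)) \<partial>M) = (\<integral>\<omega>. k (Y t \<omega>) \<partial>M) * (\<integral>\<omega>. V \<omega> \<bullet> (N *v V \<omega>) \<partial>M) + (\<integral>\<omega>. k (Y t \<omega>) * (Y t \<omega> \<bullet> (N' *v Y t \<omega>)) \<partial>M)"
      unfolding e2 Bochner_Integration.integral_add[OF Bochner_Integration.integrable_add[OF pV(2) ikl(2)] ics] Bochner_Integration.integral_add[OF pV(2) ikl(2)] cs pV(1)
      by simp
    have pP: "integrable M (\<lambda>\<omega>. (V \<omega> \<bullet> p) * k (Y t \<omega>))" "(\<integral>\<omega>. (V \<omega> \<bullet> p) * k (Y t \<omega>) \<partial>M) = 0"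
      using prod[OF bm(1)[of p] k V0(1) ik] V0(2) by simp_all
    have e3: "k (Y t \<omega>) * (p \<bullet> Y s \<omega>) = (V \<omega> \<bullet> p) * k (Y t \<omega>) + k (Y t \<omega>) * (Y t \<omega> \<bullet> (P *v (E *v (S *v p))))" for \<omega>
    proof -
      have "p \<bullet> Y s \<omega> = V \<omega> \<bullet> p + Y t \<omega> \<bullet> (P *v (E *v (S *v p)))"
        using Ct[of p "Y t \<omega>"] by (simp add: V_def inner_diff_left inner_diff_right inner_commute)
      then show ?thesis by (simp only: distrib_left mult.commute)
    qed
    show "integrable M (\<lambda>\<omega>. k (Y t \<omega>) * (p \<bullet> Y s \<omega>))"
      unfolding e3 by (intro Bochner_Integration.integrable_add pP ikl)
    show "(\<integral>\<omega>. k (Y t \<omega>) * (p \<bullet> Y s \<omega>) \<partial>M) = (\<integral>\<omega>. k (Y t \<omega>) * (Y t \<omega> \<bullet> (P *v (E *v (S *v p)))) \<partial>M)"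
      unfolding e3 Bochner_Integration.integral_add[OF pP(1) ikl(1)] pP(2) by simp
  qed
  define F where "F y = f (m + y)" for y
  have Fm: "F \<in> borel_measurable borel" "\<And>y. \<bar>F y\<bar> \<le> K" using fm f(2) by (simp_all add: F_def[abs_def])
  have FX: "f (X r \<omega>) = F (Y r \<omega>)" for r \<omega> by (simp add: F_def Y_def)
  note mF = main[OF Fm]
  \<comment> \<open>Taking \<open>k = 1\<close> determines the mean of the \<open>V\<close>-form
    from stationary moments; its negative part is precisely the normalising term of the
    score.\<close>
  have VV: "(\<integral>\<omega>. V \<omega> \<bullet> (N *v V \<omega>) \<partial>M) = (\<integral>\<omega>. Y 0 \<omega> \<bullet> (N *v Y 0 \<omega>) \<partial>M) - (\<integral>\<omega>. Y 0 \<omega> \<bullet> (N' *v Y 0 \<omega>) \<partial>M)"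
    using main(2)[of "\<lambda>_. 1" 1] law_transfer(1)[OF ls Ym(2,1) bm(2)[of N]] law_transfer(1)[OF lt Ym(3,1) bm(2)[of N']]
    by (simp add: prob_space)
  have kl: "(\<lambda>y. F y * (y \<bullet> v)) \<in> borel_measurable borel" "(\<lambda>y. F y * (y \<bullet> (Q *v y))) \<in> borel_measurable borel" for v Q
    using bm(1)[of v] bm(2)[of Q] Fm(1) by measurable
  have "(\<integral>\<omega>. f (X t \<omega>) * (c0 + p \<bullet> (X s \<omega> - m) + ((X s \<omega> - m) \<bullet> (N *v (X s \<omega> - m))) / 2) \<partial>M)
    = (\<integral>\<omega>. F (Y t \<omega>) * c0 + F (Y t \<omega>) * (p \<bullet> Y s \<omega>) + F (Y t \<omega>) * (Y s \<omega> \<bullet> (N *v Y s \<omega>)) / 2 \<partial>M)"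
    unfolding FX Y_def[symmetric] by (simp add: distrib_left)
  also have "\<dots> = (\<integral>\<omega>. F (Y t \<omega>) \<partial>M) * c0 + (\<integral>\<omega>. F (Y t \<omega>) * (p \<bullet> Y s \<omega>) \<partial>M) + (\<integral>\<omega>. F (Y t \<omega>) * (Y s \<omega> \<bullet> (N *v Y s \<omega>)) \<partial>M) / 2"
    using mF by simp
  also have "\<dots> = (\<integral>\<omega>. F (Y 0 \<omega>) \<partial>M) * c0 + (\<integral>\<omega>. F (Y 0 \<omega>) * (Y 0 \<omega> \<bullet> (P *v (E *v (S *v p)))) \<partial>M)
      + ((\<integral>\<omega>. F (Y 0 \<omega>) \<partial>M) * ((\<integral>\<omega>. Y 0 \<omega> \<bullet> (N *v Y 0 \<omega>) \<partial>M) - (\<integral>\<omega>. Y 0 \<omega> \<bullet> (N' *v Y 0 \<omega>) \<partial>M))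
         + (\<integral>\<omega>. F (Y 0 \<omega>) * (Y 0 \<omega> \<bullet> (N' *v Y 0 \<omega>)) \<partial>M)) / 2"
    unfolding mF(2,4) VV law_transfer(1)[OF lt Ym(3,1) Fm(1)] law_transfer(1)[OF lt Ym(3,1) kl(1)] law_transfer(1)[OF lt Ym(3,1) kl(2)] ..
  finally show ?thesis
    unfolding gaussian_score_def FX Y_def[symmetric] P_def[symmetric] N'_def[symmetric]
    by (simp add: algebra_simps add_divide_distrib diff_divide_distrib)
qed

section \<open>The response function\<close>

text \<open>Differentiability on the open interval accompanies the response property because
  \<open>deriv\<close> denotes an unspecified value wherever no derivative exists.\<close>

theorem theorem6p6:
  fixes T :: real
    and B :: "real^'d::finite^'d" and g gt :: "real^'d" and A :: "real^'n::finite^'d"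
    and atl :: "real^'d^'d" and lam :: real
    and M :: "'a measure" and X :: "real \<Rightarrow> 'a \<Rightarrow> real^'d" and W :: "real \<Rightarrow> 'a \<Rightarrow> real^'n"
    and Mh :: "(real \<Rightarrow> real) \<Rightarrow> 'b measure" and Xh :: "(real \<Rightarrow> real) \<Rightarrow> real \<Rightarrow> 'b \<Rightarrow> real^'d"
    and f :: "real^'d \<Rightarrow> real" and \<theta> t :: real
  defines "a \<equiv> A ** transpose A"
  defines "m \<equiv> - (matrix_inv B *v g)"
  defines "\<Sigma> \<equiv> Sigma_h B a atl 0"
  assumes T: "0 < T"
    and B_sym: "transpose B = B" and B_neg: "eigenvalues_negative B"
    and ellip: "0 < lam" "\<forall>\<xi>. \<xi> \<bullet> (a *v \<xi>) \<ge> lam * (norm \<xi>)\<^sup>2"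
    and M: "prob_space M"
    and X0: "gaussian_vec M (X 0) m \<Sigma>"
    and W: "brownian_indep M (X 0) W"
    and X: "ou_sde_sol M B g A W X"
    and Xh: "\<forall>h. continuous_on {0..T} h \<and> (\<forall>r\<in>{0..T}. \<bar>h r\<bar> \<le> 1)
               \<and> (\<forall>r\<in>{0..T}. \<forall>\<xi>. 0 \<le> \<xi> \<bullet> ((a + h r *\<^sub>R atl) *v \<xi>)) \<longrightarrow>
               prob_space (Mh h) \<and> gaussian_vec (Mh h) (Xh h 0) m \<Sigma> \<and>
               diffusion_sol (Mh h) T (\<lambda>r x. B *v x + g + h r *\<^sub>R gt) (\<lambda>r. a + h r *\<^sub>R atl) (Xh h)"
    and \<theta>: "0 < \<theta>" "\<theta> < 1"
    and f: "in_OU_gen_domain M B g A W f" "C2theta_b \<theta> f"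
    and t: "t \<in> {0..T}"
  shows "(\<forall>s\<in>{0<..<t}. (\<lambda>s. \<integral>\<omega>. f (X t \<omega>) * w_fun B g gt a atl (X s \<omega>) \<partial>M) differentiable (at s))
       \<and> is_response t (\<lambda>h. \<integral>\<omega>. f (Xh h t \<omega>) \<partial>Mh h)
            (\<lambda>s. deriv (\<lambda>s. \<integral>\<omega>. f (X t \<omega>) * w_fun B g gt a atl (X s \<omega>) \<partial>M) s)"
proof -
  interpret M: prob_space M by fact
  have asym: "transpose a = a" unfolding a_def by (simp add: matrix_transpose_mul)
  have apos: "0 < v \<bullet> (a *v v)" if "v \<noteq> 0" for v
  proof -
    have "0 < lam * (norm v)\<^sup>2" using ellip(1) that by simp
    then show ?thesis using ellip(2) by (meson less_le_trans)
  qed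
  define St where "St = lyap B atl"
  have S_lyap: "\<Sigma> = lyap B a" by (simp add: \<Sigma>_def Sigma_h_eq_lyap)
  have Sigma_lin: "Sigma_h B a atl h = \<Sigma> + h *\<^sub>R St" for h
    by (simp add: Sigma_h_eq_lyap lyap_add_scaleR[OF B_sym B_neg] S_lyap St_def)
  have S_sym: "transpose \<Sigma> = \<Sigma>" by (simp add: S_lyap transpose_lyap[OF B_sym B_neg] asym)
  have S_pos: "0 < v \<bullet> (\<Sigma> *v v)" if "v \<noteq> 0" for v
    unfolding S_lyap by (rule lyap_posdef[OF B_sym B_neg asym apos that])
  have S_psd: "0 \<le> v \<bullet> (\<Sigma> *v v)" for v using S_pos[of v] by (cases "v = 0") auto
  have S_eq: "B ** \<Sigma> + \<Sigma> ** B = - a" unfolding S_lyap by (rule lyap_equation[OF B_sym B_neg])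
  have St_eq: "B ** St + St ** B = - atl" unfolding St_def by (rule lyap_equation[OF B_sym B_neg])
  have B_inv: "invertible B"
  proof -
    obtain \<beta> where \<beta>: "0 < \<beta>" "\<And>v. v \<bullet> (B *v v) \<le> - \<beta> * (norm v)\<^sup>2"
      using negative_definite[OF B_sym B_neg] by blast
    have "v = 0" if "B *v v = 0" for v
      using \<beta>(2)[of v] \<beta>(1) that by (simp add: zero_le_mult_iff mult_le_0_iff)
    then show ?thesis by (simp add: invertible_left_inverse matrix_left_invertible_ker)
  qed
  define Bi where "Bi = matrix_inv B"
  note BBi = matrix_inv_mult[OF B_inv, folded Bi_def]
  have Bm: "B *v m = - g"
    unfolding m_def Bi_def[symmetric] by (simp add: bounded_bilinear.minus_right[OF matrix_vector_bb] BBi)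
  define P where "P = matrix_inv \<Sigma>"
  have S_inv: "invertible \<Sigma>" by (rule invertible_posdef[OF S_pos])
  note PS = matrix_inv_mult[OF S_inv, folded P_def]
  have Psym: "transpose P = P" unfolding P_def by (rule transpose_matrix_inv[OF S_inv S_sym])
  have inv_deriv: "vector_derivative (\<lambda>h. matrix_inv (Sigma_h B a atl h)) (at 0) = - (P ** St ** P)"
  proof -
    obtain v l where vl: "v \<noteq> 0" "\<Sigma> *v v = l *\<^sub>R v" "\<And>w. l * (norm w)\<^sup>2 \<le> w \<bullet> (\<Sigma> *v w)"
      using symmetric_least_eigenvalue[OF S_sym] by blast
    have "0 < l * (v \<bullet> v)" using S_pos[OF vl(1)] vl(2) by simp
    then have "0 < l" using inner_ge_zero[of v] by (simp add: zero_less_mult_iff not_less[symmetric])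
    from matrix_inv_has_vector_derivative[OF this vl(3), of St] show ?thesis
      unfolding Sigma_lin P_def by (rule vector_derivative_at)
  qed
  \<comment> \<open>The determinant term of the weight depends on neither the position nor the time
    \<open>s\<close>.\<close>
  define c0 where "c0 = - pi * inverse (2 * pi * det \<Sigma>) * deriv (\<lambda>h. det (Sigma_h B a atl h)) 0"
  define q where "q = - (P *v (Bi *v gt))"
  define N where "N = P ** St ** P"
  \<comment> \<open>The inverse covariance has derivative \<open>- N\<close> in \<open>h\<close>, so
    the quadratic term appears with a plus sign; the linear term is moved onto \<open>x - m\<close>
    by symmetry of \<open>P\<close>.\<close>
  have w_eq: "w_fun B g gt a atl x = c0 + q \<bullet> (x - m) + ((x - m) \<bullet> (N *v (x - m))) / 2" for x
  proof -
    have "gt \<bullet> (transpose Bi *v (P *v (x - m))) = (Bi *v gt) \<bullet> (P *v (x - m))"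
      using dot_transpose_mult[of gt "transpose Bi" "P *v (x - m)"] by (simp only: transpose_transpose)
    also have "\<dots> = (P *v (Bi *v gt)) \<bullet> (x - m)"
      using dot_transpose_mult[of "Bi *v gt" P "x - m"] by (simp only: Psym)
    finally show ?thesis
      unfolding w_fun_def Let_def m_def[symmetric]
      unfolding \<Sigma>_def[symmetric] inv_deriv Bi_def[symmetric] P_def[symmetric]
        c0_def[symmetric] N_def[symmetric]
      by (simp add: q_def bounded_bilinear.minus_left[OF matrix_vector_bb] del: transpose_matrix_vector)
  qed
  have fC: "continuous_on UNIV f" "partially_differentiable f" "\<And>i. continuous_on UNIV (pd i f)"
    "\<And>i. partially_differentiable (pd i f)" "\<And>i j. continuous_on UNIV (pd j (pd i f))"
    using f(2) unfolding C2theta_b_def C2_def by blast+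
  obtain K where fb: "\<And>x. \<bar>f x\<bar> \<le> K" "\<And>i x. \<bar>pd i f x\<bar> \<le> K" "\<And>i j x. \<bar>pd j (pd i f) x\<bar> \<le> K"
  proof -
    have b: "bounded (range f)" "\<And>i. bounded (range (pd i f))" "\<And>i j. bounded (range (pd j (pd i f)))"
      using f(2) unfolding C2theta_b_def by blast+
    have "bounded (range f \<union> (\<Union>i. range (pd i f)) \<union> (\<Union>i. \<Union>j. range (pd j (pd i f))))"
      using b by (intro bounded_Un[THEN iffD2] conjI bounded_UN ballI finite) auto
    then obtain K where K: "\<And>y. y \<in> range f \<union> (\<Union>i. range (pd i f)) \<union> (\<Union>i. \<Union>j. range (pd j (pd i f))) \<Longrightarrow> norm y \<le> K"
      unfolding bounded_iff by blast
    have "\<bar>f x\<bar> \<le> K" "\<bar>pd i f x\<bar> \<le> K" "\<bar>pd j (pd i f) x\<bar> \<le> K" for i j x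
      by (rule K[unfolded real_norm_def], blast)+
    then show thesis by (rule that)
  qed
  have fm[measurable]: "f \<in> borel_measurable borel" by (rule borel_measurable_continuous_onI[OF fC(1)])
  define Y where "Y \<omega> = X 0 \<omega> - m" for \<omega>
  have Y: "gaussian_vec M Y 0 \<Sigma>" unfolding Y_def[abs_def] by (rule gaussian_vec_centered[OF M X0])
  have Ym[measurable]: "Y \<in> borel_measurable M" using Y by (simp add: gaussian_vec_def)
  have fY: "(\<lambda>\<omega>. f (X 0 \<omega>)) = (\<lambda>\<omega>. f (m + Y \<omega>))" by (simp add: Y_def)
  have fYm: "(\<lambda>\<omega>. f (m + Y \<omega>)) \<in> borel_measurable M" by measurable
  define Sc where "Sc v Q = gaussian_score M Y (\<lambda>\<omega>. f (m + Y \<omega>)) v Q" for v Q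
  have Sc: "bounded_linear (\<lambda>p. Sc (fst p) (snd p))"
    unfolding Sc_def by (rule bounded_linear_gaussian_score[OF M Y fYm fb(1)])
  define E where "E s = mexp ((t - s) *\<^sub>R B)" for s
  have E_sym: "transpose (E s) = E s" for s by (simp add: E_def transpose_mexp transpose_scalar B_sym)
  have cE: "continuous_on Q E" for Q unfolding E_def by (intro continuous_intros)
  have E_comm: "B ** E s = E s ** B" for s unfolding E_def by (rule mexp_scaleR_commute)
  have E': "(E has_vector_derivative - (B ** E s)) (at s)" for s
    unfolding E_def by (rule mexp_rev_has_vector_derivative)
  define G where "G s = (\<integral>\<omega>. f (X t \<omega>) * w_fun B g gt a atl (X s \<omega>) \<partial>M)" for s
  define R0 where "R0 s = Sc (P *v (E s *v gt)) (P ** E s ** atl ** E s ** P)" for s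
  define const where "const = (\<integral>\<omega>. f (X 0 \<omega>) \<partial>M) * (c0 + (\<integral>\<omega>. Y \<omega> \<bullet> (N *v Y \<omega>) \<partial>M) / 2)"
  \<comment> \<open>The inverse covariances inside \<open>q\<close> and \<open>N\<close> are
    cancelled by the covariances that the two-time formula multiplies onto them.\<close>
  have G_eq: "G s = const + Sc (- (P *v (E s *v (Bi *v gt)))) (P ** E s ** St ** E s ** P)" if s: "s \<in> {0<..<t}" for s
  proof -
    have "G s = const + gaussian_score M Y (\<lambda>\<omega>. f (X 0 \<omega>)) (P *v (E s *v (\<Sigma> *v q))) (P ** E s ** \<Sigma> ** N ** \<Sigma> ** E s ** P)"
      unfolding G_def w_eq const_def E_def P_def Y_def[abs_def]
      by (rule ou_two_time_expectation[OF M B_sym Bm S_eq[unfolded a_def] S_sym S_pos X0 W X _ _ fm fb(1)]) (use s in auto)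
    moreover have "P *v (E s *v (\<Sigma> *v q)) = - (P *v (E s *v (Bi *v gt)))"
      by (simp add: q_def bounded_bilinear.minus_right[OF matrix_vector_bb] PS)
    moreover have "P ** E s ** \<Sigma> ** N ** \<Sigma> ** E s ** P = P ** E s ** St ** E s ** P"
    proof -
      have "P ** E s ** \<Sigma> ** N ** \<Sigma> ** E s ** P = P ** E s ** (\<Sigma> ** P) ** St ** (P ** \<Sigma>) ** E s ** P"
        by (simp add: N_def matrix_mul_assoc)
      then show ?thesis by (simp add: PS)
    qed
    ultimately show ?thesis unfolding fY Sc_def by simp
  qed
  have G': "(G has_real_derivative R0 s) (at s)" if s: "s \<in> {0<..<t}" for s
  proof -
    have v': "((\<lambda>s. - (P *v (E s *v (Bi *v gt)))) has_vector_derivative P *v (E s *v gt)) (at s)"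
    proof -
      have L: "bounded_linear (\<lambda>Q. - (P *v (Q *v (Bi *v gt))))"
        by (intro bounded_linear_minus bounded_linear_compose[OF bounded_bilinear.bounded_linear_right[OF matrix_vector_bb]]
            bounded_bilinear.bounded_linear_left[OF matrix_vector_bb])
      have "- (P *v (- (B ** E s) *v (Bi *v gt))) = P *v (E s *v gt)"
        unfolding E_comm by (simp add: bounded_bilinear.minus_left[OF matrix_vector_bb] bounded_bilinear.minus_right[OF matrix_vector_bb]
            BBi flip: matrix_vector_mul_assoc)
      with bounded_linear.has_vector_derivative[OF L E'[of s]] show ?thesis by simp
    qed
    have N': "((\<lambda>s. P ** E s ** St ** E s ** P) has_vector_derivative P ** E s ** atl ** E s ** P) (at s)"
    proof -
      have 1: "((\<lambda>s. P ** E s ** St) has_vector_derivative P ** (- (B ** E s)) ** St) (at s)"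
        by (rule bounded_linear.has_vector_derivative[OF _ E'])
           (intro bounded_linear_compose[OF bounded_bilinear.bounded_linear_left[OF matrix_mult_bb]] bounded_bilinear.bounded_linear_right[OF matrix_mult_bb])
      have 2: "((\<lambda>s. E s ** P) has_vector_derivative (- (B ** E s)) ** P) (at s)"
        by (rule bounded_linear.has_vector_derivative[OF bounded_bilinear.bounded_linear_left[OF matrix_mult_bb] E'])
      have "(P ** E s ** St) ** ((- (B ** E s)) ** P) + (P ** (- (B ** E s)) ** St) ** (E s ** P) = P ** E s ** atl ** E s ** P"
      proof -
        have "(P ** E s ** St) ** ((- (B ** E s)) ** P) + (P ** (- (B ** E s)) ** St) ** (E s ** P)
          = - ((P ** E s ** St) ** ((B ** E s) ** P) + (P ** (E s ** B) ** St) ** (E s ** P))"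
          by (simp add: matrix_mult_minus_left matrix_mult_minus_right E_comm)
        \<comment> \<open>\<open>E s\<close> commutes with \<open>B\<close>, so both copies of
          \<open>B\<close> move inward next to \<open>St\<close>. The minus sign of
          \<open>E' = - B E\<close> then cancels that of the Lyapunov equation.\<close>
        also have "\<dots> = - (P ** E s ** (B ** St + St ** B) ** E s ** P)"
          by (simp add: bounded_bilinear.add_left[OF matrix_mult_bb] bounded_bilinear.add_right[OF matrix_mult_bb] matrix_mul_assoc add.commute)
        finally show ?thesis by (simp add: St_eq matrix_mult_minus_left matrix_mult_minus_right)
      qed
      with bounded_bilinear.has_vector_derivative[OF matrix_mult_bb 1 2] show ?thesis by (simp add: matrix_mul_assoc)
    qed
    have "((\<lambda>s. Sc (- (P *v (E s *v (Bi *v gt)))) (P ** E s ** St ** E s ** P)) has_vector_derivative R0 s) (at s)"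
      using bounded_linear.has_vector_derivative[OF Sc has_vector_derivative_Pair[OF v' N']] by (simp add: R0_def)
    from DERIV_add[OF DERIV_const this[folded has_real_derivative_iff_has_vector_derivative], of const]
    have d: "((\<lambda>s. const + Sc (- (P *v (E s *v (Bi *v gt)))) (P ** E s ** St ** E s ** P)) has_real_derivative R0 s) (at s)"
      by simp
    \<comment> \<open>The closed formula for \<open>G\<close> is available on the open interval
      only, hence the transfer of the derivative within an open set.\<close>
    show ?thesis
      by (rule has_field_derivative_transform_within_open[OF d, of "{0<..<t}"]) (use s G_eq in auto)
  qed
  have dG: "deriv G s = R0 s" if "s \<in> {0<..<t}" for s by (rule DERIV_imp_deriv[OF G'[OF that]])
  have cR0: "continuous_on Q R0" for Q
    unfolding R0_def
    using bounded_linear.continuous_on[OF Sc, of Q "\<lambda>s. (P *v (E s *v gt), P ** E s ** atl ** E s ** P)"]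
    by (simp add: continuous_intros cE)
  have "is_response t (\<lambda>h. \<integral>\<omega>. f (Xh h t \<omega>) \<partial>Mh h) (deriv G)"
    unfolding is_response_def
  proof (intro conjI allI impI)
    fix K0 :: "real set" assume K0: "compact K0 \<and> K0 \<subseteq> {0<..<t}"
    have "set_integrable lborel K0 R0"
      unfolding set_integrable_def using K0 cR0 by (intro borel_integrable_compact) auto
    moreover have "set_integrable lborel K0 (deriv G) = set_integrable lborel K0 R0"
      using K0 dG by (intro set_integrable_cong refl) auto
    ultimately show "set_integrable lborel K0 (deriv G)" by simp
  next
    fix \<phi> assume \<phi>: "Cc_inf_interval t \<phi>"
    have "\<phi> differentiable (at x)" for x
      using \<phi>[unfolded Cc_inf_interval_def, THEN conjunct1, THEN spec[of _ 0]] by simp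
    then have c\<phi>: "continuous_on Q \<phi>" for Q
      using differentiable_imp_continuous_within continuous_at_imp_continuous_on by blast
    define u where "u = integral {0..t} (\<lambda>r. \<phi> r *\<^sub>R (E r *v gt))"
    define Q where "Q = integral {0..t} (\<lambda>r. \<phi> r *\<^sub>R (E r ** atl ** E r))"
    have iu: "(\<lambda>r. \<phi> r *\<^sub>R (E r *v gt)) integrable_on {0..t}"
      by (intro integrable_continuous_real continuous_intros c\<phi> cE)
    have iQ: "(\<lambda>r. \<phi> r *\<^sub>R (E r ** atl ** E r)) integrable_on {0..t}"
      by (intro integrable_continuous_real continuous_intros c\<phi> cE)
    \<comment> \<open>Stated for a function \<open>h\<close> equal to the perturbation, so that it
      also covers the constant zero function, which arises from
      \<open>\<epsilon> = 0\<close>.\<close>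
    have char: "(\<integral>\<omega>. cos (\<xi> \<bullet> Xh h t \<omega> + \<theta>) \<partial>Mh h)
         = exp (- (\<xi> \<bullet> (\<Sigma> *v \<xi>) + \<epsilon> * (\<xi> \<bullet> (Q *v \<xi>))) / 2) * cos (\<xi> \<bullet> (m + \<epsilon> *\<^sub>R u) + \<theta>)"
        and h_ok: "prob_space (Mh h)" "Xh h t \<in> borel_measurable (Mh h)"
      if h: "h = (\<lambda>r. \<epsilon> * \<phi> r)" and h1: "\<And>r. r \<in> {0..T} \<Longrightarrow> \<bar>h r\<bar> \<le> 1"
        and h2: "\<And>r \<xi>. r \<in> {0..T} \<Longrightarrow> 0 \<le> \<xi> \<bullet> ((a + h r *\<^sub>R atl) *v \<xi>)" for \<epsilon> h \<xi> \<theta>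
    proof -
      have ch: "continuous_on {0..T} h" unfolding h by (intro continuous_intros c\<phi>)
      have H: "prob_space (Mh h)" "gaussian_vec (Mh h) (Xh h 0) m \<Sigma>"
        "diffusion_sol (Mh h) T (\<lambda>r x. B *v x + g + h r *\<^sub>R gt) (\<lambda>r. a + h r *\<^sub>R atl) (Xh h)"
        using Xh ch h1 h2 by blast+
      show "prob_space (Mh h)" by (rule H)
      show "Xh h t \<in> borel_measurable (Mh h)" using H(3) t unfolding diffusion_sol_def by blast
      have e1: "integral {0..t} (\<lambda>r. h r * ((E r *v \<xi>) \<bullet> (atl *v (E r *v \<xi>)))) = \<epsilon> * (\<xi> \<bullet> (Q *v \<xi>))"
      proof -
        have L: "bounded_linear (\<lambda>F :: real^'d^'d. \<epsilon> * (\<xi> \<bullet> (F *v \<xi>)))"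
          by (intro bounded_linear_const_mult bounded_linear_compose[OF bounded_linear_inner_right] bounded_bilinear.bounded_linear_left[OF matrix_vector_bb])
        have "\<epsilon> * (\<xi> \<bullet> ((\<phi> r *\<^sub>R (E r ** atl ** E r)) *v \<xi>)) = h r * ((E r *v \<xi>) \<bullet> (atl *v (E r *v \<xi>)))" for r
          using dot_transpose_mult[of \<xi> "E r" "atl *v (E r *v \<xi>)"]
          by (simp add: h bounded_bilinear.scaleR_left[OF matrix_vector_bb] E_sym flip: matrix_vector_mul_assoc)
        then show ?thesis using integral_linear[OF iQ L] unfolding Q_def by (simp add: o_def)
      qed
      have e2: "integral {0..t} (\<lambda>r. h r * ((E r *v \<xi>) \<bullet> gt)) = \<epsilon> * (\<xi> \<bullet> u)"
      proof -
        have L: "bounded_linear (\<lambda>x :: real^'d. \<epsilon> * (\<xi> \<bullet> x))"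
          by (intro bounded_linear_const_mult bounded_linear_inner_right)
        have "\<epsilon> * (\<xi> \<bullet> (\<phi> r *\<^sub>R (E r *v gt))) = h r * ((E r *v \<xi>) \<bullet> gt)" for r
          using dot_transpose_mult[of \<xi> "E r" gt] by (simp add: h E_sym)
        then show ?thesis using integral_linear[OF iu L] unfolding u_def by (simp add: o_def)
      qed
      show "(\<integral>\<omega>. cos (\<xi> \<bullet> Xh h t \<omega> + \<theta>) \<partial>Mh h)
         = exp (- (\<xi> \<bullet> (\<Sigma> *v \<xi>) + \<epsilon> * (\<xi> \<bullet> (Q *v \<xi>))) / 2) * cos (\<xi> \<bullet> (m + \<epsilon> *\<^sub>R u) + \<theta>)"
        using diffusion_char[OF H(1) t B_sym Bm S_eq ch H(3) H(2) S_psd, of \<xi> \<theta>, folded E_def]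
        unfolding e1 e2 by (simp add: inner_add_right)
    qed
    have F0: "(\<integral>\<omega>. f (Xh (\<lambda>_. 0) t \<omega>) \<partial>Mh (\<lambda>_. 0)) = (\<integral>\<omega>. f (m + Y \<omega>) \<partial>M)"
    proof -
      have z: "(\<lambda>_. 0) = (\<lambda>r. 0 * \<phi> r)" by simp
      have a0: "0 \<le> \<xi> \<bullet> ((a + 0 *\<^sub>R atl) *v \<xi>)" for \<xi> using apos[of \<xi>] by (cases "\<xi> = 0") auto
      note c = char[OF z] and ok = h_ok[OF z]
      have "(\<integral>\<omega>. f (Xh (\<lambda>_. 0) t \<omega>) \<partial>Mh (\<lambda>_. 0)) = (\<integral>\<omega>. f (X 0 \<omega>) \<partial>M)"
      proof (rule expectation_eq_of_char_eq[OF ok(1) M ok(2) _ _ fC(1) fb(1)])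
        show "X 0 \<in> borel_measurable M" using X0 by (simp add: gaussian_vec_def)
        show "(\<integral>\<omega>. cos (\<xi> \<bullet> Xh (\<lambda>_. 0) t \<omega> + \<theta>) \<partial>Mh (\<lambda>_. 0)) = (\<integral>\<omega>. cos (\<xi> \<bullet> X 0 \<omega> + \<theta>) \<partial>M)" for \<xi> \<theta>
          using c[of \<xi> \<theta>] a0 gaussian_vec_char[OF M X0 S_psd] by simp
      qed (use a0 in auto)
      then show ?thesis by (simp only: fY)
    qed
    obtain \<Phi> where \<Phi>: "0 \<le> \<Phi>" "\<And>r. r \<in> {0..T} \<Longrightarrow> norm (\<phi> r) \<le> \<Phi>"
      using continuous_on_interval_bounded[OF c\<phi>] by blast
    define k where "k = onorm ((*v) atl)"
    have k: "norm (atl *v v) \<le> k * norm v" "0 \<le> k" for v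
      unfolding k_def by (auto intro: onorm onorm_pos_le)
    \<comment> \<open>Small enough for both admissibility conditions:
      \<open>\<epsilon> * \<phi> r\<close> stays within 1, and its product with the norm
      \<open>k\<close> of \<open>atl\<close> stays below the ellipticity constant. The added ones
      keep the denominator positive.\<close>
    define \<delta> where "\<delta> = min 1 lam / ((\<Phi> + 1) * (k + 1))"
    have \<delta>: "0 < \<delta>" using ellip(1) \<Phi>(1) k(2) by (simp add: \<delta>_def)
    have small: "\<bar>\<epsilon> * \<phi> r\<bar> \<le> 1" "\<bar>\<epsilon> * \<phi> r\<bar> * k \<le> lam" if \<epsilon>: "\<bar>\<epsilon>\<bar> < \<delta>" and r: "r \<in> {0..T}" for \<epsilon> r
    proof -
      have "\<bar>\<epsilon> * \<phi> r\<bar> * (k + 1) \<le> \<delta> * (\<Phi> + 1) * (k + 1)"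
        unfolding abs_mult using \<epsilon> \<Phi>(2)[OF r] k(2) by (intro mult_right_mono mult_mono) auto
      also have "\<dots> = min 1 lam" using \<Phi>(1) k(2) by (simp add: \<delta>_def)
      finally have b: "\<bar>\<epsilon> * \<phi> r\<bar> * (k + 1) \<le> min 1 lam" .
      have "\<bar>\<epsilon> * \<phi> r\<bar> * 1 \<le> \<bar>\<epsilon> * \<phi> r\<bar> * (k + 1)" "\<bar>\<epsilon> * \<phi> r\<bar> * k \<le> \<bar>\<epsilon> * \<phi> r\<bar> * (k + 1)"
        using k(2) by (intro mult_left_mono; simp)+
      then show "\<bar>\<epsilon> * \<phi> r\<bar> \<le> 1" "\<bar>\<epsilon> * \<phi> r\<bar> * k \<le> lam" using b by linarith+
    qed
    \<comment> \<open>Uniform ellipticity of \<open>a\<close> absorbs the perturbation of the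
      diffusion matrix.\<close>
    have psd_h: "0 \<le> \<xi> \<bullet> ((a + (\<epsilon> * \<phi> r) *\<^sub>R atl) *v \<xi>)" if \<epsilon>: "\<bar>\<epsilon>\<bar> < \<delta>" and r: "r \<in> {0..T}" for \<epsilon> r \<xi>
    proof -
      have "\<bar>\<xi> \<bullet> (atl *v \<xi>)\<bar> \<le> norm \<xi> * (k * norm \<xi>)"
        by (intro order.trans[OF Cauchy_Schwarz_ineq2] mult_left_mono k) auto
      then have "\<bar>\<epsilon> * \<phi> r\<bar> * \<bar>\<xi> \<bullet> (atl *v \<xi>)\<bar> \<le> \<bar>\<epsilon> * \<phi> r\<bar> * (norm \<xi> * (k * norm \<xi>))"
        by (intro mult_left_mono) auto
      also have "\<dots> = (\<bar>\<epsilon> * \<phi> r\<bar> * k) * (norm \<xi>)\<^sup>2" by (simp add: power2_eq_square)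
      also have "\<dots> \<le> lam * (norm \<xi>)\<^sup>2" by (intro mult_right_mono small(2)[OF \<epsilon> r]) simp
      also have "\<dots> \<le> \<xi> \<bullet> (a *v \<xi>)" using ellip(2) by blast
      finally have "\<bar>\<epsilon> * \<phi> r * (\<xi> \<bullet> (atl *v \<xi>))\<bar> \<le> \<xi> \<bullet> (a *v \<xi>)" by (simp only: abs_mult)
      then show ?thesis
        by (simp add: matrix_vector_mult_add_rdistrib inner_add_right bounded_bilinear.scaleR_left[OF matrix_vector_bb] abs_le_iff)
    qed
    have "((\<lambda>\<epsilon>. ((\<integral>\<omega>. f (Xh (\<lambda>r. \<epsilon> * \<phi> r) t \<omega>) \<partial>Mh (\<lambda>r. \<epsilon> * \<phi> r)) - (\<integral>\<omega>. f (m + Y \<omega>) \<partial>M)) / \<epsilon>)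
      \<longlongrightarrow> gaussian_score M Y (\<lambda>\<omega>. f (m + Y \<omega>)) (matrix_inv \<Sigma> *v u) (matrix_inv \<Sigma> ** Q ** matrix_inv \<Sigma>)) (at 0)"
    proof (rule gaussian_perturbation[OF M Y S_sym S_pos fC(1,2,3) fC(4,5) fb(3) fb(1,2)])
      have "\<forall>\<^sub>F \<epsilon> in at 0. \<bar>\<epsilon>\<bar> < \<delta>"
        using \<delta> by (auto simp: eventually_at dist_real_def intro!: exI[of _ \<delta>])
      then show "\<forall>\<^sub>F \<epsilon> in at 0. prob_space (Mh (\<lambda>r. \<epsilon> * \<phi> r)) \<and> Xh (\<lambda>r. \<epsilon> * \<phi> r) t \<in> borel_measurable (Mh (\<lambda>r. \<epsilon> * \<phi> r)) \<and>
        (\<forall>\<xi> \<theta>. (\<integral>\<omega>. cos (\<xi> \<bullet> Xh (\<lambda>r. \<epsilon> * \<phi> r) t \<omega> + \<theta>) \<partial>Mh (\<lambda>r. \<epsilon> * \<phi> r))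
         = exp (- (\<xi> \<bullet> (\<Sigma> *v \<xi>) + \<epsilon> * (\<xi> \<bullet> (Q *v \<xi>))) / 2) * cos (\<xi> \<bullet> (m + \<epsilon> *\<^sub>R u) + \<theta>))"
      proof (rule eventually_mono, intro conjI allI)
        fix \<epsilon> :: real and \<xi> \<theta> assume \<epsilon>: "\<bar>\<epsilon>\<bar> < \<delta>"
        show "prob_space (Mh (\<lambda>r. \<epsilon> * \<phi> r))" by (rule h_ok(1)[OF refl small(1)[OF \<epsilon>] psd_h[OF \<epsilon>]])
        show "Xh (\<lambda>r. \<epsilon> * \<phi> r) t \<in> borel_measurable (Mh (\<lambda>r. \<epsilon> * \<phi> r))" by (rule h_ok(2)[OF refl small(1)[OF \<epsilon>] psd_h[OF \<epsilon>]])
        show "(\<integral>\<omega>. cos (\<xi> \<bullet> Xh (\<lambda>r. \<epsilon> * \<phi> r) t \<omega> + \<theta>) \<partial>Mh (\<lambda>r. \<epsilon> * \<phi> r))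
         = exp (- (\<xi> \<bullet> (\<Sigma> *v \<xi>) + \<epsilon> * (\<xi> \<bullet> (Q *v \<xi>))) / 2) * cos (\<xi> \<bullet> (m + \<epsilon> *\<^sub>R u) + \<theta>)"
          by (rule char[OF refl small(1)[OF \<epsilon>] psd_h[OF \<epsilon>]])
      qed
    qed
    moreover have "gaussian_score M Y (\<lambda>\<omega>. f (m + Y \<omega>)) (matrix_inv \<Sigma> *v u) (matrix_inv \<Sigma> ** Q ** matrix_inv \<Sigma>)
       = (\<integral>s\<in>{0<..<t}. deriv G s * \<phi> s \<partial>lborel)"
    proof -
      have L1: "bounded_linear (\<lambda>x. Sc (P *v x) 0)" and L2: "bounded_linear (\<lambda>F. Sc 0 (P ** F ** P))"
      proof -
        have "bounded_linear (\<lambda>x. (P *v x, 0 :: real^'d^'d))"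
          by (intro bounded_linear_Pair bounded_bilinear.bounded_linear_right[OF matrix_vector_bb] bounded_linear_zero)
        from bounded_linear_compose[OF Sc this] show "bounded_linear (\<lambda>x. Sc (P *v x) 0)" by simp
        have "bounded_linear (\<lambda>F. (0 :: real^'d, P ** F ** P))"
          by (intro bounded_linear_Pair bounded_linear_zero
              bounded_linear_compose[OF bounded_bilinear.bounded_linear_left[OF matrix_mult_bb]] bounded_bilinear.bounded_linear_right[OF matrix_mult_bb])
        from bounded_linear_compose[OF Sc this] show "bounded_linear (\<lambda>F. Sc 0 (P ** F ** P))" by simp
      qed
      \<comment> \<open>Splitting the score into a functional of the vector and one of the matrix
        lets each be exchanged with its own time integral.\<close>
      have add: "Sc v F = Sc v 0 + Sc 0 F" for v F
        using linear_add[OF bounded_linear.linear[OF Sc], of "(v, 0)" "(0, F)"] by simp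
      have R0\<phi>: "R0 r * \<phi> r = Sc (P *v (\<phi> r *\<^sub>R (E r *v gt))) 0 + Sc 0 (P ** (\<phi> r *\<^sub>R (E r ** atl ** E r)) ** P)" for r
        using linear_scale[OF bounded_linear.linear[OF L1], of "\<phi> r" "E r *v gt"]
          linear_scale[OF bounded_linear.linear[OF L2], of "\<phi> r" "E r ** atl ** E r"]
          add[of "P *v (E r *v gt)" "P ** E r ** atl ** E r ** P"]
        by (simp add: R0_def matrix_mul_assoc algebra_simps)
      have "Sc (P *v u) (P ** Q ** P) = Sc (P *v u) 0 + Sc 0 (P ** Q ** P)" by (rule add)
      also have "\<dots> = integral {0..t} (\<lambda>r. R0 r * \<phi> r)"
        unfolding R0\<phi>
        using integral_linear[OF iu L1] integral_linear[OF iQ L2] integrable_linear[OF iu L1] integrable_linear[OF iQ L2]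
        by (simp add: u_def[symmetric] Q_def[symmetric] o_def Henstock_Kurzweil_Integration.integral_add)
      also have "\<dots> = integral {0<..<t} (\<lambda>r. R0 r * \<phi> r)" by (rule integral_open_interval_real)
      also have "\<dots> = (\<integral>s\<in>{0<..<t}. R0 s * \<phi> s \<partial>lborel)"
      proof -
        have "set_integrable lborel {0..t} (\<lambda>r. R0 r * \<phi> r)"
          unfolding set_integrable_def by (intro borel_integrable_compact continuous_intros cR0 c\<phi>) auto
        then have "set_integrable lborel {0<..<t} (\<lambda>r. R0 r * \<phi> r)" by (rule set_integrable_subset) auto
        then show ?thesis by (simp add: set_borel_integral_eq_integral(2))
      qed
      also have "\<dots> = (\<integral>s\<in>{0<..<t}. deriv G s * \<phi> s \<partial>lborel)"
        using dG by (intro set_lebesgue_integral_cong) auto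
      finally show ?thesis by (simp add: Sc_def P_def)
    qed
    ultimately show "((\<lambda>\<epsilon>. ((\<integral>\<omega>. f (Xh (\<lambda>r. \<epsilon> * \<phi> r) t \<omega>) \<partial>Mh (\<lambda>r. \<epsilon> * \<phi> r)) - (\<integral>\<omega>. f (Xh (\<lambda>_. 0) t \<omega>) \<partial>Mh (\<lambda>_. 0))) / \<epsilon>)
      \<longlongrightarrow> (\<integral>s\<in>{0<..<t}. deriv G s * \<phi> s \<partial>lborel)) (at 0)"
      unfolding F0 by simp
  qed
  moreover have "\<forall>s\<in>{0<..<t}. G differentiable (at s)"
    using G' real_differentiable_def by blast
  ultimately show ?thesis unfolding G_def[abs_def] by blast
qed

end
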